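(* The following three statements are equivalent: (1) For all positive integers $d$ and $q$, every continuous map $f:\Delta^{(d+1)(q-1)}\to\mathbb{R}^d$ has at least $((q-1)!)^d$ Tverberg partitions. (2) For all positive integers $d$ and $q$, every continuous map $f:\Delta_d^{(d+1)(q-1)}\to\mathbb{R}^d$ has at least $((q-1)!)^d$ Tverberg partitions. (3) For all positive integers $d$ and $q$, every continuous map $f:\Delta_{d-1}^{(d+1)(q-1)}\to\mathbb{R}^d$ has at least $((q-1)!)^d$ winding partitions.
   Context: For integers $N\ge 0$ and $0\le k\le N$, $\Delta^N$ denotes the $N$-dimensional simplex (with $N+1$ vertices) and $\Delta^N_k$ its $k$-skeleton; faces are identified with their geometric realizations, and two faces are disjoint if they share no vertex. For a map $f$ from $\Delta_k^{(d+1)(q-1)}$ to $\mathbb{R}^d$, a Tverberg partition of $f$ is a set of $q$ pairwise disjoint faces $\sigma_1,\dots,\sigma_q$ of $\Delta_k^{(d+1)(q-1)}$ with $\bigcap_i f(\sigma_i)\neq\emptyset$. Winding numbers: let $\partial\Delta^d=\Delta^d_{d-1}\cong\mathbb{S}^{d-1}$. For a continuous $g:\partial\Delta^d\to\mathbb{R}^d$ and $p\notin g(\partial\Delta^d)$: if $d\ge2$, "$W(g,p)\neq0$" means that $g$ represents a nonzero element of $\pi_{d-1}(\mathbb{R}^d\setminus\{p\})\cong\mathbb{Z}$; if $d=1$, "$W(g,p)\ne 0$" means that the two points of $g(\partial\Delta^1)$ lie in different components of $\mathbb{R}\setminus\{p\}$. Set $W_{\neq0}(g):=g(\partial\Delta^d)\cup\{x\in\mathbb{R}^d\setminus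 g(\partial\Delta^d): W(g,x)\neq0\}$. For a continuous $f:\Delta_{d-1}^{(d+1)(q-1)}\to\mathbb{R}^d$, a winding partition of $f$ is a set of $q$ pairwise disjoint faces $\sigma_1,\dots,\sigma_q$ of $\Delta^{(d+1)(q-1)}$, each of dimension at most $d$, for which there exists $p\in\mathbb{R}^d$ such that for every $i$: if $\dim\sigma_i\le d-1$ then $p\in f(\sigma_i)$, and if $\dim\sigma_i=d$ then $p\in W_{\neq0}(f|_{\partial\sigma_i})$. Partitions are counted as sets of faces. *)

theory Defs
  imports "HOL-Homology.Homology"
begin

text \<open>
  A nonempty face of \<open>\<Delta>\<^sup>N\<close> is represented by its set of vertices, a nonempty subset of \<open>{..N}\<close>;
  two faces share no vertex iff these sets are disjoint. Points are given by their barycentric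
  coordinates, as in \<^const>\<open>standard_simplex\<close>, and \<open>\<real>\<^sup>d\<close> is \<^term>\<open>Euclidean_space d\<close>,
  the sequences vanishing from index \<open>d\<close> on.
\<close>

definition face_dim :: "nat set \<Rightarrow> nat"
  where "face_dim A = card A - 1"

text \<open>For \<open>k > N\<close>, \<open>faces N k\<close> consists of all faces of \<open>\<Delta>\<^sup>N\<close>.\<close>

definition faces :: "nat \<Rightarrow> nat \<Rightarrow> nat set set"
  where "faces N k = {A. A \<noteq> {} \<and> A \<subseteq> {..N} \<and> face_dim A \<le> k}"

definition realization :: "nat set \<Rightarrow> (nat \<Rightarrow> real) set"
  where "realization A = {x. (\<forall>i. 0 \<le> x i) \<and> (\<forall>i. i \<notin> A \<longrightarrow> x i = 0) \<and> (\<Sum>i\<in>A. x i) = 1}"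

definition skeleton :: "nat \<Rightarrow> nat \<Rightarrow> (nat \<Rightarrow> real) set"
  where "skeleton N k = (\<Union>A\<in>faces N k. realization A)"

definition boundary :: "nat set \<Rightarrow> (nat \<Rightarrow> real) set"
  where "boundary A = (\<Union>B\<in>{B. B \<noteq> {} \<and> B \<subset> A}. realization B)"

abbreviation tverberg_dim :: "nat \<Rightarrow> nat \<Rightarrow> nat"
  where "tverberg_dim d q \<equiv> (d + 1) * (q - 1)"

abbreviation coord_top :: "(nat \<Rightarrow> real) set \<Rightarrow> (nat \<Rightarrow> real) topology"
  where "coord_top S \<equiv> subtopology (powertop_real UNIV) S"

lemma realization_atMost: "realization {..N} = standard_simplex N"
proof -
  have "x i \<le> 1" if "\<forall>i. 0 \<le> x i" "\<forall>i. i \<notin> {..N} \<longrightarrow> x i = 0" "sum x {..N} = 1"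
    for x :: "nat \<Rightarrow> real" and i
  proof (cases "i \<in> {..N}")
    case True
    then have "x i \<le> sum x {..N}"
      using that by (intro member_le_sum) auto
    then show ?thesis using that by simp
  next
    case False
    then show ?thesis using that by simp
  qed
  then show ?thesis
    by (auto simp: realization_def standard_simplex_def not_le)
qed

lemma realization_mono:
  assumes "A \<subseteq> B" "finite B"
  shows "realization A \<subseteq> realization B"
proof
  fix x assume x: "x \<in> realization A"
  then have "sum x B = sum x A"
    using assms by (intro sum.mono_neutral_right) (auto simp: realization_def)
  then show "x \<in> realization B"
    using x assms by (auto simp: realization_def)
qed

lemma skeleton_full: "skeleton N N = standard_simplex N"
proof -
  have "{..N} \<in> faces N N"
    by (auto simp: faces_def face_dim_def)
  moreover have "realization A \<subseteq> realization {..N}" if "A \<in> faces N N" for A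
    using that by (intro realization_mono) (auto simp: faces_def)
  ultimately show ?thesis
    unfolding skeleton_def realization_atMost[symmetric] by blast
qed

lemma boundary_atMost:
  assumes "d > 0"
  shows "boundary {..d} = skeleton d (d - 1)"
proof -
  have "B \<subset> {..d} \<longleftrightarrow> B \<subseteq> {..d} \<and> face_dim B \<le> d - 1" for B
  proof
    assume B: "B \<subset> {..d}"
    then have "card B < Suc d"
      using psubset_card_mono[OF _ B] by simp
    then show "B \<subseteq> {..d} \<and> face_dim B \<le> d - 1"
      using B by (simp add: face_dim_def psubset_imp_subset)
  next
    assume B: "B \<subseteq> {..d} \<and> face_dim B \<le> d - 1"
    then have "B \<noteq> {..d}"
      using assms by (auto simp: face_dim_def)
    then show "B \<subset> {..d}"
      using B by blast
  qed
  then have "{B. B \<noteq> {} \<and> B \<subset> {..d}} = faces d (d - 1)"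
    by (simp add: faces_def)
  then show ?thesis
    by (simp add: boundary_def skeleton_def)
qed

definition vertex :: "nat \<Rightarrow> nat \<Rightarrow> real"
  where "vertex v = (\<lambda>i. if i = v then 1 else 0)"

definition pointed_homotopy_class ::
    "'a topology \<Rightarrow> 'a \<Rightarrow> 'b topology \<Rightarrow> ('a \<Rightarrow> 'b) \<Rightarrow> ('a \<Rightarrow> 'b) set"
  where "pointed_homotopy_class S s X g = {h. homotopic_with (\<lambda>k. k s = g s) S X g h}"

definition punctured_space :: "nat \<Rightarrow> (nat \<Rightarrow> real) \<Rightarrow> (nat \<Rightarrow> real) topology"
  where "punctured_space d p = subtopology (Euclidean_space d) (topspace (Euclidean_space d) - {p})"

text \<open>
  \<open>winding_nonzero d A g p\<close> expresses \<open>W(g, p) \<noteq> 0\<close> for a map \<open>g\<close> on the boundary of a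
  \<open>d\<close>-simplex with vertex set \<open>A\<close>, where \<open>p\<close> is not in the image. For \<open>d \<ge> 2\<close>, the boundary is a
  \<open>(d - 1)\<close>-sphere, based at its least vertex \<open>b\<close>. The map \<open>g\<close> represents an element of the
  homotopy group of the punctured space with base point \<open>g b\<close>, whose zero element is the class
  of the constant map. As the punctured space is path connected and simple, the choice of base
  point is immaterial.
\<close>

definition winding_nonzero ::
    "nat \<Rightarrow> nat set \<Rightarrow> ((nat \<Rightarrow> real) \<Rightarrow> nat \<Rightarrow> real) \<Rightarrow> (nat \<Rightarrow> real) \<Rightarrow> bool"
  where "winding_nonzero d A g p \<longleftrightarrow>
    (if d = 1
     then \<exists>x\<in>boundary A. \<exists>y\<in>boundary A.
            \<not> connected_component_of (punctured_space d p) (g x) (g y)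
     else let b = vertex (Min A) in
            pointed_homotopy_class (coord_top (boundary A)) b (punctured_space d p) g \<noteq>
            pointed_homotopy_class (coord_top (boundary A)) b (punctured_space d p) (\<lambda>_. g b))"

definition winding_set ::
    "nat \<Rightarrow> nat set \<Rightarrow> ((nat \<Rightarrow> real) \<Rightarrow> nat \<Rightarrow> real) \<Rightarrow> (nat \<Rightarrow> real) set"
  where "winding_set d A g =
    g ` boundary A \<union>
    {x \<in> topspace (Euclidean_space d) - g ` boundary A. winding_nonzero d A g x}"

text \<open>Both notions of partition concern a map on \<open>skeleton N k\<close>, with \<open>k = d - 1\<close> in the second.\<close>

definition tverberg_partitions ::
    "nat \<Rightarrow> nat \<Rightarrow> nat \<Rightarrow> ((nat \<Rightarrow> real) \<Rightarrow> nat \<Rightarrow> real) \<Rightarrow> nat set set set"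
  where "tverberg_partitions N k q f =
    {P. P \<subseteq> faces N k \<and> card P = q \<and> disjoint P \<and> (\<Inter>A\<in>P. f ` realization A) \<noteq> {}}"

definition winding_partitions ::
    "nat \<Rightarrow> nat \<Rightarrow> nat \<Rightarrow> ((nat \<Rightarrow> real) \<Rightarrow> nat \<Rightarrow> real) \<Rightarrow> nat set set set"
  where "winding_partitions N d q f =
    {P. P \<subseteq> faces N d \<and> card P = q \<and> disjoint P \<and>
        (\<exists>p\<in>topspace (Euclidean_space d). \<forall>A\<in>P.
           (face_dim A \<le> d - 1 \<longrightarrow> p \<in> f ` realization A) \<and>
           (face_dim A = d \<longrightarrow> p \<in> winding_set d A f))}"

end

theory Submission
  imports Defs "HOL-Analysis.Weierstrass_Theorems" "HOL-Combinatorics.Permutations"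
begin

text \<open>
  A winding partition of the restriction to the \<open>(d - 1)\<close>-skeleton is a Tverberg partition, because a map on
  the boundary of a simplex with an extension missing \<open>p\<close> is null-homotopic in the complement of \<open>p\<close>; and a
  Tverberg partition of a restriction is one of the map itself. Hence (3) implies (2) implies (1).

  For (1) implies (3), statement (1) is used in dimension \<open>d + 1\<close>. Working in dimension \<open>d\<close> alone fails for
  \<open>d = 2\<close>: a loop may have winding number zero around several points without being null-homotopic in
  the complement of all of them. By compactness it suffices to treat generic maps \<open>f\<close>, a small
  Lipschitz approximation being made generic by a linear perturbation. For generic \<open>f\<close>, the faces of
  dimension less than \<open>d\<close> of a partition meet only if all vertices are used, and they meet in a set \<open>I\<close> that
  avoids a fine grid, so the pieces of \<open>I\<close> in the grid cells can be given distinct heights. Add \<open>q - 1\<close>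
  vertices and map to \<open>\<real>\<^sup>d \<times> \<real>\<close>; the second coordinate is the weight of the new vertices plus a function \<open>g\<close>
  vanishing unless the vertex \<open>N\<close> is used, and in \<open>\<real>\<^sup>d\<close> one uses, at the height of each cell, an
  extension of \<open>f\<close> to the \<open>d\<close>-faces that avoids this cell whenever possible. On a face containing \<open>N\<close>, \<open>g\<close> is
  the height of the cell, or its negative if the boundary of the face does not wind around the cell. In a
  Tverberg partition of this map, the face containing \<open>N\<close> has no new vertex and each other face has exactly
  one, since otherwise the common height is zero, which genericity excludes. Removing the new
  vertices gives an approximate winding partition, which arises from at most \<open>(q - 1)!\<close> Tverberg partitions.
\<close>

section \<open>Extensions and winding numbers\<close>

text \<open>One extra dimension costs exactly \<open>q - 1\<close> vertices and one factor
  \<open>(q - 1)!\<close>, and the same factor counts the ways to attach these vertices again; this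
  is why the bound survives the detour. The obstacle is that an extension of \<open>f\<close> to the
  \<open>d\<close>-faces can be made to avoid one cell where this is possible, but not all such
  cells at once. The extra coordinate separates the cells: the level of a coincidence tells its
  cell, so the extension used at this level has to treat only this cell well. Levels of neighbouring
  cells are unrelated, yet they must form a continuous function; hence the grid has to be avoided.
  The sign of the level deals with the face through \<open>N\<close>: without new vertices it sits
  at new weight 0, where its extension is not controlled. If it could avoid the cell, its level is
  made negative, whereas the levels of the other faces are never negative. Winding numbers occur
  only at the two ends of the argument. In between, the condition that every extension meets the
  cell replaces them; up to a small error it withstands perturbation and passage to the
  limit.\<close>

abbreviation coords :: "nat \<Rightarrow> (nat \<Rightarrow> real) set"
  where "coords d \<equiv> {x. \<forall>i\<ge>d. x i = 0}"

lemma coord_top_eq: "coord_top S = top_of_set S"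
  by (simp add: euclidean_product_topology)

lemma Euclidean_space_eq: "Euclidean_space d = top_of_set (coords d)"
  by (simp add: Euclidean_space_def euclidean_product_topology)

lemma continuous_map_coord_top_iff:
  "continuous_map (coord_top S) (Euclidean_space d) f \<longleftrightarrow> continuous_on S f \<and> f \<in> S \<rightarrow> coords d"
  by (simp add: coord_top_eq Euclidean_space_eq)

lemma continuous_on_coordinate:
  assumes "continuous_on S f"
  shows "continuous_on S (\<lambda>x. f x (i::nat) :: real)"
  using assms by (rule continuous_on_product_then_coordinatewise)

lemma continuous_on_apply [continuous_intros]: "continuous_on S (\<lambda>x :: nat \<Rightarrow> real. x i)"
  by (rule continuous_on_coordinate[OF continuous_on_id])

text \<open>Tychonoff's theorem: the carrier is the infinite product
  \<open>nat \<Rightarrow> real\<close>, in which closed bounded sets need not be compact.\<close>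

lemma compact_box:
  fixes a b :: "nat \<Rightarrow> real"
  shows "compact {x. \<forall>i. a i \<le> x i \<and> x i \<le> b i}"
proof -
  have "{x. \<forall>i. a i \<le> x i \<and> x i \<le> b i} = PiE UNIV (\<lambda>i. {a i..b i})"
    by (auto simp: PiE_def Pi_def)
  moreover have "compactin (powertop_real UNIV) (PiE UNIV (\<lambda>i. {a i..b i}))"
    by (subst compactin_PiE) auto
  ultimately show ?thesis by (simp add: euclidean_product_topology)
qed

section \<open>Simplices, skeleta and boundaries as compact sets\<close>

lemma realization_bounds:
  assumes "finite A" "x \<in> realization A"
  shows "0 \<le> x i" "x i \<le> 1"
proof -
  show "0 \<le> x i" using assms by (auto simp: realization_def)
  show "x i \<le> 1"
  proof (cases "i \<in> A")
    case True
    then have "x i \<le> sum x A"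
      using assms by (intro member_le_sum) (auto simp: realization_def)
    then show ?thesis using assms by (auto simp: realization_def)
  qed (use assms in \<open>auto simp: realization_def\<close>)
qed

lemma compact_realization:
  assumes "finite A"
  shows "compact (realization A)"
proof -
  have "realization A = {x. \<forall>i. 0 \<le> x i \<and> x i \<le> (if i \<in> A then 1 else 0)} \<inter> {x. sum x A = 1}"
  proof (intro equalityI subsetI)
    fix x assume x: "x \<in> realization A"
    then show "x \<in> {x. \<forall>i. 0 \<le> x i \<and> x i \<le> (if i \<in> A then 1 else 0)} \<inter> {x. sum x A = 1}"
      using realization_bounds[OF assms x] by (simp add: realization_def)
  next
    fix x :: "nat \<Rightarrow> real"
    assume x: "x \<in> {x. \<forall>i. 0 \<le> x i \<and> x i \<le> (if i \<in> A then 1 else 0)} \<inter> {x. sum x A = 1}"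
    then have "x i = 0" if "i \<notin> A" for i
      using that by (auto intro: antisym dest!: spec[of _ i])
    then show "x \<in> realization A"
      using x by (simp add: realization_def)
  qed
  moreover have "closed {x. sum x A = (1::real)}"
    by (intro closed_Collect_eq continuous_on_sum continuous_intros)
  ultimately show ?thesis
    using compact_box[of "\<lambda>_. 0" "\<lambda>i. if i \<in> A then 1 else 0"] by (simp add: compact_Int_closed)
qed

lemma finite_faces: "finite (faces N k)"
  by (rule finite_subset[of _ "Pow {..N}"]) (auto simp: faces_def)

lemma facesD:
  assumes "A \<in> faces N k"
  shows "finite A" "A \<noteq> {}" "A \<subseteq> {..N}" "card A \<le> k + 1"
  using assms by (auto simp: faces_def face_dim_def finite_subset)

lemma faces_mono: "k \<le> l \<Longrightarrow> faces N k \<subseteq> faces N l"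
  by (auto simp: faces_def)

lemma compact_skeleton: "compact (skeleton N k)"
  unfolding skeleton_def using finite_faces facesD(1)
  by (intro compact_UN compact_realization) blast+

lemma compact_boundary: "finite A \<Longrightarrow> compact (boundary A)"
  unfolding boundary_def by (intro compact_UN compact_realization) (auto intro: finite_subset)

lemma boundary_subset: "finite A \<Longrightarrow> boundary A \<subseteq> realization A"
  unfolding boundary_def using realization_mono by blast

lemma realization_nonempty_set: "x \<in> realization A \<Longrightarrow> A \<noteq> {}"
  by (auto simp: realization_def)

lemma vertex_in_realization: "finite A \<Longrightarrow> v \<in> A \<Longrightarrow> vertex v \<in> realization A"
  by (auto simp: realization_def vertex_def)

lemma Tietze_coords:
  fixes f :: "'a::{metric_space,second_countable_topology} \<Rightarrow> nat \<Rightarrow> real"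
  assumes "closed S" "continuous_on S f" "f \<in> S \<rightarrow> coords d"
  obtains g where "continuous_on UNIV g" "\<And>x. g x \<in> coords d" "\<And>x. x \<in> S \<Longrightarrow> g x = f x"
proof -
  have "\<exists>g. continuous_on UNIV g \<and> (\<forall>x\<in>S. g x = f x i)" for i
    by (rule Tietze_unbounded[of S "\<lambda>x. f x i" UNIV])
       (use assms in \<open>auto intro!: continuous_on_coordinate\<close>)
  then obtain G where G: "\<And>i. continuous_on UNIV (G i)" "\<And>i x. x \<in> S \<Longrightarrow> G i x = f x i"
    by metis
  show thesis
  proof (rule that[of "\<lambda>x i. if i < d then G i x else 0"])
    show "continuous_on UNIV (\<lambda>x i. if i < d then G i x else 0)"
    proof (rule continuous_on_coordinatewise_then_product)
      show "continuous_on UNIV (\<lambda>x. if i < d then G i x else 0)" for i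
        using G(1) by (cases "i < d") auto
    qed
  qed (use assms G(2) in \<open>auto simp: fun_eq_iff Pi_def not_less\<close>)
qed

lemma Tietze_coords_bounded:
  fixes f :: "'a::{metric_space,second_countable_topology} \<Rightarrow> nat \<Rightarrow> real"
  assumes "closed S" "continuous_on S f" "f \<in> S \<rightarrow> coords d" "0 \<le> B"
    and "\<And>x i. x \<in> S \<Longrightarrow> \<bar>f x i\<bar> \<le> B"
  obtains g where "continuous_on UNIV g" "\<And>x. g x \<in> coords d" "\<And>x. x \<in> S \<Longrightarrow> g x = f x"
    "\<And>x i. \<bar>g x i\<bar> \<le> B"
proof -
  have "\<exists>g. continuous_on UNIV g \<and> (\<forall>x\<in>S. g x = f x i) \<and> (\<forall>x. \<bar>g x\<bar> \<le> B)" for i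
    by (rule Tietze[of S "\<lambda>x. f x i" UNIV B])
       (use assms in \<open>auto intro!: continuous_on_coordinate\<close>)
  then obtain G where G: "\<And>i. continuous_on UNIV (G i)" "\<And>i x. x \<in> S \<Longrightarrow> G i x = f x i"
     "\<And>i x. \<bar>G i x\<bar> \<le> B"
    by metis
  show thesis
  proof (rule that[of "\<lambda>x i. if i < d then G i x else 0"])
    show "continuous_on UNIV (\<lambda>x i. if i < d then G i x else 0)"
    proof (rule continuous_on_coordinatewise_then_product)
      show "continuous_on UNIV (\<lambda>x. if i < d then G i x else 0)" for i
        using G(1) by (cases "i < d") auto
    qed
  qed (use assms G(2,3) in \<open>auto simp: fun_eq_iff Pi_def not_less\<close>)
qed

text \<open>Homotopy extension: extend the homotopy to a map into \<open>\<real>\<^sup>d\<close>, and stop it at the constant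
  map on the set where it runs through \<open>p\<close>.\<close>

lemma nullhomotopic_imp_extension:
  fixes S X :: "(nat \<Rightarrow> real) set"
  assumes hom: "homotopic_with (\<lambda>_. True) (top_of_set S) (top_of_set (coords d - {p})) g (\<lambda>_. c)"
    and S: "closed S" "S \<subseteq> X" "S \<noteq> {}" and X: "compact X"
  obtains G where "continuous_on X G" "G \<in> X \<rightarrow> coords d - {p}" "\<And>x. x \<in> S \<Longrightarrow> G x = g x"
proof -
  obtain h where h: "continuous_on ({0..1} \<times> S) h" "h \<in> ({0..1::real} \<times> S) \<rightarrow> coords d - {p}"
    "\<And>x. x \<in> S \<Longrightarrow> h (0, x) = g x" "\<And>x. x \<in> S \<Longrightarrow> h (1, x) = c"
    using hom unfolding homotopic_with_def by (auto simp: image_subset_iff Pi_iff)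
  have c: "c \<in> coords d - {p}" using h(2,4) S(3) by force
  \<comment> \<open>The homotopy on the cylinder over \<open>S\<close> is joined with the constant
    \<open>c\<close> on the whole of \<open>X\<close> at time 1. Tietze extends this only as a map
    to \<open>coords d\<close>, so the extension \<open>H\<close> may run through
    \<open>p\<close>.\<close>
  define D where "D = {0..1} \<times> S \<union> {1::real} \<times> X"
  have clX: "closed X" using X by (rule compact_imp_closed)
  define h' where "h' = (\<lambda>z. if z \<in> {1::real} \<times> X then c else h z)"
  have "continuous_on D h'"
    unfolding D_def
  proof (rule continuous_on_closed_Un)
    show "continuous_on ({0..1} \<times> S) h'"
      by (rule continuous_on_eq[OF h(1)]) (use h(4) in \<open>auto simp: h'_def\<close>)
    show "continuous_on ({1} \<times> X) h'"
      by (rule continuous_on_eq[OF continuous_on_const[of _ c]]) (auto simp: h'_def)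
  qed (use S clX in \<open>auto intro!: closed_Times\<close>)
  moreover have "closed D" unfolding D_def using S clX by (intro closed_Un closed_Times) auto
  moreover have "h' \<in> D \<rightarrow> coords d"
  proof
    fix z assume "z \<in> D"
    then show "h' z \<in> coords d"
      using h(2) c unfolding h'_def D_def by (cases "z \<in> {1} \<times> X") auto
  qed
  ultimately obtain H where H: "continuous_on UNIV H" "\<And>x. H x \<in> coords d" "\<And>x. x \<in> D \<Longrightarrow> H x = h' x"
    using Tietze_coords[of D h' d] by blast
  define K where "K = ({0..1::real} \<times> X) \<inter> {z. H z = p}"
  have "closed {z. H z = p}"
    using closed_Collect_eq[OF H(1) continuous_on_const] .
  then have "compact K"
    unfolding K_def using X by (intro compact_Int_closed compact_Times) auto
  then have clB: "closed (snd ` K)"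
    by (intro compact_imp_closed compact_continuous_image continuous_intros)
  have disj: "S \<inter> snd ` K = {}"
  proof -
    have "H (t, x) \<noteq> p" if "x \<in> S" "t \<in> {0..1}" for t x
      using that H(3)[of "(t,x)"] h(2) c by (auto simp: D_def h'_def)
    then show ?thesis unfolding K_def by fastforce
  qed
  \<comment> \<open>A Urysohn function: time 0 over \<open>S\<close>, time 1 over the points whose
    track under \<open>H\<close> meets \<open>p\<close>. If \<open>H (l x, x)\<close> were
    \<open>p\<close>, then \<open>l x\<close> would be 1 and the value would be
    \<open>c\<close>.\<close>
  have "continuous_on (S \<union> snd ` K) (\<lambda>x. if x \<in> S then 0 else 1 :: real)"
    using S(1) clB disj by (intro continuous_on_cases continuous_intros) auto
  then obtain l :: "(nat \<Rightarrow> real) \<Rightarrow> real" where l: "continuous_on UNIV l"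
    "\<And>x. x \<in> S \<union> snd ` K \<Longrightarrow> l x = (if x \<in> S then 0 else 1)" "\<And>x. l x \<in> cbox 0 1"
    by (rule Tietze_closed_interval_1[of "S \<union> snd ` K" _ UNIV 0 1])
       (use S(1) clB in \<open>auto simp: closed_Un\<close>)
  have l01: "l x \<in> {0..1}" for x using l(3)[of x] by simp
  have l0: "l x = 0" if "x \<in> S" for x using l(2)[of x] that by simp
  have l1: "l x = 1" if "x \<in> snd ` K" for x using l(2)[of x] that disj by auto
  show thesis
  proof (rule that[of "\<lambda>x. H (l x, x)"])
    show "continuous_on X (\<lambda>x. H (l x, x))"
      by (rule continuous_on_compose2[OF H(1)])
         (auto intro!: continuous_intros continuous_on_subset[OF l(1)])
    show "(\<lambda>x. H (l x, x)) \<in> X \<rightarrow> coords d - {p}"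
    proof
      fix x assume x: "x \<in> X"
      have "H (l x, x) \<noteq> p"
      proof
        assume eq: "H (l x, x) = p"
        then have "x \<in> snd ` K" using l01[of x] x unfolding K_def by force
        then have "H (l x, x) = c" using l1 x H(3)[of "(1,x)"] by (auto simp: D_def h'_def)
        then show False using eq c by simp
      qed
      then show "H (l x, x) \<in> coords d - {p}" using H(2) by blast
    qed
    show "H (l x, x) = g x" if "x \<in> S" for x
      using that l0[OF that] H(3)[of "(0,x)"] h(3) by (auto simp: D_def h'_def)
  qed
qed

section \<open>Winding numbers versus extensions over the simplex\<close>

lemma punctured_space_eq: "punctured_space d p = top_of_set (coords d - {p})"
  unfolding punctured_space_def Euclidean_space_eq subtopology_subtopology by (simp add: Int_absorb1 Diff_subset)

lemma card_face: "d > 0 \<Longrightarrow> face_dim A = d \<longleftrightarrow> card A = d + 1"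
  by (auto simp: face_dim_def)

lemma boundary_card_2:
  assumes "a \<noteq> b"
  shows "boundary {a, b} = {vertex a, vertex b}"
proof -
  have 1: "{B. B \<noteq> {} \<and> B \<subset> {a,b}} = {{a},{b}}"
    using assms by blast
  have "realization {c} = {vertex c}" for c
    by (auto simp: realization_def vertex_def fun_eq_iff)
  then show ?thesis unfolding boundary_def 1 by auto
qed

text \<open>For \<open>d = 1\<close> both boundary values lie on one side of \<open>p\<close>, so
  the segment between them misses \<open>p\<close>. Otherwise equality of the two pointed classes
  gives a null-homotopy in the complement of \<open>p\<close>, which extends over the simplex. This
  direction turns unavoidable points into winding points.\<close>

lemma winding_set_extension:
  assumes A: "card A = d + 1" "d > 0"
    and g: "continuous_on (boundary A) g" "g \<in> boundary A \<rightarrow> coords d"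
    and p: "p \<in> coords d" "p \<notin> winding_set d A g"
  obtains G where "continuous_on (realization A) G" "G \<in> realization A \<rightarrow> coords d - {p}"
    "\<And>x. x \<in> boundary A \<Longrightarrow> G x = g x"
proof -
  have fin: "finite A" using A by (simp add: card_ge_0_finite)
  have pg: "p \<notin> g ` boundary A" and nw: "\<not> winding_nonzero d A g p"
    using p by (auto simp: winding_set_def topspace_Euclidean_space)
  show thesis
  proof (cases "d = 1")
    case True
    then have "card A = 2" using A by simp
    then obtain a b where ab: "A = {a,b}" "a \<noteq> b" by (auto simp: card_2_iff)
    have bd: "boundary A = {vertex a, vertex b}" using ab boundary_card_2 by simp
    have "connected_component_of (punctured_space d p) (g (vertex a)) (g (vertex b))"
      using nw True bd unfolding winding_nonzero_def by auto
    then obtain C where C: "connected C" "C \<subseteq> coords 1 - {p}" "g (vertex a) \<in> C" "g (vertex b) \<in> C"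
      unfolding connected_component_of_def punctured_space_eq
      using True by (auto simp: connectedin_subtopology)
    let ?u = "g (vertex a) 0" and ?v = "g (vertex b) 0"
    have "connected ((\<lambda>x. x 0) ` C)"
      using C(1) by (intro connected_continuous_image continuous_on_coordinate continuous_on_id)
    moreover have "p 0 \<notin> (\<lambda>x. x 0) ` C"
    proof
      assume "p 0 \<in> (\<lambda>x. x 0) ` C"
      then obtain x where x: "x \<in> C" "x 0 = p 0" by auto
      have "x i = p i" for i using x C(2) p(1) True by (cases "i = 0") auto
      then have "x = p" by auto
      then show False using x C(2) by auto
    qed
    ultimately have side: "(?u < p 0 \<and> ?v < p 0) \<or> (?u > p 0 \<and> ?v > p 0)"
      using C(3,4) connectedD_interval[of "(\<lambda>x. x 0) ` C" ?u ?v "p 0"]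
        connectedD_interval[of "(\<lambda>x. x 0) ` C" ?v ?u "p 0"]
      by (smt (verit) imageI)
    define G where "G = (\<lambda>x i. x a * g (vertex a) i + x b * g (vertex b) i)"
    show thesis
    proof (rule that[of G])
      show "continuous_on (realization A) G"
        unfolding G_def by (intro continuous_on_coordinatewise_then_product continuous_intros)
      show "G x = g x" if "x \<in> boundary A" for x
        proof
        fix i
        show "G x i = g x i"
          using that ab(2) unfolding bd G_def by (auto simp: vertex_def)
      qed
      show "G \<in> realization A \<rightarrow> coords d - {p}"
      proof
        fix x assume x: "x \<in> realization A"
        then have s: "x a \<ge> 0" "x b \<ge> 0" "x a + x b = 1" using ab by (auto simp: realization_def)
        have "G x 0 \<noteq> p 0"
        proof -
          have e: "G x 0 - p 0 = x a * (?u - p 0) + x b * (?v - p 0)"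
          proof -
            have "p 0 = (x a + x b) * p 0" using s(3) by simp
            then show ?thesis unfolding G_def by (simp only: algebra_simps)
          qed
          from side have "G x 0 - p 0 \<noteq> 0"
          proof
            assume "?u < p 0 \<and> ?v < p 0"
            then have "x a * (?u - p 0) \<le> 0" "x b * (?v - p 0) \<le> 0" "x a * (?u - p 0) < 0 \<or> x b * (?v - p 0) < 0"
              using s by (auto simp: mult_nonneg_nonpos mult_less_0_iff)
            then show ?thesis using e by linarith
          next
            assume "?u > p 0 \<and> ?v > p 0"
            then have "x a * (?u - p 0) \<ge> 0" "x b * (?v - p 0) \<ge> 0" "x a * (?u - p 0) > 0 \<or> x b * (?v - p 0) > 0"
              using s by (auto simp: zero_less_mult_iff)
            then show ?thesis using e by linarith
          qed
          then show ?thesis by simp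
        qed
        moreover have "G x \<in> coords d" using g(2) unfolding G_def bd by auto
        ultimately show "G x \<in> coords d - {p}" by auto
      qed
    qed
  next
    case False
    let ?b = "vertex (Min A)" and ?X = "top_of_set (boundary A)" and ?Y = "top_of_set (coords d - {p})"
    have "pointed_homotopy_class ?X ?b ?Y g = pointed_homotopy_class ?X ?b ?Y (\<lambda>_. g ?b)"
      using nw False unfolding winding_nonzero_def punctured_space_eq coord_top_eq Let_def by simp
    \<comment> \<open>A class is a set of maps: \<open>g\<close> belongs to its own class, hence to
      that of the constant map, which is the required homotopy.\<close>
    moreover have "g \<in> pointed_homotopy_class ?X ?b ?Y g"
      unfolding pointed_homotopy_class_def using g pg
      by (auto intro!: homotopic_with_equal)
    ultimately have "homotopic_with (\<lambda>k. k ?b = g ?b) ?X ?Y (\<lambda>_. g ?b) g"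
      unfolding pointed_homotopy_class_def by auto
    then have hom: "homotopic_with (\<lambda>_. True) ?X ?Y g (\<lambda>_. g ?b)"
      by (subst homotopic_with_sym) (auto elim: homotopic_with_mono)
    have ne: "boundary A \<noteq> {}"
    proof -
      have "Min A \<in> A" using A fin by (intro Min_in) auto
      have "{Min A} \<noteq> A"
      proof
        assume "{Min A} = A"
        then have "card A = 1" by (metis card_1_singleton_iff One_nat_def)
        then show False using A by simp
      qed
      then have "{Min A} \<subset> A" using \<open>Min A \<in> A\<close> by auto
      then show ?thesis unfolding boundary_def using vertex_in_realization[of "{Min A}"] by blast
    qed
    show thesis
      by (rule nullhomotopic_imp_extension[OF hom compact_imp_closed[OF compact_boundary[OF fin]]
            boundary_subset[OF fin] ne compact_realization[OF fin]]) (use that in blast)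
  qed
qed

lemma realization_convex:
  assumes "x \<in> realization A" "y \<in> realization A" "0 \<le> t" "t \<le> 1"
  shows "(\<lambda>i. (1 - t) * x i + t * y i) \<in> realization A"
  using assms by (auto simp: realization_def sum.distrib simp flip: sum_distrib_left)

text \<open>The simplex contracts linearly to its least vertex \<open>b\<close>, keeping
  \<open>b\<close> fixed. If \<open>G\<close> misses \<open>p\<close>, then \<open>G\<close> after
  this contraction is a pointed null-homotopy in the complement of \<open>p\<close>; for
  \<open>d = 1\<close>, connectedness of the simplex is enough.\<close>

lemma winding_set_subset_image:
  assumes A: "card A = d + 1" "d > 0"
    and G: "continuous_on (realization A) G" "G \<in> realization A \<rightarrow> coords d"
    and p: "p \<in> winding_set d A G"
  shows "p \<in> G ` realization A"
proof (rule ccontr)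
  assume np: "p \<notin> G ` realization A"
  have fin: "finite A" using A by (simp add: card_ge_0_finite)
  note bs = boundary_subset[OF fin]
  have w: "winding_nonzero d A G p" using p np bs by (auto simp: winding_set_def)
  have GY: "G \<in> realization A \<rightarrow> coords d - {p}" using G np by auto
  define b where "b = vertex (Min A)"
  have mA: "Min A \<in> A" using A fin by (intro Min_in) auto
  have b: "b \<in> realization A" unfolding b_def using mA fin by (simp add: vertex_in_realization)
  define h where "h = (\<lambda>(t, x). G (\<lambda>i. (1 - t) * x i + t * b i))"
  have ch: "continuous_on ({0..1} \<times> realization A) h"
    unfolding h_def case_prod_unfold
    by (rule continuous_on_compose2[OF G(1)])
      (auto intro!: continuous_on_coordinatewise_then_product continuous_intros
        continuous_on_coordinate[of _ snd] realization_convex b)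
  have hY: "h (t, x) \<in> coords d - {p}" if "t \<in> {0..1}" "x \<in> realization A" for t x
  proof -
    have "(\<lambda>i. (1 - t) * x i + t * b i) \<in> realization A" using realization_convex[OF that(2) b] that by auto
    then show ?thesis using GY unfolding h_def by auto
  qed
  show False
  proof (cases "d = 1")
    case True
    then obtain x y where xy: "x \<in> boundary A" "y \<in> boundary A"
      "\<not> connected_component_of (punctured_space d p) (G x) (G y)"
      using w unfolding winding_nonzero_def by auto
    have "connected (realization A)"
    proof -
      have "path_component (realization A) x b" if x: "x \<in> realization A" for x
      proof -
        define g where "g = (\<lambda>t i. (1 - t) * x i + t * b i)"
        have "path g" unfolding path_def g_def
          by (intro continuous_on_coordinatewise_then_product continuous_intros)
        moreover have "path_image g \<subseteq> realization A"
          unfolding path_image_def g_def using realization_convex[OF x b] by auto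
        moreover have "pathstart g = x" "pathfinish g = b"
          by (auto simp: pathstart_def pathfinish_def g_def)
        ultimately show ?thesis unfolding path_component_def by blast
      qed
      then have "path_connected (realization A)"
        unfolding path_connected_component by (meson path_component_sym path_component_trans)
      then show ?thesis by (rule path_connected_imp_connected)
    qed
    then have "connected (G ` realization A)" using G(1) by (rule connected_continuous_image[rotated])
    then have "connectedin (punctured_space d p) (G ` realization A)"
      unfolding punctured_space_eq using GY by (auto simp: connectedin_subtopology)
    then have "connected_component_of (punctured_space d p) (G x) (G y)"
      unfolding connected_component_of_def using xy bs by blast
    then show False using xy by simp
  next
    case False
    let ?X = "top_of_set (boundary A)" and ?Y = "top_of_set (coords d - {p})"
    have "homotopic_with (\<lambda>k. k b = G b) ?X ?Y G (\<lambda>_. G b)"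
      unfolding homotopic_with_def
    proof (intro exI[of _ h] conjI ballI allI)
      show "continuous_map (prod_topology (top_of_set {0..1}) (top_of_set (boundary A))) ?Y h"
        using ch hY bs unfolding prod_topology_subtopology_eu
        by (auto simp: Pi_iff subset_iff intro: continuous_on_subset)
      show "h (t, b) = G b" if "t \<in> {0..1}" for t
        unfolding h_def by (simp add: algebra_simps)
    qed (auto simp: h_def)
    then have "homotopic_with (\<lambda>k. k b = G b) ?X ?Y G h \<longleftrightarrow> homotopic_with (\<lambda>k. k b = G b) ?X ?Y (\<lambda>_. G b) h" for h
      by (blast intro: homotopic_with_trans homotopic_with_symD)
    then have "pointed_homotopy_class ?X b ?Y G = pointed_homotopy_class ?X b ?Y (\<lambda>_. G b)"
      unfolding pointed_homotopy_class_def set_eq_iff by simp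
    then show False
      using w False unfolding winding_nonzero_def punctured_space_eq coord_top_eq Let_def b_def by simp
  qed
qed

section \<open>Generic perturbations\<close>

text \<open>The distance is the l1 distance of the coordinates up to \<open>N\<close>, because the
  count of bad parameters compares barycentric coordinates one by one.\<close>

definition lipschitz_l1 :: "nat \<Rightarrow> (nat \<Rightarrow> real) set \<Rightarrow> real \<Rightarrow> ((nat \<Rightarrow> real) \<Rightarrow> real) \<Rightarrow> bool"
  where "lipschitz_l1 N X C g \<longleftrightarrow> (\<forall>x\<in>X. \<forall>z\<in>X. \<bar>g x - g z\<bar> \<le> C * (\<Sum>j\<le>N. \<bar>x j - z j\<bar>))"

lemma lipschitz_l1_mono: "lipschitz_l1 N X C g \<Longrightarrow> C \<le> C' \<Longrightarrow> lipschitz_l1 N X C' g"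
  unfolding lipschitz_l1_def
proof (intro ballI)
  fix x z
  assume *: "\<forall>x\<in>X. \<forall>z\<in>X. \<bar>g x - g z\<bar> \<le> C * (\<Sum>j\<le>N. \<bar>x j - z j\<bar>)" "C \<le> C'" and "x \<in> X" "z \<in> X"
  then have "\<bar>g x - g z\<bar> \<le> C * (\<Sum>j\<le>N. \<bar>x j - z j\<bar>)" by blast
  also have "\<dots> \<le> C' * (\<Sum>j\<le>N. \<bar>x j - z j\<bar>)"
    using * by (intro mult_right_mono sum_nonneg) auto
  finally show "\<bar>g x - g z\<bar> \<le> C' * (\<Sum>j\<le>N. \<bar>x j - z j\<bar>)" .
qed

lemma lipschitz_l1_continuous:
  assumes "lipschitz_l1 N X C g"
  shows "continuous_on X g"
  unfolding continuous_on_def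
proof
  fix x assume x: "x \<in> X"
  have "continuous_on X (\<lambda>z. C * (\<Sum>j\<le>N. \<bar>x j - z j\<bar>))"
    by (intro continuous_intros)
  then have "((\<lambda>z. C * (\<Sum>j\<le>N. \<bar>x j - z j\<bar>)) \<longlongrightarrow> C * (\<Sum>j\<le>N. \<bar>x j - x j\<bar>)) (at x within X)"
    using x unfolding continuous_on_def by blast
  then have lim: "((\<lambda>z. C * (\<Sum>j\<le>N. \<bar>x j - z j\<bar>)) \<longlongrightarrow> 0) (at x within X)" by simp
  have "\<forall>\<^sub>F z in at x within X. norm (g z - g x) \<le> C * (\<Sum>j\<le>N. \<bar>x j - z j\<bar>)"
    using assms x unfolding lipschitz_l1_def eventually_at_filter
    by (auto intro!: always_eventually simp: abs_minus_commute)
  then have "((\<lambda>z. g z - g x) \<longlongrightarrow> 0) (at x within X)"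
    using lim by (rule Lim_null_comparison)
  then show "(g \<longlongrightarrow> g x) (at x within X)" by (simp add: LIM_zero_iff)
qed

lemma skeleton_coords: "x \<in> skeleton N k \<Longrightarrow> j > N \<Longrightarrow> x j = 0"
proof -
  assume "x \<in> skeleton N k" "j > N"
  then obtain A where A: "A \<in> faces N k" "x \<in> realization A" by (auto simp: skeleton_def)
  then have "j \<notin> A" using \<open>j > N\<close> facesD(3) by fastforce
  then show ?thesis using A by (simp add: realization_def)
qed

lemma skeleton_sum: "x \<in> skeleton N k \<Longrightarrow> (\<Sum>j\<le>N. x j) = 1"
proof -
  assume "x \<in> skeleton N k"
  then obtain A where "A \<in> faces N k" "x \<in> realization A" by (auto simp: skeleton_def)
  then have "x \<in> realization {..N}" using realization_mono[of A "{..N}"] by (auto simp: faces_def)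
  then show ?thesis by (simp add: realization_def)
qed

lemma skeleton_bounds: "x \<in> skeleton N k \<Longrightarrow> 0 \<le> x j \<and> x j \<le> 1"
proof -
  assume "x \<in> skeleton N k"
  then obtain A where "A \<in> faces N k" "x \<in> realization A" by (auto simp: skeleton_def)
  then show ?thesis using realization_bounds[of A x j] facesD(1) by blast
qed

text \<open>Stone-Weierstrass for the algebra of Lipschitz functions: products stay Lipschitz
  because the factors are bounded on a compact set, and the coordinates separate points. The
  Lipschitz bound later controls values when coordinates are rounded to multiples of
  \<open>1 / n\<close>.\<close>

lemma lipschitz_approximation:
  fixes f :: "(nat \<Rightarrow> real) \<Rightarrow> real"
  assumes f: "continuous_on (skeleton N k) f" and "e > 0"
  obtains g C where "lipschitz_l1 N (skeleton N k) C g" "\<And>x. x \<in> skeleton N k \<Longrightarrow> \<bar>f x - g x\<bar> < e"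
proof -
  let ?X = "skeleton N k"
  let ?D = "\<lambda>x z :: nat \<Rightarrow> real. \<Sum>j\<le>N. \<bar>x j - z j\<bar>"
  define P where "P g \<longleftrightarrow> (\<exists>C. lipschitz_l1 N ?X C g)" for g
  have D0: "?D x z \<ge> 0" for x z by (intro sum_nonneg) auto
  have "\<exists>g. P g \<and> (\<forall>x\<in>?X. \<bar>f x - g x\<bar> < e)"
  proof (rule Stone_Weierstrass_HOL)
    show "compact ?X" by (rule compact_skeleton)
    show "P (\<lambda>_. c)" for c
      unfolding P_def lipschitz_l1_def by (intro exI[of _ 0]) simp
    show "continuous_on ?X g" if "P g" for g
      using that lipschitz_l1_continuous unfolding P_def by blast
    show "P (\<lambda>x. g x + h x)" if gh: "P g \<and> P h" for g h
    proof -
      obtain C C' where C: "lipschitz_l1 N ?X C g" "lipschitz_l1 N ?X C' h" using gh unfolding P_def by auto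
      have "\<bar>g x + h x - (g z + h z)\<bar> \<le> (C + C') * ?D x z" if "x \<in> ?X" "z \<in> ?X" for x z
      proof -
        have "\<bar>g x - g z\<bar> \<le> C * ?D x z" "\<bar>h x - h z\<bar> \<le> C' * ?D x z"
          using C that unfolding lipschitz_l1_def by auto
        then show ?thesis unfolding distrib_right by linarith
      qed
      then show ?thesis unfolding P_def lipschitz_l1_def by blast
    qed
    show "P (\<lambda>x. g x * h x)" if gh: "P g \<and> P h" for g h
    proof -
      obtain C C' where C: "lipschitz_l1 N ?X C g" "lipschitz_l1 N ?X C' h" using gh unfolding P_def by auto
      have "bounded (g ` ?X)" "bounded (h ` ?X)"
        using C by (auto intro!: compact_imp_bounded compact_continuous_image compact_skeleton
            lipschitz_l1_continuous)
      then obtain b b' where b: "\<And>x. x \<in> ?X \<Longrightarrow> \<bar>g x\<bar> \<le> b" "\<And>x. x \<in> ?X \<Longrightarrow> \<bar>h x\<bar> \<le> b'"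
        unfolding bounded_iff by auto
      have "\<bar>g x * h x - g z * h z\<bar> \<le> (b * C' + b' * C) * ?D x z" if x: "x \<in> ?X" "z \<in> ?X" for x z
      proof -
        have l: "\<bar>g x - g z\<bar> \<le> C * ?D x z" "\<bar>h x - h z\<bar> \<le> C' * ?D x z"
          using C x unfolding lipschitz_l1_def by auto
        have "g x * h x - g z * h z = g x * (h x - h z) + h z * (g x - g z)"
          by (simp add: algebra_simps)
        then have "\<bar>g x * h x - g z * h z\<bar> \<le> \<bar>g x\<bar> * \<bar>h x - h z\<bar> + \<bar>h z\<bar> * \<bar>g x - g z\<bar>"
          by (metis abs_mult abs_triangle_ineq)
        also have "\<dots> \<le> b * (C' * ?D x z) + b' * (C * ?D x z)"
          using b[OF x(1)] b[OF x(2)] l by (intro add_mono mult_mono) auto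
        finally show ?thesis by (simp add: algebra_simps)
      qed
      then show ?thesis unfolding P_def lipschitz_l1_def by blast
    qed
    show "\<exists>g. P g \<and> g x \<noteq> g z" if xz: "x \<in> ?X \<and> z \<in> ?X \<and> x \<noteq> z" for x z
    proof -
      obtain j where j: "x j \<noteq> z j" using xz by auto
      have "j \<le> N" using j xz skeleton_coords[of x N k j] skeleton_coords[of z N k j]
        by (cases "j \<le> N") auto
      then have "\<bar>u j - v j\<bar> \<le> 1 * ?D u v" for u v :: "nat \<Rightarrow> real"
        using member_le_sum[of j "{..N}" "\<lambda>j. \<bar>u j - v j\<bar>"] by simp
      then have "P (\<lambda>x. x j)" unfolding P_def lipschitz_l1_def by blast
      then show ?thesis using j by blast
    qed
  qed (use assms in auto)
  then show thesis using that unfolding P_def by blast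
qed

section \<open>Counting bad perturbation parameters\<close>

definition restr :: "nat set \<Rightarrow> (nat \<Rightarrow> real) \<Rightarrow> nat \<Rightarrow> real"
  where "restr S y = (\<lambda>j. if j \<in> S then y j else 0)"

text \<open>A face \<open>S\<close> has dimension \<open>card S - 1\<close>, so its summand is the
  codimension expected of its image in \<open>d\<close>-space. The subtraction does not truncate for
  the faces of dimension less than \<open>d\<close> to which this is applied.\<close>

definition codim :: "nat \<Rightarrow> nat set set \<Rightarrow> nat"
  where "codim d L = (\<Sum>S\<in>L. d + 1 - card S)"

text \<open>In each face \<open>S\<close> the point has a barycentric coordinate, that of \<open>v S\<close>, bounded away from zero.
  Hence the parameters at \<open>v S\<close> are determined, up to boundedly many choices, by the other parameters, the
  points and their common image. Counting these data shows that such \<open>w\<close> are rare for large \<open>n\<close>.\<close>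

definition bad_params ::
  "nat \<Rightarrow> nat \<Rightarrow> ((nat \<Rightarrow> real) \<Rightarrow> nat \<Rightarrow> real) \<Rightarrow> real \<Rightarrow> real \<Rightarrow> nat set set \<Rightarrow> (nat set \<Rightarrow> nat) \<Rightarrow>
    nat set \<Rightarrow> (nat \<Rightarrow> real) \<Rightarrow> nat \<Rightarrow> (nat \<times> nat \<Rightarrow> nat) set"
  where "bad_params N d \<phi> M e L v T c n =
    {w \<in> ({..N} \<times> {..<d}) \<rightarrow>\<^sub>E {..<n}. \<exists>y p.
       (\<forall>S\<in>L. restr S y \<in> realization S \<and> y (v S) \<ge> 1 / real (N + 1) \<and>
          (\<forall>k<d. p k = \<phi> (restr S y) k + e / real n * (\<Sum>j\<in>S. y j * real (w (j, k))))) \<and>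
       (\<forall>k\<in>T. p k = c k) \<and> (\<forall>k<d. \<bar>p k\<bar> \<le> M)}"

lemma floor_eq_imp_abs_less: "\<lfloor>a\<rfloor> = \<lfloor>b\<rfloor> \<Longrightarrow> \<bar>a - b\<bar> < (1::real)"
  by linarith

lemma floor_abs_le:
  assumes "\<bar>x\<bar> \<le> real m"
  shows "\<lfloor>x\<rfloor> \<in> {- int m..int m}"
  using assms by (simp add: abs_le_iff le_floor_iff floor_le_iff)

lemma mod_eq_imp_eq:
  fixes a b B :: nat
  assumes "a mod B = b mod B" "\<bar>real a - real b\<bar> < real B"
  shows "a = b"
proof -
  have "int B dvd int a - int b" using assms(1) by (metis mod_eq_dvd_iff zmod_int)
  moreover have "\<bar>int a - int b\<bar> < int B" using assms(2) by linarith
  ultimately have "int a - int b = 0" using dvd_imp_le_int[of "int a - int b" "int B"] by linarith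
  then show ?thesis by simp
qed

text \<open>Since \<open>y\<close> sums to 1 on \<open>S\<close>, also \<open>y v\<close> is known
  up to \<open>O(1 / n)\<close>. The Lipschitz bound then determines the weighted sum of the
  parameters up to a constant. In it only the parameter at \<open>v\<close> is free, and its
  coefficient is at least \<open>1 / (N + 1)\<close>, so it is known up to a bound independent of
  \<open>n\<close>.\<close>

lemma bad_params_difference:
  assumes S: "S \<in> faces N l" and v: "v \<in> S" and n: "n > 0" and e: "e > (0::real)"
    and lip: "lipschitz_l1 N (skeleton N l) \<Lambda> \<phi>" "\<Lambda> \<ge> 0"
    and y: "restr S y \<in> realization S" "restr S y' \<in> realization S" "y v \<ge> 1 / real (N + 1)"
    and w': "\<And>j. j \<in> S \<Longrightarrow> w' j < n"
    and ww: "\<And>j. j \<in> S - {v} \<Longrightarrow> w j = w' j"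
    and yy: "\<And>j. j \<in> S - {v} \<Longrightarrow> \<bar>y j - y' j\<bar> \<le> 1 / real n"
    and p: "p = \<phi> (restr S y) + e / real n * (\<Sum>j\<in>S. y j * real (w j))"
    and p': "p' = \<phi> (restr S y') + e / real n * (\<Sum>j\<in>S. y' j * real (w' j))"
    and pp: "\<bar>p - p'\<bar> \<le> 1 / real n"
  shows "\<bar>real (w v) - real (w' v)\<bar> \<le> real (N + 1) * ((1 + \<Lambda> * real (N + 1)^2) / e + real (N + 1)^2)"
proof -
  note fS = facesD[OF S]
  have cS: "card S \<le> N + 1" using fS(3) card_mono[of "{..N}" S] by simp
  have sum1: "sum y S = 1" "sum y' S = 1"
    using y(1,2) by (simp_all add: realization_def restr_def)
  have y1: "y v = 1 - sum y (S - {v})" "y' v = 1 - sum y' (S - {v})"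
    using sum1 sum.remove[OF fS(1) v, of y] sum.remove[OF fS(1) v, of y'] by linarith+
  have "\<bar>y v - y' v\<bar> = \<bar>\<Sum>j\<in>S-{v}. y' j - y j\<bar>" unfolding y1 by (simp add: sum_subtractf)
  also have "\<dots> \<le> (\<Sum>j\<in>S-{v}. \<bar>y' j - y j\<bar>)" by (rule sum_abs)
  also have "\<dots> \<le> (\<Sum>j\<in>S-{v}. 1 / real n)" using yy by (intro sum_mono) (simp add: abs_minus_commute)
  also have "\<dots> = real (card (S - {v})) / real n" by simp
  also have "\<dots> \<le> real (N + 1) / real n" 
    using cS fS(1) v by (intro divide_right_mono) (auto simp: card_Diff_singleton)
  finally have yv: "\<bar>y v - y' v\<bar> \<le> real (N + 1) / real n" .
  have ally: "\<bar>y j - y' j\<bar> \<le> real (N + 1) / real n" if "j \<in> S" for j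
  proof (cases "j = v")
    case False
    then have "\<bar>y j - y' j\<bar> \<le> 1 / real n" using yy that by auto
    also have "\<dots> \<le> real (N + 1) / real n" by (intro divide_right_mono) auto
    finally show ?thesis .
  qed (use yv in simp)
  have sk: "restr S y \<in> skeleton N l" "restr S y' \<in> skeleton N l"
    using y S by (auto simp: skeleton_def)
  have "(\<Sum>j\<le>N. \<bar>restr S y j - restr S y' j\<bar>) \<le> (\<Sum>j\<le>N. real (N + 1) / real n)"
    using ally by (intro sum_mono) (auto simp: restr_def)
  also have "\<dots> = real (N + 1)^2 / real n" by (simp add: power2_eq_square)
  finally have "\<Lambda> * (\<Sum>j\<le>N. \<bar>restr S y j - restr S y' j\<bar>) \<le> \<Lambda> * (real (N + 1)^2 / real n)"
    using lip(2) by (rule mult_left_mono)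
  moreover have "\<bar>\<phi> (restr S y) - \<phi> (restr S y')\<bar> \<le> \<Lambda> * (\<Sum>j\<le>N. \<bar>restr S y j - restr S y' j\<bar>)"
    using lip(1) sk unfolding lipschitz_l1_def by blast
  ultimately have ph: "\<bar>\<phi> (restr S y) - \<phi> (restr S y')\<bar> \<le> \<Lambda> * (real (N + 1)^2 / real n)" by linarith
  let ?s = "\<Sum>j\<in>S. y j * real (w j)" and ?s' = "\<Sum>j\<in>S. y' j * real (w' j)"
  have "e / real n * \<bar>?s - ?s'\<bar> = \<bar>e / real n * (?s - ?s')\<bar>" using e n by (simp add: abs_mult)
  also have "\<dots> = \<bar>(p - p') - (\<phi> (restr S y) - \<phi> (restr S y'))\<bar>" unfolding p p' by (simp add: algebra_simps)
  also have "\<dots> \<le> 1 / real n + \<Lambda> * (real (N + 1)^2 / real n)" using pp ph by linarith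
  finally have "e * \<bar>?s - ?s'\<bar> \<le> 1 + \<Lambda> * real (N + 1)^2"
    using n by (simp add: field_simps)
  then have ss: "\<bar>?s - ?s'\<bar> \<le> (1 + \<Lambda> * real (N + 1)^2) / e"
    using e by (simp add: field_simps)
  \<comment> \<open>The first sum is the change of the point, at most \<open>(N + 1)^2\<close>
    because \<open>w' j < n\<close>; the second is the change of the parameters, which concerns only
    \<open>v\<close>.\<close>
  have "?s - ?s' = (\<Sum>j\<in>S. (y j - y' j) * real (w' j)) + (\<Sum>j\<in>S. y j * (real (w j) - real (w' j)))"
    by (simp add: sum.distrib[symmetric] sum_subtractf[symmetric] algebra_simps)
  moreover have "(\<Sum>j\<in>S. y j * (real (w j) - real (w' j))) = y v * (real (w v) - real (w' v))"
    using sum.remove[OF fS(1) v, of "\<lambda>j. y j * (real (w j) - real (w' j))"] ww by simp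
  moreover have "\<bar>\<Sum>j\<in>S. (y j - y' j) * real (w' j)\<bar> \<le> real (N + 1)^2"
  proof -
    have "\<bar>\<Sum>j\<in>S. (y j - y' j) * real (w' j)\<bar> \<le> (\<Sum>j\<in>S. \<bar>(y j - y' j) * real (w' j)\<bar>)" by (rule sum_abs)
    also have "\<dots> \<le> (\<Sum>j\<in>S. real (N + 1) / real n * real n)"
      unfolding abs_mult using ally w' by (intro sum_mono mult_mono) (auto simp: less_imp_le)
    also have "\<dots> = real (card S) * real (N + 1)" using n by simp
    also have "\<dots> \<le> real (N + 1)^2" using cS unfolding power2_eq_square by (intro mult_right_mono) auto
    finally show ?thesis .
  qed
  ultimately have b: "\<bar>y v * (real (w v) - real (w' v))\<bar> \<le> (1 + \<Lambda> * real (N + 1)^2) / e + real (N + 1)^2"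
    using ss by linarith
  have "1 / real (N + 1) * \<bar>real (w v) - real (w' v)\<bar> \<le> \<bar>y v\<bar> * \<bar>real (w v) - real (w' v)\<bar>"
    using y(3) by (intro mult_right_mono) auto
  also have "\<dots> \<le> (1 + \<Lambda> * real (N + 1)^2) / e + real (N + 1)^2" using b by (simp add: abs_mult)
  finally show ?thesis by (simp add: field_simps)
qed

text \<open>A bad \<open>w\<close> is encoded injectively by its values at the vertices outside
  \<open>J\<close>, the barycentric coordinates outside \<open>J\<close> and the coordinates of
  \<open>p\<close> outside \<open>T\<close>, both rounded to multiples of \<open>1 / n\<close>, and
  the residues of its values at \<open>J\<close>. Thus the \<open>d\<close> parameters at
  \<open>v S\<close> are traded for \<open>card S - 1\<close> coordinates of a point, and
  \<open>d - card T\<close> coordinates of \<open>p\<close> are added. The exponent of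
  \<open>n\<close> drops by \<open>codim d L + card T - d\<close>, which is at least 1.\<close>

lemma card_bad_params:
  assumes L: "L \<subseteq> faces N (d - 1)" "disjoint L" and v: "\<And>S. S \<in> L \<Longrightarrow> v S \<in> S"
    and T: "T \<subseteq> {..<d}" "codim d L + card T > d" and e: "e > 0" and d: "d > 0"
    and lip: "\<And>k. lipschitz_l1 N (skeleton N (d - 1)) \<Lambda> (\<lambda>x. \<phi> x k)" "\<Lambda> \<ge> 0"
  shows "\<exists>C. \<forall>n>0. card (bad_params N d \<phi> M e L v T c n) * n \<le> C * n ^ (d * (N + 1))"
proof -
  define J where "J = v ` L"
  define U where "U = \<Union> L"
  define D where "D = real (N + 1) * ((1 + \<Lambda> * real (N + 1)^2) / e + real (N + 1)^2)"
  \<comment> \<open>\<open>D\<close> bounds the distance of two values of a parameter at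
    \<open>J\<close> when all other data agree; a residue modulo \<open>B > D\<close> therefore
    determines the parameter.\<close>
  define B where "B = nat \<lceil>D\<rceil> + 1"
  define M' where "M' = nat \<lceil>\<bar>M\<bar>\<rceil>"
  define r where "r = card L"
  have finL: "finite L" using L(1) finite_faces finite_subset by blast
  have LS: "finite S" "S \<noteq> {}" "S \<subseteq> {..N}" "card S \<le> d" if "S \<in> L" for S
    using facesD[of S N "d - 1"] that L(1) d by auto
  have injv: "inj_on v L"
  proof
    fix S S' assume *: "S \<in> L" "S' \<in> L" "v S = v S'"
    then have "v S \<in> S \<inter> S'" using v by force
    then show "S = S'" using L(2) * unfolding disjoint_def by auto
  qed
  have cardJ: "card J = r" unfolding J_def r_def using injv by (rule card_image)
  have JU: "J \<subseteq> U" unfolding J_def U_def using v by auto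
  have UN: "U \<subseteq> {..N}" unfolding U_def using LS(3) by auto
  have fin: "finite U" "finite J" using UN JU by (auto intro: finite_subset)
  have notJ: "j \<notin> J" if "S \<in> L" "j \<in> S - {v S}" for S j
  proof
    assume "j \<in> J"
    then obtain S' where S': "S' \<in> L" "j = v S'" unfolding J_def by auto
    then have "j \<in> S \<inter> S'" using v that by auto
    then have "S = S'" using L(2) that S' unfolding disjoint_def by auto
    then show False using S' that by auto
  qed
  have cardU: "card U = (\<Sum>S\<in>L. card S)"
    unfolding U_def using L(2) LS(1) by (intro card_Union_disjoint) (auto simp: pairwise_def disjoint_def disjnt_def)
  have cod: "codim d L + card U = r * (d + 1)"
  proof -
    have "codim d L + card U = (\<Sum>S\<in>L. (d + 1 - card S) + card S)"
      unfolding codim_def cardU by (simp add: sum.distrib)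
    also have "\<dots> = (\<Sum>S\<in>L. d + 1)" using LS(4) by (intro sum.cong) (auto simp: le_SucI)
    finally show ?thesis by (simp add: r_def)
  qed
  have rU: "r \<le> card U" using cardJ JU fin card_mono by metis
  have UN1: "card U \<le> N + 1" using card_mono[OF _ UN] by simp
  have cT: "card T \<le> d" using T(1) card_mono[of "{..<d}" T] by simp
  have ex: "d * (N + 1 - r) + (card U - r) + (d - card T) + 1 \<le> d * (N + 1)"
  proof -
    have "d * (N + 1 - r) + d * r = d * (N + 1)"
      using rU UN1 by (simp flip: distrib_left)
    moreover have "(card U - r) + (d - card T) + 1 \<le> d * r"
      using cod T(2) rU cT by (simp add: algebra_simps)
    ultimately show ?thesis by linarith
  qed
  define C where "C = 2 ^ (card U - r) * (2 * M' + 3) ^ (d - card T) * B ^ (d * r)"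
  show ?thesis
  proof (intro exI allI impI)
    fix n :: nat assume n: "n > 0"
    let ?Bad = "bad_params N d \<phi> M e L v T c n"
    define R where "R w y p \<longleftrightarrow> (\<forall>S\<in>L. restr S y \<in> realization S \<and> y (v S) \<ge> 1 / real (N + 1) \<and>
          (\<forall>k<d. p k = \<phi> (restr S y) k + e / real n * (\<Sum>j\<in>S. y j * real (w (j, k))))) \<and>
       (\<forall>k\<in>T. p k = c k) \<and> (\<forall>k<d. \<bar>p k\<bar> \<le> M)"
      for w :: "nat \<times> nat \<Rightarrow> nat" and y p
    have "\<exists>y p. R w y p" if "w \<in> ?Bad" for w
      using that unfolding bad_params_def R_def by blast
    then obtain y p where "\<And>w. w \<in> ?Bad \<Longrightarrow> R w (y w) (p w)" by metis
    note yp = this[unfolded R_def]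
    have Wn: "w \<in> ({..N} \<times> {..<d}) \<rightarrow>\<^sub>E {..<n}" if "w \<in> ?Bad" for w
      using that unfolding bad_params_def by blast
    define A1 where "A1 = (({..N} - J) \<times> {..<d}) \<rightarrow>\<^sub>E {..<n}"
    define A2 where "A2 = (U - J) \<rightarrow>\<^sub>E {0..int n}"
    define A3 where "A3 = ({..<d} - T) \<rightarrow>\<^sub>E {- int ((M' + 1) * n) .. int ((M' + 1) * n)}"
    define A4 where "A4 = (J \<times> {..<d}) \<rightarrow>\<^sub>E {..<B}"
    define code where "code w =
      (restrict w (({..N} - J) \<times> {..<d}), (\<lambda>j\<in>U - J. \<lfloor>real n * y w j\<rfloor>),
       (\<lambda>k\<in>{..<d} - T. \<lfloor>real n * p w k\<rfloor>), (\<lambda>z\<in>J \<times> {..<d}. w z mod B))" for w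
    have yU: "0 \<le> y w j \<and> y w j \<le> 1" if "w \<in> ?Bad" "j \<in> U" for w j
    proof -
      obtain S where S: "S \<in> L" "j \<in> S" using \<open>j \<in> U\<close> unfolding U_def by auto
      then have "restr S (y w) \<in> realization S" using yp[OF that(1)] by auto
      from realization_bounds[OF LS(1)[OF S(1)] this, of j] show ?thesis using S(2) by (simp add: restr_def)
    qed
    have code_in: "code ` ?Bad \<subseteq> A1 \<times> A2 \<times> A3 \<times> A4"
    proof
      fix z assume "z \<in> code ` ?Bad"
      then obtain w where w: "w \<in> ?Bad" "z = code w" by auto
      have "restrict w (({..N} - J) \<times> {..<d}) \<in> A1" unfolding A1_def using Wn[OF w(1)] by auto
      moreover have "(\<lambda>j\<in>U - J. \<lfloor>real n * y w j\<rfloor>) \<in> A2"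
      proof -
        have "\<lfloor>real n * y w j\<rfloor> \<in> {0..int n}" if "j \<in> U" for j
        proof -
          have "0 \<le> real n * y w j" "real n * y w j \<le> real n"
            using yU[OF w(1) that] mult_left_mono[of "y w j" 1 "real n"] by auto
          then have "0 \<le> \<lfloor>real n * y w j\<rfloor>" "\<lfloor>real n * y w j\<rfloor> \<le> int n"
            using floor_mono[of "real n * y w j" "real n"] by auto
          then show ?thesis by simp
        qed
        then show ?thesis unfolding A2_def by auto
      qed
      moreover have "(\<lambda>k\<in>{..<d} - T. \<lfloor>real n * p w k\<rfloor>) \<in> A3"
      proof -
        have "\<lfloor>real n * p w k\<rfloor> \<in> {- int ((M' + 1) * n) .. int ((M' + 1) * n)}" if "k < d" for k
        proof -
          have "\<bar>p w k\<bar> \<le> real M'" using yp[OF w(1)] that unfolding M'_def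
            by (smt (verit) of_nat_ceiling)
          then have "\<bar>real n * p w k\<bar> \<le> real n * real M'" unfolding abs_mult by (intro mult_mono) auto
          also have "\<dots> = real (M' * n)" by simp
          finally have "\<lfloor>real n * p w k\<rfloor> \<in> {- int (M' * n)..int (M' * n)}" by (rule floor_abs_le)
          moreover have "int (M' * n) \<le> int ((M' + 1) * n)" by simp
          ultimately show ?thesis unfolding atLeastAtMost_iff by linarith
        qed
        then show ?thesis unfolding A3_def by auto
      qed
      moreover have "(\<lambda>z\<in>J \<times> {..<d}. w z mod B) \<in> A4" unfolding A4_def B_def by auto
      ultimately show "z \<in> A1 \<times> A2 \<times> A3 \<times> A4" unfolding w(2) code_def by simp
    qed
    have inj: "inj_on code ?Bad"
    proof
      fix w w' assume w: "w \<in> ?Bad" and w': "w' \<in> ?Bad" and eq: "code w = code w'"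
      from eq have c: "restrict w (({..N} - J) \<times> {..<d}) = restrict w' (({..N} - J) \<times> {..<d})"
        "(\<lambda>j\<in>U - J. \<lfloor>real n * y w j\<rfloor>) = (\<lambda>j\<in>U - J. \<lfloor>real n * y w' j\<rfloor>)"
        "(\<lambda>k\<in>{..<d} - T. \<lfloor>real n * p w k\<rfloor>) = (\<lambda>k\<in>{..<d} - T. \<lfloor>real n * p w' k\<rfloor>)"
        "(\<lambda>z\<in>J \<times> {..<d}. w z mod B) = (\<lambda>z\<in>J \<times> {..<d}. w' z mod B)"
        unfolding code_def by (simp_all only: prod.inject)
      have e1: "w (j, k) = w' (j, k)" if "j \<le> N" "j \<notin> J" "k < d" for j k
        using fun_cong[OF c(1), of "(j, k)"] that by simp
      have e2: "\<lfloor>real n * y w j\<rfloor> = \<lfloor>real n * y w' j\<rfloor>" if "j \<in> U - J" for j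
        using fun_cong[OF c(2), of j] that by simp
      have e3: "\<lfloor>real n * p w k\<rfloor> = \<lfloor>real n * p w' k\<rfloor>" if "k < d" "k \<notin> T" for k
        using fun_cong[OF c(3), of k] that by simp
      have e4: "w (j, k) mod B = w' (j, k) mod B" if "j \<in> J" "k < d" for j k
        using fun_cong[OF c(4), of "(j, k)"] that by simp
      have near: "\<bar>a - b\<bar> \<le> 1 / real n" if "\<lfloor>real n * a\<rfloor> = \<lfloor>real n * b\<rfloor>" for a b
      proof -
        have "real n * \<bar>a - b\<bar> = \<bar>real n * a - real n * b\<bar>" by (simp add: abs_mult flip: right_diff_distrib)
        also have "\<dots> \<le> 1" using floor_eq_imp_abs_less[OF that] by simp
        finally show ?thesis using n by (simp add: field_simps)
      qed
      have "w (j, k) = w' (j, k)" if jk: "j \<le> N" "k < d" for j k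
      proof (cases "j \<in> J")
        case True
        then obtain S where S: "S \<in> L" "j = v S" unfolding J_def by auto
        have SU: "S \<subseteq> U" using S unfolding U_def by auto
        have "\<bar>real (w (v S, k)) - real (w' (v S, k))\<bar> \<le> D"
          unfolding D_def
        proof (rule bad_params_difference[where w = "\<lambda>j. w (j, k)" and w' = "\<lambda>j. w' (j, k)"
              and y = "y w" and y' = "y w'" and \<phi> = "\<lambda>x. \<phi> x k" and p = "p w k" and p' = "p w' k" and n = n
              and S = S and l = "d - 1"])
          show "S \<in> faces N (d - 1)" using S L by auto
          show "w' (j, k) < n" if "j \<in> S" for j
            using Wn[OF w'] that LS(3)[OF S(1)] jk by auto
          show "w (j, k) = w' (j, k)" if "j \<in> S - {v S}" for j
            using e1[of j k] notJ[OF S(1) that] that LS(3)[OF S(1)] jk by auto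
          show "\<bar>y w j - y w' j\<bar> \<le> 1 / real n" if "j \<in> S - {v S}" for j
            using near[OF e2] notJ[OF S(1) that] that SU by auto
          show "\<bar>p w k - p w' k\<bar> \<le> 1 / real n"
          proof (cases "k \<in> T")
            case True
            then show ?thesis using yp[OF w] yp[OF w'] by simp
          qed (use near[OF e3] jk in auto)
        qed (use n e lip v[OF S(1)] yp[OF w] yp[OF w'] S(1) jk in auto)
        also have "D < real B" unfolding B_def by linarith
        finally show ?thesis using mod_eq_imp_eq[OF e4[OF True jk(2)]] S(2) by blast
      qed (use e1 jk in auto)
      then show "w = w'" using Wn[OF w] Wn[OF w'] by (intro PiE_ext[of w _ _ w']) auto
    qed
    have finA: "finite (A1 \<times> A2 \<times> A3 \<times> A4)" unfolding A1_def A2_def A3_def A4_def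
      using fin by (intro finite_cartesian_product finite_PiE) auto
    have "card ?Bad \<le> card (A1 \<times> A2 \<times> A3 \<times> A4)"
      using card_inj_on_le[OF inj code_in finA] .
    also have "\<dots> = n ^ (d * (N + 1 - r)) * ((n + 1) ^ (card U - r) * ((2 * ((M' + 1) * n) + 1) ^ (d - card T) * B ^ (d * r)))"
    proof -
      have "card A1 = n ^ (d * (N + 1 - r))" unfolding A1_def using UN JU fin
        by (subst card_funcsetE) (auto simp: card_cartesian_product card_Diff_subset cardJ mult.commute)
      moreover have "card A2 = (n + 1) ^ (card U - r)" unfolding A2_def using JU fin
        by (subst card_funcsetE) (auto simp: card_Diff_subset cardJ nat_add_distrib)
      moreover have "card A3 = (2 * ((M' + 1) * n) + 1) ^ (d - card T)"
      proof -
        have "card {- int ((M' + 1) * n) .. int ((M' + 1) * n)} = 2 * ((M' + 1) * n) + 1"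
          by (simp only: card_atLeastAtMost_int)
        moreover have "card ({..<d} - T) = d - card T" using T(1) by (simp add: card_Diff_subset finite_subset)
        ultimately show ?thesis unfolding A3_def by (subst card_funcsetE) auto
      qed
      moreover have "card A4 = B ^ (d * r)" unfolding A4_def using fin
        by (subst card_funcsetE) (auto simp: card_cartesian_product cardJ mult.commute)
      ultimately show ?thesis by (simp add: card_cartesian_product)
    qed
    also have "\<dots> \<le> n ^ (d * (N + 1 - r)) * ((2 * n) ^ (card U - r) * (((2 * M' + 3) * n) ^ (d - card T) * B ^ (d * r)))"
    proof -
      have "2 * ((M' + 1) * n) + 1 \<le> (2 * M' + 3) * n" using n by (simp add: algebra_simps)
      then show ?thesis using n by (intro mult_mono power_mono) auto
    qed
    also have "\<dots> = C * n ^ (d * (N + 1 - r) + (card U - r) + (d - card T))"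
      unfolding C_def power_mult_distrib power_add by (simp only: ac_simps)
    finally have "card ?Bad * n \<le> C * n ^ (d * (N + 1 - r) + (card U - r) + (d - card T)) * n"
      by (rule mult_le_mono1)
    also have "\<dots> = C * n ^ (d * (N + 1 - r) + (card U - r) + (d - card T) + 1)"
      by (simp only: power_add power_one_right mult.assoc)
    also have "\<dots> \<le> C * n ^ (d * (N + 1))"
      using ex n by (intro mult_le_mono2 power_increasing) auto
    finally show "card ?Bad * n \<le> C * n ^ (d * (N + 1))" .
  qed
qed

text \<open>An element of \<open>E\<close> forbids common image points of the faces in
  \<open>L\<close> with coordinates \<open>c\<close> on \<open>T\<close>; with \<open>T\<close>
  empty it forbids common image points altogether. The perturbations are \<open>e / n\<close> times
  linear maps with integer coefficients below \<open>n\<close>. Each condition excludes a fraction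
  \<open>O(1 / n)\<close> of them, so a union bound leaves a good one.\<close>

lemma generic_perturbation:
  fixes f :: "(nat \<Rightarrow> real) \<Rightarrow> nat \<Rightarrow> real"
  assumes d: "d > 0" and f: "continuous_on (skeleton N (d - 1)) f" and \<epsilon>: "\<epsilon> > 0"
    and E: "finite E" "\<And>L T c. (L, T, c) \<in> E \<Longrightarrow>
      L \<subseteq> faces N (d - 1) \<and> disjoint L \<and> T \<subseteq> {..<d} \<and> codim d L + card T > d"
  obtains f' where "continuous_on (skeleton N (d - 1)) f'" "\<And>x. f' x \<in> coords d"
    "\<And>x k. x \<in> skeleton N (d - 1) \<Longrightarrow> k < d \<Longrightarrow> \<bar>f' x k - f x k\<bar> < \<epsilon>"
    "\<And>L T c p. (L, T, c) \<in> E \<Longrightarrow> (\<And>S. S \<in> L \<Longrightarrow> p \<in> f' ` realization S) \<Longrightarrow> \<exists>k\<in>T. p k \<noteq> c k"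
proof -
  let ?X = "skeleton N (d - 1)"
  have "\<exists>g C. lipschitz_l1 N ?X C g \<and> (\<forall>x\<in>?X. \<bar>f x k - g x\<bar> < \<epsilon> / 2)" for k
    by (rule lipschitz_approximation[OF continuous_on_coordinate[OF f], of "\<epsilon> / 2" k]) (use \<epsilon> in auto)
  then obtain g C where gC: "\<And>k. lipschitz_l1 N ?X (C k) (g k)"
    "\<And>k x. x \<in> ?X \<Longrightarrow> \<bar>f x k - g k x\<bar> < \<epsilon> / 2"
    by metis
  define \<phi> where "\<phi> x k = (if k < d then g k x else 0)" for x k
  define \<Lambda> where "\<Lambda> = (\<Sum>k<d. \<bar>C k\<bar>)"
  have \<Lambda>0: "\<Lambda> \<ge> 0" unfolding \<Lambda>_def by (intro sum_nonneg) auto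
  have lip: "lipschitz_l1 N ?X \<Lambda> (\<lambda>x. \<phi> x k)" for k
  proof (cases "k < d")
    case True
    have "C k \<le> \<bar>C k\<bar>" by simp
    also have "\<dots> \<le> \<Lambda>" unfolding \<Lambda>_def using True by (intro member_le_sum) auto
    finally show ?thesis using lipschitz_l1_mono[OF gC(1)] True unfolding \<phi>_def by simp
  next
    case False
    have "0 \<le> \<Lambda> * (\<Sum>j\<le>N. \<bar>x j - z j\<bar>)" for x z :: "nat \<Rightarrow> real"
      using \<Lambda>0 by (intro mult_nonneg_nonneg sum_nonneg) auto
    then show ?thesis using False unfolding \<phi>_def lipschitz_l1_def by simp
  qed
  have "\<exists>b. \<forall>x\<in>?X. \<bar>\<phi> x k\<bar> \<le> b" for k
  proof -
    have "bounded ((\<lambda>x. \<phi> x k) ` ?X)"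
      using lip by (intro compact_imp_bounded compact_continuous_image compact_skeleton lipschitz_l1_continuous)
    then show ?thesis unfolding bounded_iff by auto
  qed
  then obtain b where b: "\<And>k x. x \<in> ?X \<Longrightarrow> \<bar>\<phi> x k\<bar> \<le> b k" by metis
  \<comment> \<open>Bounds the coordinates of every perturbed map on the skeleton, so that common
    points satisfy the last clause of \<open>bad_params\<close>.\<close>
  define M where "M = (\<Sum>k<d. \<bar>b k\<bar>) + \<epsilon>"
  have bM: "b k + \<epsilon> \<le> M" if "k < d" for k
  proof -
    have "b k \<le> \<bar>b k\<bar>" by simp
    also have "\<dots> \<le> (\<Sum>k<d. \<bar>b k\<bar>)" using that by (intro member_le_sum) auto
    finally show ?thesis unfolding M_def by simp
  qed
  define e where "e = \<epsilon> / 2"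
  have e: "e > 0" unfolding e_def using \<epsilon> by simp
  \<comment> \<open>Which vertex of a face carries a large coordinate depends on the common point;
    hence every choice \<open>v\<close> of vertices is excluded separately.\<close>
  define EV where "EV = (SIGMA z:E. PiE (fst z) (\<lambda>S. S))"
  have finEV: "finite EV"
    unfolding EV_def
  proof (intro finite_SigmaI E(1))
    fix z assume z: "z \<in> E"
    then have "fst z \<subseteq> faces N (d - 1)" using E(2)[of "fst z" "fst (snd z)" "snd (snd z)"] by simp
    then show "finite (PiE (fst z) (\<lambda>S. S))"
      using facesD(1) finite_faces by (intro finite_PiE) (auto intro: finite_subset)
  qed
  define Bad where "Bad \<equiv> \<lambda>n ((L, T, c), v). bad_params N d \<phi> M e L v T c n"
  have "\<exists>K. \<forall>n>0. card (Bad n z) * n \<le> K * n ^ (d * (N + 1))" if z: "z \<in> EV" for z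
  proof -
    obtain L T c v where zz: "z = ((L, T, c), v)" by (metis prod.exhaust)
    have "(L, T, c) \<in> E" "v \<in> PiE L (\<lambda>S. S)" using z unfolding EV_def zz by auto
    then show ?thesis unfolding zz Bad_def prod.case
      using E(2) e d lip \<Lambda>0 by (intro card_bad_params) auto
  qed
  then obtain K where K: "\<And>z n. z \<in> EV \<Longrightarrow> n > 0 \<Longrightarrow> card (Bad n z) * n \<le> K z * n ^ (d * (N + 1))"
    by metis
  \<comment> \<open>The bad fraction is at most \<open>sum K EV / n\<close>, now less than
    1.\<close>
  define n where "n = sum K EV + 1"
  have n0: "n > 0" unfolding n_def by simp
  have "card (\<Union>z\<in>EV. Bad n z) * n \<le> (\<Sum>z\<in>EV. card (Bad n z)) * n"
    using finEV by (intro mult_le_mono1 card_UN_le)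
  also have "\<dots> \<le> sum K EV * n ^ (d * (N + 1))"
    unfolding sum_distrib_right using K n0 by (intro sum_mono) auto
  also have "\<dots> < n * n ^ (d * (N + 1))" using n0 unfolding n_def by (intro mult_strict_right_mono) auto
  finally have "card (\<Union>z\<in>EV. Bad n z) < n ^ (d * (N + 1))" by (simp add: mult.commute)
  moreover have "card (({..N} \<times> {..<d}) \<rightarrow>\<^sub>E {..<n}) = n ^ (d * (N + 1))"
    by (subst card_funcsetE) (auto simp: card_cartesian_product mult.commute)
  moreover have "finite (\<Union>z\<in>EV. Bad n z)"
  proof (intro finite_UN_I finEV)
    fix z assume "z \<in> EV"
    have "Bad n z \<subseteq> ({..N} \<times> {..<d}) \<rightarrow>\<^sub>E {..<n}" unfolding Bad_def bad_params_def by (auto split: prod.splits)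
    then show "finite (Bad n z)" by (rule finite_subset) (auto intro!: finite_PiE)
  qed
  ultimately have "\<not> ({..N} \<times> {..<d}) \<rightarrow>\<^sub>E {..<n} \<subseteq> (\<Union>z\<in>EV. Bad n z)"
    by (metis card_mono leD)
  then obtain w where w: "w \<in> ({..N} \<times> {..<d}) \<rightarrow>\<^sub>E {..<n}" "\<And>z. z \<in> EV \<Longrightarrow> w \<notin> Bad n z" by blast
  define f' where "f' x k = (if k < d then \<phi> x k + e / real n * (\<Sum>j\<le>N. x j * real (w (j, k))) else 0)" for x k
  have pert: "\<bar>e / real n * (\<Sum>j\<le>N. x j * real (w (j, k)))\<bar> \<le> e" if x: "x \<in> ?X" and k: "k < d" for x k
  proof -
    have "0 \<le> (\<Sum>j\<le>N. x j * real (w (j, k)))"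
      using skeleton_bounds[OF x] by (intro sum_nonneg) auto
    moreover have "(\<Sum>j\<le>N. x j * real (w (j, k))) \<le> (\<Sum>j\<le>N. x j * real n)"
    proof (intro sum_mono mult_left_mono)
      fix j assume "j \<in> {..N}"
      then have "w (j, k) < n" using w(1) k by auto
      then show "real (w (j, k)) \<le> real n" by simp
    qed (use skeleton_bounds[OF x] in auto)
    moreover have "(\<Sum>j\<le>N. x j * real n) = real n" using skeleton_sum[OF x] by (simp flip: sum_distrib_right)
    ultimately show ?thesis using e n0 by (simp add: abs_mult field_simps)
  qed
  show thesis
  proof (rule that[of f'])
    show "continuous_on ?X f'"
    proof (rule continuous_on_coordinatewise_then_product)
      show "continuous_on ?X (\<lambda>x. f' x k)" for k
        using lipschitz_l1_continuous[OF lip] unfolding f'_def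
        using n0 by (cases "k < d") (auto intro!: continuous_intros)
    qed
    show "f' x \<in> coords d" for x unfolding f'_def by auto
    show "\<bar>f' x k - f x k\<bar> < \<epsilon>" if "x \<in> ?X" "k < d" for x k
    proof -
      have "f' x k = g k x + e / real n * (\<Sum>j\<le>N. x j * real (w (j, k)))"
        using that unfolding f'_def \<phi>_def by simp
      then show ?thesis using pert[OF that] gC(2)[OF that(1), of k] unfolding e_def by linarith
    qed
    show "\<exists>k\<in>T. p k \<noteq> c k" if LTc: "(L, T, c) \<in> E" and p: "\<And>S. S \<in> L \<Longrightarrow> p \<in> f' ` realization S" for L T c p
    proof (rule ccontr)
      assume "\<not> (\<exists>k\<in>T. p k \<noteq> c k)"
      then have pc: "\<forall>k\<in>T. p k = c k" by auto
      have L: "L \<subseteq> faces N (d - 1)" "disjoint L" "T \<subseteq> {..<d}" "codim d L + card T > d" using E(2)[OF LTc] by auto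
      have "\<exists>y. y \<in> realization S \<and> p = f' y" if "S \<in> L" for S using p[OF that] by auto
      then obtain Y where Y: "\<And>S. S \<in> L \<Longrightarrow> Y S \<in> realization S" "\<And>S. S \<in> L \<Longrightarrow> p = f' (Y S)" by metis
      have YX: "Y S \<in> ?X" if "S \<in> L" for S using Y(1)[OF that] that L(1) by (auto simp: skeleton_def)
      have "\<exists>j\<in>S. Y S j \<ge> 1 / real (N + 1)" if S: "S \<in> L" for S
      proof (rule ccontr)
        note fS = facesD[OF subsetD[OF L(1) S]]
        assume "\<not> (\<exists>j\<in>S. Y S j \<ge> 1 / real (N + 1))"
        then have "Y S j < 1 / real (N + 1)" if "j \<in> S" for j using that by (meson not_le)
        then have "sum (Y S) S < (\<Sum>j\<in>S. 1 / real (N + 1))"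
          using fS(1,2) by (intro sum_strict_mono)
        also have "\<dots> = real (card S) / real (N + 1)" by simp
        also have "\<dots> \<le> 1" using card_mono[OF _ fS(3)] by (simp add: field_simps)
        finally show False using Y(1)[OF S] by (simp add: realization_def)
      qed
      then obtain v0 where v0: "\<And>S. S \<in> L \<Longrightarrow> v0 S \<in> S" "\<And>S. S \<in> L \<Longrightarrow> Y S (v0 S) \<ge> 1 / real (N + 1)" by metis
      define v where "v = restrict v0 L"
      have zEV: "((L, T, c), v) \<in> EV" unfolding EV_def v_def using LTc v0 by auto
      \<comment> \<open>The faces are disjoint, so their points combine into one vector of
        barycentric coordinates, from which \<open>restr S\<close> recovers each of them.\<close>
      define y where "y j = (if \<exists>S\<in>L. j \<in> S then Y (THE S. S \<in> L \<and> j \<in> S) j else 0)" for j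
      have yY: "y j = Y S j" if "S \<in> L" "j \<in> S" for S j
      proof -
        have "(THE S. S \<in> L \<and> j \<in> S) = S"
          using that L(2) by (intro the_equality) (auto simp: disjoint_def)
        then show ?thesis using that unfolding y_def by auto
      qed
      have ry: "restr S y = Y S" if S: "S \<in> L" for S
        using yY[OF S] Y(1)[OF S] by (auto simp: restr_def realization_def fun_eq_iff)
      have sumN: "(\<Sum>j\<le>N. Y S j * real (w (j, k))) = (\<Sum>j\<in>S. y j * real (w (j, k)))" if S: "S \<in> L" for S k
      proof -
        have "(\<Sum>j\<le>N. Y S j * real (w (j, k))) = (\<Sum>j\<in>S. Y S j * real (w (j, k)))"
          using facesD[OF subsetD[OF L(1) S]] Y(1)[OF S]
          by (intro sum.mono_neutral_right) (auto simp: realization_def)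
        then show ?thesis using yY[OF S] by simp
      qed
      obtain S0 where S0: "S0 \<in> L"
      proof -
        have "L \<noteq> {}"
        proof
          assume "L = {}"
          then have "card T > d" using L(4) by (simp add: codim_def)
          then show False using card_mono[OF _ L(3)] by simp
        qed
        then show thesis using that by blast
      qed
      have "w \<in> Bad n ((L, T, c), v)"
        unfolding Bad_def prod.case bad_params_def
      proof (rule CollectI, rule conjI, goal_cases)
        case 2
        show ?case
        proof (rule exI[of _ y], rule exI[of _ p], intro conjI ballI allI impI)
          show "p k = c k" if "k \<in> T" for k using pc that by blast
          show "\<bar>p k\<bar> \<le> M" if k: "k < d" for k
          proof -
            define t where "t = e / real n * (\<Sum>j\<le>N. Y S0 j * real (w (j, k)))"
            have "p k = \<phi> (Y S0) k + t"
              using Y(2)[OF S0] k unfolding f'_def t_def by simp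
            moreover have "\<bar>t\<bar> \<le> e" using pert[OF YX[OF S0] k] unfolding t_def .
            moreover have "e \<le> \<epsilon>" using \<epsilon> unfolding e_def by simp
            ultimately show ?thesis using b[OF YX[OF S0], of k] bM[OF k] by linarith
          qed
          fix S assume S: "S \<in> L"
          show "restr S y \<in> realization S" using ry[OF S] Y(1)[OF S] by simp
          show "1 / real (N + 1) \<le> y (v S)" using yY[OF S v0(1)[OF S]] v0(2)[OF S] S unfolding v_def by simp
          show "p k = \<phi> (restr S y) k + e / real n * (\<Sum>j\<in>S. y j * real (w (j, k)))" if k: "k < d" for k
          proof -
            have "p k = f' (Y S) k" using Y(2)[OF S] by simp
            then show ?thesis using k sumN[OF S, of k] unfolding ry[OF S] f'_def by simp
          qed
        qed
      qed (fact w(1))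
      then show False using w(2)[OF zEV] by simp
    qed
  qed
qed

section \<open>Cells and extensions avoiding them\<close>

definition supp :: "(nat \<Rightarrow> real) \<Rightarrow> nat set"
  where "supp x = {i. x i \<noteq> 0}"

lemma supp_realization:
  assumes "finite A" "x \<in> realization A"
  shows "supp x \<subseteq> A" "supp x \<noteq> {}" "x \<in> realization (supp x)" "finite (supp x)"
proof -
  show sub: "supp x \<subseteq> A" using assms by (auto simp: supp_def realization_def)
  then show "finite (supp x)" using assms(1) by (rule finite_subset)
  have "sum x (supp x) = sum x A"
    using sub assms(1) by (intro sum.mono_neutral_left) (auto simp: supp_def)
  then show r: "x \<in> realization (supp x)" using assms(2) by (auto simp: realization_def supp_def)
  then show "supp x \<noteq> {}" by (rule realization_nonempty_set)
qed

lemma skeleton_supp: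
  assumes "x \<in> skeleton N k"
  shows "supp x \<subseteq> {..N}" "supp x \<noteq> {}" "card (supp x) \<le> k + 1" "x \<in> realization (supp x)"
proof -
  obtain A where A: "A \<in> faces N k" "x \<in> realization A" using assms by (auto simp: skeleton_def)
  note fA = facesD[OF A(1)]
  note sp = supp_realization[OF fA(1) A(2)]
  show "supp x \<subseteq> {..N}" "supp x \<noteq> {}" "x \<in> realization (supp x)" using sp fA by auto
  show "card (supp x) \<le> k + 1" using card_mono[OF fA(1) sp(1)] fA(4) by linarith
qed

lemma realization_subset_skeleton: "A \<in> faces N k \<Longrightarrow> realization A \<subseteq> skeleton N k"
  by (auto simp: skeleton_def)

lemma facesI: "A \<noteq> {} \<Longrightarrow> A \<subseteq> {..N} \<Longrightarrow> card A \<le> k + 1 \<Longrightarrow> A \<in> faces N k"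
  by (auto simp: faces_def face_dim_def)

lemma boundaryI:
  assumes "finite A" "x \<in> realization A" "supp x \<noteq> A"
  shows "x \<in> boundary A"
  using supp_realization[OF assms(1,2)] assms(3) unfolding boundary_def by blast

lemma boundary_supp:
  assumes "finite A" "x \<in> boundary A"
  shows "supp x \<subset> A"
proof -
  obtain B where B: "B \<subset> A" "x \<in> realization B" using assms(2) by (auto simp: boundary_def)
  then show ?thesis using supp_realization(1)[of B x] assms(1) finite_subset by blast
qed

lemma boundary_subset_skeleton:
  assumes "A \<subseteq> {..N}" "card A = d + 1"
  shows "boundary A \<subseteq> skeleton N (d - 1)"
proof
  fix x assume x: "x \<in> boundary A"
  have fin: "finite A" using assms(1) finite_subset by auto
  have s: "supp x \<subset> A" using boundary_supp[OF fin x] .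
  have r: "x \<in> realization A" using x boundary_subset[OF fin] by auto
  have "card (supp x) < d + 1" using psubset_card_mono[OF fin s] assms(2) by simp
  then have "supp x \<in> faces N (d - 1)"
    using supp_realization[OF fin r] s assms(1) by (intro facesI) auto
  then show "x \<in> skeleton N (d - 1)"
    using supp_realization(3)[OF fin r] realization_subset_skeleton by blast
qed

text \<open>Adding up \<open>d + 1 - card S\<close> over all sets gives
  \<open>codim d L + card (\<Union>\<S>) = (d + 1) * q + ex\<close>, with \<open>L\<close> the small
  sets and \<open>ex\<close> the surplus of the large ones over \<open>d + 1\<close> vertices. Few
  vertices thus force a large codimension; if it is least possible, there is no surplus and every
  available vertex is used. It is applied with \<open>t = 1\<close>, as the old simplex has
  \<open>(d + 1) * (q - 1) + 1\<close> vertices.\<close>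

lemma codim_count:
  assumes S: "finite \<S>" "disjoint \<S>" "\<And>S. S \<in> \<S> \<Longrightarrow> finite S" and q: "card \<S> = q" "q > 0"
    and U: "card (\<Union>\<S>) \<le> (d + 1) * (q - 1) + t" "t \<le> d + 1"
  shows "codim d {S \<in> \<S>. card S \<le> d} + t \<ge> d + 1"
    and "codim d {S \<in> \<S>. card S \<le> d} + t \<le> d + 1 \<Longrightarrow> S \<in> \<S> \<Longrightarrow> card S > d \<Longrightarrow> card S = d + 1"
    and "codim d {S \<in> \<S>. card S \<le> d} + t \<le> d + 1 \<Longrightarrow> card (\<Union>\<S>) = (d + 1) * (q - 1) + t"
proof -
  define L where "L = {S \<in> \<S>. card S \<le> d}"
  define H where "H = \<S> - L"
  have Hgt: "card S > d" if "S \<in> H" for S using that unfolding H_def L_def by auto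
  have LH: "L \<union> H = \<S>" "L \<inter> H = {}" "finite L" "finite H"
    unfolding H_def L_def using S(1) by auto
  have cU: "card (\<Union>\<S>) = sum card L + sum card H"
  proof -
    have "card (\<Union>\<S>) = sum card \<S>"
      using S by (intro card_Union_disjoint) (auto simp: pairwise_def disjoint_def disjnt_def)
    then show ?thesis using LH sum.union_disjoint[of L H card] by simp
  qed
  have cd: "codim d L + sum card L = card L * (d + 1)"
  proof -
    have "codim d L + sum card L = (\<Sum>S\<in>L. (d + 1 - card S) + card S)"
      unfolding codim_def by (simp add: sum.distrib)
    also have "\<dots> = (\<Sum>S\<in>L. d + 1)" by (intro sum.cong) (auto simp: L_def)
    finally show ?thesis by simp
  qed
  define ex where "ex = (\<Sum>S\<in>H. card S - (d + 1))"
  have hh: "sum card H = card H * (d + 1) + ex"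
  proof -
    have "sum card H = (\<Sum>S\<in>H. (d + 1) + (card S - (d + 1)))" 
    proof (rule sum.cong)
      show "card S = (d + 1) + (card S - (d + 1))" if "S \<in> H" for S using Hgt[OF that] by linarith
    qed simp
    also have "\<dots> = card H * (d + 1) + ex" unfolding ex_def sum.distrib by simp
    finally show ?thesis .
  qed
  have "card L + card H = q" using LH q card_Un_disjoint[of L H] by simp
  then have "card L * (d + 1) + card H * (d + 1) = q * (d + 1)" by (metis distrib_right)
  moreover have "(d + 1) * (q - 1) + (d + 1) = q * (d + 1)" using q(2) by (cases q) (auto simp: algebra_simps)
  ultimately have key: "codim d L + card (\<Union>\<S>) = (d + 1) * (q - 1) + (d + 1) + ex"
    using cU cd hh by linarith
  show "codim d {S \<in> \<S>. card S \<le> d} + t \<ge> d + 1"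
    using key U unfolding L_def[symmetric] by linarith
  {
    assume "codim d {S \<in> \<S>. card S \<le> d} + t \<le> d + 1"
    then have c: "codim d L + t \<le> d + 1" unfolding L_def .
    then have ex0: "ex = 0" using key U by linarith
    show "card (\<Union>\<S>) = (d + 1) * (q - 1) + t" using key U c ex0 by linarith
    show "card S = d + 1" if "S \<in> \<S>" "card S > d"
    proof -
      have "S \<in> H" using that unfolding H_def L_def by auto
      then have "card S - (d + 1) = 0" using ex0 LH(4) unfolding ex_def by simp
      then show ?thesis using that by linarith
    qed
  }
qed

section \<open>Grid cells\<close>

definition cell :: "nat \<Rightarrow> real \<Rightarrow> (nat \<Rightarrow> int) \<Rightarrow> (nat \<Rightarrow> real) set"
  where "cell d \<delta> c = {x. \<forall>k<d. \<bar>x k / \<delta> - (of_int (c k) + 1 / 2)\<bar> \<le> 1 / 2}"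

text \<open>The value 0 from index \<open>d\<close> on makes the set of indices finite over a
  bounded set.\<close>

definition cell_index :: "nat \<Rightarrow> real \<Rightarrow> (nat \<Rightarrow> real) \<Rightarrow> nat \<Rightarrow> int"
  where "cell_index d \<delta> p k = (if k < d then \<lfloor>p k / \<delta>\<rfloor> else 0)"

lemma in_cell_index: "p \<in> cell d \<delta> (cell_index d \<delta> p)"
proof -
  have "\<bar>u - (of_int \<lfloor>u\<rfloor> + 1 / 2)\<bar> \<le> 1 / 2" for u :: real
    unfolding abs_le_iff by linarith
  then show ?thesis unfolding cell_def cell_index_def by simp
qed

lemma cell_near:
  assumes "x \<in> cell d \<delta> c" "y \<in> cell d \<delta> c" "\<delta> > 0" "k < d"
  shows "\<bar>x k - y k\<bar> \<le> \<delta>"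
proof -
  have "\<bar>x k / \<delta> - (of_int (c k) + 1 / 2)\<bar> \<le> 1 / 2" "\<bar>y k / \<delta> - (of_int (c k) + 1 / 2)\<bar> \<le> 1 / 2"
    using assms unfolding cell_def by auto
  then have "\<bar>x k / \<delta> - y k / \<delta>\<bar> \<le> 1" by linarith
  then have "\<bar>x k - y k\<bar> / \<delta> \<le> 1" using assms(3) by (simp flip: diff_divide_distrib)
  then show ?thesis using assms(3) by (simp add: field_simps)
qed

lemma finite_cell_index:
  assumes b: "\<And>p k. p \<in> I \<Longrightarrow> k < d \<Longrightarrow> \<bar>p k\<bar> \<le> b" and "\<delta> > 0"
  shows "finite (cell_index d \<delta> ` I)"
proof -
  define Z where "Z = {\<lfloor>- (\<bar>b\<bar> / \<delta>)\<rfloor> .. \<lfloor>\<bar>b\<bar> / \<delta>\<rfloor>}"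
  have "cell_index d \<delta> ` I \<subseteq> {c. \<forall>k. (k \<in> {..<d} \<longrightarrow> c k \<in> Z) \<and> (k \<notin> {..<d} \<longrightarrow> c k = 0)}"
  proof
    fix c assume "c \<in> cell_index d \<delta> ` I"
    then obtain p where p: "p \<in> I" "c = cell_index d \<delta> p" by auto
    have "c k \<in> Z" if "k < d" for k
    proof -
      have "\<bar>p k\<bar> \<le> \<bar>b\<bar>" using b[OF p(1) that] by simp
      then have "- (\<bar>b\<bar> / \<delta>) \<le> p k / \<delta>" "p k / \<delta> \<le> \<bar>b\<bar> / \<delta>"
        using \<open>\<delta> > 0\<close> divide_right_mono[of "- \<bar>b\<bar>" "p k" \<delta>] divide_right_mono[of "p k" "\<bar>b\<bar>" \<delta>]
        by (auto simp: abs_le_iff)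
      then show ?thesis using that unfolding p(2) cell_index_def Z_def by (simp add: floor_mono)
    qed
    then show "c \<in> {c. \<forall>k. (k \<in> {..<d} \<longrightarrow> c k \<in> Z) \<and> (k \<notin> {..<d} \<longrightarrow> c k = 0)}"
      unfolding p(2) cell_index_def by auto
  qed
  moreover have "finite {c. \<forall>k. (k \<in> {..<d} \<longrightarrow> c k \<in> Z) \<and> (k \<notin> {..<d} \<longrightarrow> c k = (0::int))}"
    by (rule finite_set_of_finite_funs) (auto simp: Z_def)
  ultimately show ?thesis by (rule finite_subset)
qed

text \<open>Off the grid hyperplanes small moves do not change the floors. Arbitrary heights
  assigned to the cells are therefore continuous on such a set.\<close>

lemma cell_index_locally_constant:
  assumes off: "\<And>p k z. p \<in> I \<Longrightarrow> k < d \<Longrightarrow> p k \<noteq> \<delta> * of_int z" and \<delta>: "\<delta> > 0"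
  shows "continuous_on I (\<lambda>p. \<psi> (cell_index d \<delta> p) :: real)"
  unfolding continuous_on_topological
proof (intro ballI allI impI)
  fix p B assume p: "p \<in> I" and B: "\<psi> (cell_index d \<delta> p) \<in> B"
  define U where "U = (\<Inter>k<d. {x. of_int \<lfloor>p k / \<delta>\<rfloor> < x k / \<delta>} \<inter> {x. x k / \<delta> < of_int \<lfloor>p k / \<delta>\<rfloor> + 1})"
  have "open U"
    unfolding U_def by (intro open_INT open_Int open_Collect_less continuous_intros ballI finite_lessThan) (use \<delta> in auto)
  moreover have "p \<in> U"
  proof -
    have "of_int \<lfloor>p k / \<delta>\<rfloor> \<noteq> p k / \<delta>" if "k < d" for k
      using off[OF p that, of "\<lfloor>p k / \<delta>\<rfloor>"] \<delta> by (auto simp: field_simps)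
    moreover have "of_int \<lfloor>p k / \<delta>\<rfloor> \<le> p k / \<delta>" "p k / \<delta> < of_int \<lfloor>p k / \<delta>\<rfloor> + 1" for k by linarith+
    ultimately show ?thesis unfolding U_def by (auto simp: order.strict_iff_order)
  qed
  moreover have "\<psi> (cell_index d \<delta> x) \<in> B" if "x \<in> U" for x
  proof -
    have "\<lfloor>x k / \<delta>\<rfloor> = \<lfloor>p k / \<delta>\<rfloor>" if "k < d" for k
      using \<open>x \<in> U\<close> that unfolding U_def by (intro floor_unique) (auto simp: less_imp_le)
    then have "cell_index d \<delta> x = cell_index d \<delta> p" unfolding cell_index_def by auto
    then show ?thesis using B by simp
  qed
  ultimately show "\<exists>A. open A \<and> p \<in> A \<and> (\<forall>y\<in>I. y \<in> A \<longrightarrow> \<psi> (cell_index d \<delta> y) \<in> B)" by blast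
qed

text \<open>The substitute for a nonzero winding number: the boundary values force every extension
  over the \<open>d\<close>-face into \<open>Z\<close>. It requires no degree theory, and in the
  limit of shrinking cells it yields membership in \<open>winding_set\<close>.\<close>

definition extensions_hit ::
    "nat \<Rightarrow> nat set \<Rightarrow> ((nat \<Rightarrow> real) \<Rightarrow> nat \<Rightarrow> real) \<Rightarrow> (nat \<Rightarrow> real) set \<Rightarrow> bool"
  where "extensions_hit d A f Z \<longleftrightarrow> (\<forall>G. continuous_on (realization A) G \<longrightarrow>
     G \<in> realization A \<rightarrow> coords d \<longrightarrow> (\<forall>x\<in>boundary A. G x = f x) \<longrightarrow> (\<exists>x\<in>realization A. G x \<in> Z))"

text \<open>Each \<open>d\<close>-face is treated separately: it gets an extension missing
  \<open>Z\<close> if there is one, and any Tietze extension otherwise. Distinct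
  \<open>d\<close>-faces overlap only in the \<open>(d - 1)\<close>-skeleton, where all choices
  equal \<open>f\<close>.\<close>

lemma extension_avoiding:
  assumes d: "d > 0" and f: "continuous_on (skeleton N (d - 1)) f" "\<And>x. f x \<in> coords d"
  obtains E where "continuous_on (skeleton N d) E" "\<And>x. E x \<in> coords d"
    "\<And>x. x \<in> skeleton N (d - 1) \<Longrightarrow> E x = f x"
    "\<And>A x. A \<subseteq> {..N} \<Longrightarrow> card A = d + 1 \<Longrightarrow> x \<in> realization A \<Longrightarrow> E x \<in> Z \<Longrightarrow> extensions_hit d A f Z"
proof -
  define P where "P A G \<longleftrightarrow> continuous_on (realization A) G \<and> G \<in> realization A \<rightarrow> coords d \<and>
    (\<forall>x\<in>boundary A. G x = f x) \<and> ((\<exists>x\<in>realization A. G x \<in> Z) \<longrightarrow> extensions_hit d A f Z)" for A G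
  have "\<exists>G. P A G" if A: "A \<subseteq> {..N}" "card A = d + 1" for A
  proof (cases "extensions_hit d A f Z")
    case True
    have fin: "finite A" using A finite_subset by auto
    have "continuous_on (boundary A) f"
      using f(1) boundary_subset_skeleton[OF A] by (rule continuous_on_subset)
    moreover have fB: "f \<in> boundary A \<rightarrow> coords d" using f(2) by blast
    ultimately obtain G where "continuous_on UNIV G" "\<And>x. G x \<in> coords d" "\<And>x. x \<in> boundary A \<Longrightarrow> G x = f x"
      using Tietze_coords[OF compact_imp_closed[OF compact_boundary[OF fin]] _ fB] by blast
    then show ?thesis using True unfolding P_def by (intro exI[of _ G]) (auto intro: continuous_on_subset)
  qed (auto simp: extensions_hit_def P_def)
  then obtain G where PG: "\<And>A. A \<subseteq> {..N} \<Longrightarrow> card A = d + 1 \<Longrightarrow> P A (G A)"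
    by metis
  have G: "continuous_on (realization A) (G A)" "G A \<in> realization A \<rightarrow> coords d"
    "\<And>x. x \<in> boundary A \<Longrightarrow> G A x = f x"
    "\<And>x. x \<in> realization A \<Longrightarrow> G A x \<in> Z \<Longrightarrow> extensions_hit d A f Z"
    if "A \<subseteq> {..N}" "card A = d + 1" for A
    using PG[OF that] unfolding P_def by auto
  \<comment> \<open>Outside the \<open>(d - 1)\<close>-skeleton, \<open>supp x\<close> is the only
    \<open>d\<close>-face containing \<open>x\<close>.\<close>
  define E where "E x = (if x \<in> skeleton N d - skeleton N (d - 1) then G (supp x) x else f x)" for x
  have EG: "E x = G A x" if A: "A \<subseteq> {..N}" "card A = d + 1" and x: "x \<in> realization A" for A x
  proof -
    have fin: "finite A" using A finite_subset by auto
    have "A \<in> faces N d" using A by (intro facesI) auto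
    then have xs: "x \<in> skeleton N d" using x realization_subset_skeleton by blast
    show ?thesis
    proof (cases "supp x = A")
      case True
      have "x \<notin> skeleton N (d - 1)"
        using skeleton_supp(3)[of x N "d - 1"] True A(2) d by auto
      then show ?thesis unfolding E_def using xs True by simp
    next
      case False
      then have b: "x \<in> boundary A" using boundaryI[OF fin x] by simp
      then have "x \<in> skeleton N (d - 1)" using boundary_subset_skeleton[OF A] by auto
      then show ?thesis unfolding E_def using G(3)[OF A b] by simp
    qed
  qed
  show thesis
  proof (rule that[of E])
    show Ef: "E x = f x" if "x \<in> skeleton N (d - 1)" for x using that unfolding E_def by simp
    show "continuous_on (skeleton N d) E"
      unfolding skeleton_def[of N d]
    proof (rule continuous_on_closed_Union[OF finite_faces])
      fix A assume A: "A \<in> faces N d"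
      note fA = facesD[OF A]
      show "closed (realization A)" using compact_realization[OF fA(1)] by (rule compact_imp_closed)
      show "continuous_on (realization A) E"
      proof (cases "card A = d + 1")
        case True
        then show ?thesis using G(1)[OF fA(3) True] EG[OF fA(3) True] by (subst continuous_on_cong) auto
      next
        case False
        then have "A \<in> faces N (d - 1)" using fA d by (intro facesI) auto
        then have "realization A \<subseteq> skeleton N (d - 1)" by (rule realization_subset_skeleton)
        then show ?thesis
          by (intro continuous_on_eq[OF continuous_on_subset[OF f(1)]]) (auto intro!: Ef[symmetric])
      qed
    qed
    show "E x \<in> coords d" for x
    proof (cases "x \<in> skeleton N d - skeleton N (d - 1)")
      case True
      then have x: "x \<in> skeleton N d" by simp
      note sx = skeleton_supp[OF x]
      have "supp x \<notin> faces N (d - 1)" using True sx(4) realization_subset_skeleton by blast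
      then have "card (supp x) = d + 1" using sx d facesI[of "supp x" N "d - 1"] by linarith
      then have "G (supp x) x \<in> coords d" using G(2)[OF sx(1)] sx(4) by blast
      then show ?thesis unfolding E_def using True by simp
    next
      case False
      then have "E x = f x" unfolding E_def by (rule if_not_P)
      then show ?thesis using f(2)[of x] by simp
    qed
    show "extensions_hit d A f Z" if "A \<subseteq> {..N}" "card A = d + 1" "x \<in> realization A" "E x \<in> Z" for A x
      using G(4)[OF that(1-3)] that(4) EG[OF that(1-3)] by simp
  qed
qed

section \<open>Lifting a generic map\<close>

text \<open>General position: the images of disjoint faces of dimension less than \<open>d\<close>
  have no common point when the expected dimension is negative, and none on the grid when it is 0,
  since a grid hyperplane is one more condition. The case \<open>q = 1\<close>, without new
  vertices, is settled in the final theorem.\<close>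

locale generic_map =
  fixes N d q :: nat and f :: "(nat \<Rightarrow> real) \<Rightarrow> nat \<Rightarrow> real" and \<delta> :: real
  assumes d_pos: "d > 0" and q_ge: "q \<ge> 2" and N_eq: "N = (d + 1) * (q - 1)" and \<delta>_pos: "\<delta> > 0"
    and f_cont: "continuous_on (skeleton N (d - 1)) f" and f_coords: "f x \<in> coords d"
    and empty_meet: "\<And>L p. \<lbrakk>L \<subseteq> faces N (d - 1); disjoint L; codim d L > d\<rbrakk> \<Longrightarrow>
      \<exists>S\<in>L. p \<notin> f ` realization S"
    and off_grid: "\<And>L p k z. \<lbrakk>L \<subseteq> faces N (d - 1); disjoint L; codim d L = d; k < d;
      \<And>S. S \<in> L \<Longrightarrow> p \<in> f ` realization S\<rbrakk> \<Longrightarrow> p k \<noteq> \<delta> * of_int z"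
begin

abbreviation "M \<equiv> N + (q - 1)"
abbreviation "\<kappa> \<equiv> cell_index d \<delta>"
abbreviation "simplex \<equiv> realization {..M}"

text \<open>The set \<open>I\<close> of the overview. The horizontal part of every relevant
  coincidence lies here, so cells and heights matter only over this set.\<close>

definition meets :: "(nat \<Rightarrow> real) set"
  where "meets = {p. \<exists>L. L \<subseteq> faces N (d - 1) \<and> disjoint L \<and> codim d L = d \<and> (\<forall>S\<in>L. p \<in> f ` realization S)}"

definition new_weight :: "(nat \<Rightarrow> real) \<Rightarrow> real"
  where "new_weight x = (\<Sum>j\<in>{N<..M}. x j)"

text \<open>The large simplex is the join of the old simplex and the simplex of the new vertices;
  this is the projection to the old one. It is meaningful for new weight less than 1, and the
  constructions use it for new weight at most \<open>1 / 3\<close>.\<close>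

definition old_part :: "(nat \<Rightarrow> real) \<Rightarrow> nat \<Rightarrow> real"
  where "old_part x = (\<lambda>i. if i \<le> N then x i / (1 - new_weight x) else 0)"

definition old_supp :: "(nat \<Rightarrow> real) \<Rightarrow> nat set"
  where "old_supp x = {i. i \<le> N \<and> x i \<noteq> 0}"

definition slab :: "real set \<Rightarrow> nat set \<Rightarrow> (nat \<Rightarrow> real) set"
  where "slab T A = {x \<in> simplex. new_weight x \<in> T \<and> old_supp x \<subseteq> A}"

lemma finite_cells: "finite (\<kappa> ` meets)"
proof -
  have "bounded ((\<lambda>x. f x k) ` skeleton N (d - 1))" for k
    using f_cont by (intro compact_imp_bounded compact_continuous_image compact_skeleton continuous_on_coordinate)
  then have "\<exists>b. \<forall>x\<in>skeleton N (d - 1). \<bar>f x k\<bar> \<le> b" for k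
    unfolding bounded_iff by auto
  then obtain b where b: "\<And>k x. x \<in> skeleton N (d - 1) \<Longrightarrow> \<bar>f x k\<bar> \<le> b k" by metis
  have "\<bar>p k\<bar> \<le> (\<Sum>k<d. \<bar>b k\<bar>)" if p: "p \<in> meets" and k: "k < d" for p k
  proof -
    obtain L where L: "L \<subseteq> faces N (d - 1)" "codim d L = d" "\<forall>S\<in>L. p \<in> f ` realization S"
      using p unfolding meets_def by auto
    have "L \<noteq> {}" using L(2) d_pos by (auto simp: codim_def)
    then obtain S where S: "S \<in> L" by blast
    then obtain x where x: "x \<in> realization S" "p = f x" using L(3) by auto
    have "x \<in> skeleton N (d - 1)" using x S L(1) realization_subset_skeleton by blast
    then have "\<bar>p k\<bar> \<le> \<bar>b k\<bar>" using b[of x k] x by simp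
    also have "\<dots> \<le> (\<Sum>k<d. \<bar>b k\<bar>)" using k by (intro member_le_sum) auto
    finally show ?thesis .
  qed
  then show ?thesis using \<delta>_pos by (rule finite_cell_index)
qed

lemma continuous_on_cell_index: "continuous_on meets (\<lambda>p. \<psi> (\<kappa> p) :: real)"
proof (rule cell_index_locally_constant[OF _ \<delta>_pos])
  fix p k z assume "p \<in> meets" "k < d"
  then show "p k \<noteq> \<delta> * of_int z" unfolding meets_def using off_grid by blast
qed

lemma simplex_facts:
  assumes "x \<in> simplex"
  shows "0 \<le> new_weight x" "new_weight x \<le> 1" "(\<Sum>i\<le>N. x i) = 1 - new_weight x" "x i \<ge> 0"
proof -
  show nn: "x i \<ge> 0" for i using assms by (simp add: realization_def)
  show w0: "0 \<le> new_weight x" unfolding new_weight_def using nn by (intro sum_nonneg)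
  have "(\<Sum>i\<le>M. x i) = (\<Sum>i\<le>N. x i) + (\<Sum>j\<in>{N<..M}. x j)"
    by (subst sum.union_disjoint[symmetric]) (auto intro!: sum.cong)
  then show s: "(\<Sum>i\<le>N. x i) = 1 - new_weight x"
    using assms by (simp add: realization_def new_weight_def)
  have "(\<Sum>i\<le>N. x i) \<ge> 0" using nn by (intro sum_nonneg)
  then show "new_weight x \<le> 1" using s by simp
qed

lemma old_supp_finite: "finite (old_supp x)" "old_supp x \<subseteq> {..N}"
  by (auto simp: old_supp_def)

lemma old_part_realization:
  assumes x: "x \<in> simplex" "new_weight x < 1"
  shows "old_part x \<in> realization (old_supp x)"
proof -
  have "(\<Sum>i\<in>old_supp x. old_part x i) = (\<Sum>i\<le>N. old_part x i)"
    by (intro sum.mono_neutral_left) (auto simp: old_supp_def old_part_def)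
  also have "\<dots> = (\<Sum>i\<le>N. x i) / (1 - new_weight x)"
    unfolding old_part_def sum_divide_distrib by (intro sum.cong) auto
  also have "\<dots> = 1" using simplex_facts(3)[OF x(1)] x(2) by simp
  finally show ?thesis
    using simplex_facts(4)[OF x(1)] x(2) by (auto simp: realization_def old_part_def old_supp_def)
qed

lemma old_supp_nonempty: "x \<in> simplex \<Longrightarrow> new_weight x < 1 \<Longrightarrow> old_supp x \<noteq> {}"
  using old_part_realization realization_nonempty_set by blast

lemma old_part_slab:
  assumes "x \<in> slab T A" "T \<subseteq> {..1/3}" "finite A"
  shows "old_part x \<in> realization A"
proof -
  have x: "x \<in> simplex" "new_weight x < 1" "old_supp x \<subseteq> A" using assms by (auto simp: slab_def)
  show ?thesis using old_part_realization[OF x(1,2)] realization_mono[OF x(3) assms(3)] by blast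
qed

lemma continuous_on_new_weight: "continuous_on S new_weight"
  unfolding new_weight_def by (intro continuous_intros)

lemma closed_slab: "closed T \<Longrightarrow> closed (slab T A)"
proof -
  assume T: "closed T"
  have "slab T A = simplex \<inter> new_weight -` T \<inter> (\<Inter>i\<in>{..N} - A. {x. x i = 0})"
    unfolding slab_def old_supp_def by auto
  moreover have "closed (new_weight -` T)"
    by (rule closed_vimage[OF T continuous_on_new_weight])
  moreover have "closed {x::nat\<Rightarrow>real. x i = 0}" for i by (intro closed_Collect_eq continuous_intros)
  moreover have "closed simplex" by (intro compact_imp_closed compact_realization) simp
  ultimately show ?thesis by (simp add: closed_Int closed_INT)
qed

lemma continuous_on_old_part:
  assumes "T \<subseteq> {..1/3}"
  shows "continuous_on (slab T A) old_part"
  unfolding old_part_def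
proof (rule continuous_on_coordinatewise_then_product)
  fix i
  have "1 - new_weight x \<noteq> 0" if "x \<in> slab T A" for x using that assms by (auto simp: slab_def)
  then show "continuous_on (slab T A) (\<lambda>x. if i \<le> N then x i / (1 - new_weight x) else 0)"
    by (cases "i \<le> N") (auto intro!: continuous_intros continuous_on_new_weight)
qed

text \<open>The last condition says that \<open>A\<close> and \<open>L\<close> have the right dimensions to be members of a partition
  that uses all vertices and has no other members of dimension less than \<open>d\<close>.\<close>

definition balanced :: "nat set \<Rightarrow> nat set set \<Rightarrow> bool"
  where "balanced A L \<longleftrightarrow> N \<in> A \<and> A \<in> faces N d \<and> L \<subseteq> faces N (d - 1) \<and> disjoint L \<and>
    (\<forall>S\<in>L. S \<inter> A = {}) \<and> codim d L + (d + 1 - card A) = d"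

end

section \<open>The horizontal part of the lift\<close>

locale lift_data = generic_map +
  fixes E :: "(nat \<Rightarrow> int) \<Rightarrow> (nat \<Rightarrow> real) \<Rightarrow> nat \<Rightarrow> real" and H :: "(nat \<Rightarrow> int) \<Rightarrow> real"
  assumes E_cont: "continuous_on (skeleton N d) (E c)" and E_coords: "E c x \<in> coords d"
    and E_ext: "x \<in> skeleton N (d - 1) \<Longrightarrow> E c x = f x"
    and E_hit: "\<lbrakk>A \<subseteq> {..N}; card A = d + 1; x \<in> realization A; E c x \<in> cell d \<delta> c\<rbrakk>
      \<Longrightarrow> extensions_hit d A f (cell d \<delta> c)"
    and H_inj: "inj_on H (\<kappa> ` meets)" and H_pos: "H c > 0" and H_le: "H c \<le> 1 / 3"
begin

text \<open>Values are prescribed on two closed sets: \<open>low\<close>, where the old part has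
  dimension less than \<open>d\<close>, and \<open>mid\<close>, formed by the levels
  \<open>H c\<close>. They agree on the overlap because \<open>E c\<close> extends \<open>f\<close>,
  and injectivity of \<open>H\<close> recovers \<open>c\<close> from the level. Tietze fills in the
  rest without any control on \<open>d\<close>-faces.\<close>

lemma ex_Phi:
  "\<exists>\<Phi>. continuous_on UNIV \<Phi> \<and> (\<forall>x. \<Phi> x \<in> coords d) \<and>
    (\<forall>x\<in>simplex. new_weight x \<le> 1 / 3 \<longrightarrow> card (old_supp x) \<le> d \<longrightarrow> \<Phi> x = f (old_part x)) \<and>
    (\<forall>x\<in>simplex. \<forall>c\<in>\<kappa> ` meets. new_weight x = H c \<longrightarrow> card (old_supp x) \<le> d + 1 \<longrightarrow> \<Phi> x = E c (old_part x))"
proof -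
  define \<Phi>0 where "\<Phi>0 x = (if card (old_supp x) \<le> d then f (old_part x)
    else E (the_inv_into (\<kappa> ` meets) H (new_weight x)) (old_part x))" for x
  define low where "low = (\<Union>A\<in>faces N (d - 1). slab {..1/3} A)"
  define mid where "mid = (\<Union>z\<in>\<kappa> ` meets \<times> faces N d. slab {H (fst z)} (snd z))"
  have \<Phi>0_mid: "\<Phi>0 x = E c (old_part x)" if x: "x \<in> simplex" "new_weight x = H c" and c: "c \<in> \<kappa> ` meets" for x c
  proof (cases "card (old_supp x) \<le> d")
    case True
    have nw: "new_weight x < 1" using H_le[of c] x by linarith
    have "old_supp x \<in> faces N (d - 1)"
      using True old_supp_nonempty[OF x(1) nw] old_supp_finite d_pos by (intro facesI) auto
    then have "old_part x \<in> skeleton N (d - 1)"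
      using old_part_realization[OF x(1) nw] realization_subset_skeleton by blast
    then show ?thesis unfolding \<Phi>0_def using True E_ext by simp
  next
    case False
    then show ?thesis unfolding \<Phi>0_def x(2) using the_inv_into_f_f[OF H_inj c] by simp
  qed
  have cl_low: "closed low" unfolding low_def by (intro closed_UN finite_faces closed_slab ballI) simp
  have cl_mid: "closed mid" unfolding mid_def
    using finite_cells finite_faces by (intro closed_UN closed_slab ballI finite_cartesian_product) auto
  have "continuous_on low \<Phi>0"
    unfolding low_def
  proof (rule continuous_on_closed_Union[OF finite_faces])
    fix A assume A: "A \<in> faces N (d - 1)"
    note fA = facesD[OF A]
    show "closed (slab {..1/3} A)" by (rule closed_slab) simp
    have "continuous_on (slab {..1/3} A) (\<lambda>x. f (old_part x))"
    proof (rule continuous_on_compose2[OF f_cont continuous_on_old_part])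
      show "old_part ` slab {..1/3} A \<subseteq> skeleton N (d - 1)"
        using old_part_slab[of _ "{..1/3}" A] fA(1) realization_subset_skeleton[OF A] by blast
    qed simp
    moreover have "f (old_part x) = \<Phi>0 x" if "x \<in> slab {..1/3} A" for x
    proof -
      have "old_supp x \<subseteq> A" using that by (simp add: slab_def)
      then have "card (old_supp x) \<le> d" using card_mono[OF fA(1), of "old_supp x"] fA(4) d_pos by linarith
      then show ?thesis unfolding \<Phi>0_def by simp
    qed
    ultimately show "continuous_on (slab {..1/3} A) \<Phi>0" by (rule continuous_on_eq)
  qed
  moreover have "continuous_on mid \<Phi>0"
    unfolding mid_def
  proof (rule continuous_on_closed_Union)
    show "finite (\<kappa> ` meets \<times> faces N d)" using finite_cells finite_faces by simp
    fix z assume "z \<in> \<kappa> ` meets \<times> faces N d"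
    then obtain c A where z: "z = (c, A)" "c \<in> \<kappa> ` meets" "A \<in> faces N d" by auto
    note fA = facesD[OF z(3)]
    show "closed (slab {H (fst z)} (snd z))" by (rule closed_slab) simp
    have H3: "{H c} \<subseteq> {..1/3}" using H_le by simp
    have "continuous_on (slab {H c} A) (\<lambda>x. E c (old_part x))"
    proof (rule continuous_on_compose2[OF E_cont continuous_on_old_part[OF H3]])
      show "old_part ` slab {H c} A \<subseteq> skeleton N d"
        using old_part_slab[OF _ H3 fA(1)] realization_subset_skeleton[OF z(3)] by blast
    qed
    moreover have "E c (old_part x) = \<Phi>0 x" if "x \<in> slab {H c} A" for x
      using that \<Phi>0_mid[OF _ _ z(2)] by (simp add: slab_def)
    ultimately show "continuous_on (slab {H (fst z)} (snd z)) \<Phi>0" unfolding z(1) fst_conv snd_conv by (rule continuous_on_eq)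
  qed
  ultimately have "continuous_on (low \<union> mid) \<Phi>0" by (rule continuous_on_closed_Un[OF cl_low cl_mid])
  moreover have "closed (low \<union> mid)" using cl_low cl_mid by (rule closed_Un)
  moreover have "\<Phi>0 \<in> low \<union> mid \<rightarrow> coords d" unfolding \<Phi>0_def using f_coords E_coords by auto
  ultimately obtain \<Phi> where \<Phi>: "continuous_on UNIV \<Phi>" "\<And>x. \<Phi> x \<in> coords d" "\<And>x. x \<in> low \<union> mid \<Longrightarrow> \<Phi> x = \<Phi>0 x"
    using Tietze_coords[of "low \<union> mid" \<Phi>0 d] by blast
  have "\<Phi> x = f (old_part x)" if x: "x \<in> simplex" "new_weight x \<le> 1 / 3" "card (old_supp x) \<le> d" for x
  proof -
    have "new_weight x < 1" using x(2) by simp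
    then have "old_supp x \<in> faces N (d - 1)"
      using x old_supp_nonempty[OF x(1)] old_supp_finite d_pos by (intro facesI) auto
    then have "x \<in> low" unfolding low_def slab_def using x by auto
    then show ?thesis using \<Phi>(3) x(3) unfolding \<Phi>0_def by simp
  qed
  moreover have "\<Phi> x = E c (old_part x)"
    if x: "x \<in> simplex" "c \<in> \<kappa> ` meets" "new_weight x = H c" "card (old_supp x) \<le> d + 1" for x c
  proof -
    have "new_weight x < 1" using H_le[of c] x(3) by linarith
    then have "old_supp x \<in> faces N d"
      using x old_supp_nonempty[OF x(1)] old_supp_finite by (intro facesI) auto
    then have "x \<in> mid" unfolding mid_def slab_def using x by auto
    then show ?thesis using \<Phi>(3) \<Phi>0_mid[OF x(1,3,2)] by simp
  qed
  ultimately show ?thesis using \<Phi>(1,2) by blast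
qed

text \<open>A \<open>d\<close>-face containing \<open>N\<close> whose boundary does not wind around the cell passes below it, all other
  faces containing \<open>N\<close> pass it at the height \<open>H c\<close>.\<close>

definition height :: "nat set \<Rightarrow> (nat \<Rightarrow> int) \<Rightarrow> real"
  where "height A c = (if card A = d + 1 \<and> (\<forall>x\<in>realization A. E c x \<notin> cell d \<delta> c) then - H c else H c)"

end

section \<open>The vertical part of the lift\<close>

locale lift_phi = lift_data +
  fixes \<Phi> :: "(nat \<Rightarrow> real) \<Rightarrow> nat \<Rightarrow> real"
  assumes \<Phi>_cont: "continuous_on UNIV \<Phi>" and \<Phi>_coords: "\<Phi> x \<in> coords d"
    and \<Phi>_low: "\<lbrakk>x \<in> simplex; new_weight x \<le> 1 / 3; card (old_supp x) \<le> d\<rbrakk> \<Longrightarrow> \<Phi> x = f (old_part x)"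
    and \<Phi>_mid: "\<lbrakk>x \<in> simplex; c \<in> \<kappa> ` meets; new_weight x = H c; card (old_supp x) \<le> d + 1\<rbrakk>
      \<Longrightarrow> \<Phi> x = E c (old_part x)"
begin

text \<open>\<open>A\<close> stands for the old part of the face through \<open>N\<close>, and
  \<open>L\<close> for the other members of dimension less than \<open>d\<close>: these are the
  points at which that face can take part in a coincidence. They may still carry new weight, which
  is excluded only at the end.\<close>

definition crossing :: "nat set \<Rightarrow> nat set set \<Rightarrow> (nat \<Rightarrow> real) set"
  where "crossing A L = {x \<in> slab {..1/3} A. \<forall>S\<in>L. \<Phi> x \<in> f ` realization S}"

text \<open>If the old part of \<open>x\<close> missed a vertex of \<open>A\<close>, adding its
  carrier to \<open>L\<close> would push the codimension above \<open>d\<close>, against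
  \<open>empty_meet\<close>. Otherwise \<open>L\<close>, enlarged by \<open>A\<close> when
  \<open>A\<close> has dimension less than \<open>d\<close>, has codimension exactly
  \<open>d\<close>.\<close>

lemma crossing_facts:
  assumes bal: "balanced A L" and x: "x \<in> crossing A L"
  shows "old_supp x = A" "\<Phi> x \<in> meets"
proof -
  have A: "N \<in> A" "A \<in> faces N d" and L: "L \<subseteq> faces N (d - 1)" "disjoint L" "\<And>S. S \<in> L \<Longrightarrow> S \<inter> A = {}"
    and cod: "codim d L + (d + 1 - card A) = d"
    using bal unfolding balanced_def by auto
  note fA = facesD[OF A(2)]
  have xs: "x \<in> simplex" "new_weight x \<le> 1/3" "new_weight x < 1" "old_supp x \<subseteq> A" "\<And>S. S \<in> L \<Longrightarrow> \<Phi> x \<in> f ` realization S"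
    using x unfolding crossing_def slab_def by auto
  note ne = old_supp_nonempty[OF xs(1,3)]
  have finL: "finite L" using L(1) finite_faces finite_subset by blast
  have insB: "insert B L \<subseteq> faces N (d - 1)" "disjoint (insert B L)" "codim d (insert B L) = codim d L + (d + 1 - card B)"
    "\<And>S. S \<in> insert B L \<Longrightarrow> \<Phi> x \<in> f ` realization S"
    if B: "B = old_supp x" "card B \<le> d" for B
  proof -
    have "B \<in> faces N (d - 1)" using B ne old_supp_finite d_pos by (intro facesI) auto
    then show "insert B L \<subseteq> faces N (d - 1)" using L by auto
    have dj: "S \<inter> B = {}" if "S \<in> L" for S using L(3)[OF that] xs(4) B by auto
    then show "disjoint (insert B L)" using L(2) unfolding disjoint_def by auto
    have "B \<notin> L" using dj[of B] ne B by auto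
    then show "codim d (insert B L) = codim d L + (d + 1 - card B)" using finL by (simp add: codim_def)
    have "\<Phi> x = f (old_part x)" using \<Phi>_low[OF xs(1,2)] B by simp
    then have "\<Phi> x \<in> f ` realization B" using old_part_realization[OF xs(1,3)] B by auto
    then show "\<Phi> x \<in> f ` realization S" if "S \<in> insert B L" for S using that xs(5) by auto
  qed
  show eq: "old_supp x = A"
  proof (rule ccontr)
    assume "old_supp x \<noteq> A"
    then have less: "card (old_supp x) < card A" using xs(4) by (intro psubset_card_mono[OF fA(1)]) auto
    then have le: "card (old_supp x) \<le> d" using fA(4) by simp
    have "codim d (insert (old_supp x) L) > d" using insB(3)[OF refl le] cod less le by linarith
    then show False using empty_meet[OF insB(1,2)[OF refl le]] insB(4)[OF refl le] by blast
  qed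
  show "\<Phi> x \<in> meets"
  proof (cases "card A = d + 1")
    case True
    then show ?thesis unfolding meets_def using L xs(5) cod by auto
  next
    case False
    then have le: "card A \<le> d" using fA(4) by simp
    have "codim d (insert A L) = d" using insB(3)[OF eq[symmetric] le] cod by simp
    then show ?thesis
      unfolding meets_def using insB(1,2,4)[OF eq[symmetric] le] by blast
  qed
qed

text \<open>At a crossing the carrier is all of \<open>A\<close>, and \<open>A\<close> contains
  \<open>N\<close>. Hence the crossings are disjoint from \<open>Z0\<close>, and \<open>A\<close>
  can be read off from the point, so \<open>g0\<close> has the right value on each crossing whatever
  \<open>L\<close> is. It is continuous there because the cell index is locally constant on
  \<open>meets\<close>; Tietze keeps the bound \<open>1 / 3\<close>.\<close>

lemma ex_g:
  "\<exists>g. continuous_on UNIV g \<and> (\<forall>x. \<bar>g x\<bar> \<le> 1 / 3) \<and> (\<forall>x\<in>simplex. x N = 0 \<longrightarrow> g x = 0) \<and>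
     (\<forall>A L. balanced A L \<longrightarrow> (\<forall>x\<in>crossing A L. g x = height A (\<kappa> (\<Phi> x))))"
proof -
  define g0 where "g0 x = (if x N = 0 then 0 else height (old_supp x) (\<kappa> (\<Phi> x)))" for x
  define Z0 where "Z0 = simplex \<inter> {x. x N = 0}"
  define B where "B = {(A, L). balanced A L}"
  define Z1 where "Z1 = (\<Union>z\<in>B. crossing (fst z) (snd z))"
  have g0_crossing: "g0 x = height A (\<kappa> (\<Phi> x))" if "balanced A L" "x \<in> crossing A L" for A L x
  proof -
    have "x N \<noteq> 0" using crossing_facts(1)[OF that] that(1) unfolding balanced_def old_supp_def by auto
    then show ?thesis unfolding g0_def using crossing_facts(1)[OF that] by simp
  qed
  have cl0: "closed Z0" unfolding Z0_def
    by (intro closed_Int compact_imp_closed compact_realization closed_Collect_eq continuous_intros) simp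
  have finB: "finite B"
  proof (rule finite_subset)
    show "B \<subseteq> faces N d \<times> Pow (faces N (d - 1))" unfolding B_def balanced_def by auto
  qed (simp add: finite_faces)
  have cl_cr: "closed (crossing A L)" if "L \<subseteq> faces N (d - 1)" for A L
  proof -
    have "crossing A L = slab {..1/3} A \<inter> (\<Inter>S\<in>L. \<Phi> -` (f ` realization S))"
      unfolding crossing_def by auto
    moreover have "closed (\<Phi> -` (f ` realization S))" if S: "S \<in> L" for S
    proof -
      have SF: "S \<in> faces N (d - 1)" using S that \<open>L \<subseteq> faces N (d - 1)\<close> by auto
      have "compact (f ` realization S)"
        using continuous_on_subset[OF f_cont realization_subset_skeleton[OF SF]] facesD(1)[OF SF]
        by (intro compact_continuous_image compact_realization)
      then have "closed (f ` realization S)" by (rule compact_imp_closed)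
      then show ?thesis using \<Phi>_cont by (rule closed_vimage)
    qed
    ultimately show ?thesis by (auto intro!: closed_Int closed_INT closed_slab)
  qed
  then have cl1: "closed Z1" unfolding Z1_def using finB by (intro closed_UN) (auto simp: B_def balanced_def)
  have c0: "continuous_on Z0 g0"
    by (rule continuous_on_eq[OF continuous_on_const[of _ 0]]) (simp add: Z0_def g0_def)
  have c1: "continuous_on Z1 g0"
    unfolding Z1_def
  proof (rule continuous_on_closed_Union[OF finB])
    fix z assume "z \<in> B"
    then obtain A L where z: "z = (A, L)" "balanced A L" unfolding B_def by auto
    show "closed (crossing (fst z) (snd z))" using cl_cr z unfolding balanced_def by simp
    have "continuous_on (crossing A L) (\<lambda>x. height A (\<kappa> (\<Phi> x)))"
      by (rule continuous_on_compose2[OF continuous_on_cell_index[of "height A"]])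
        (use crossing_facts(2)[OF z(2)] \<Phi>_cont in \<open>auto intro: continuous_on_subset\<close>)
    then show "continuous_on (crossing (fst z) (snd z)) g0"
      unfolding z(1) fst_conv snd_conv by (rule continuous_on_eq) (simp add: g0_crossing[OF z(2)])
  qed
  have "continuous_on (Z0 \<union> Z1) g0" using c0 c1 by (intro continuous_on_closed_Un cl0 cl1)
  moreover have "\<bar>g0 x\<bar> \<le> 1 / 3" for x
    using H_pos H_le unfolding g0_def height_def by (auto simp: abs_le_iff less_imp_le intro: order_trans[of _ 0])
  ultimately obtain g where g: "continuous_on UNIV g" "\<And>x. x \<in> Z0 \<union> Z1 \<Longrightarrow> g x = g0 x" "\<And>x. \<bar>g x\<bar> \<le> 1 / 3"
    by (rule_tac Tietze[of "Z0 \<union> Z1" g0 UNIV "1/3"]) (use cl0 cl1 in \<open>auto simp: closed_Un\<close>)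
  have "g x = 0" if "x \<in> simplex" "x N = 0" for x using g(2)[of x] that by (simp add: Z0_def g0_def)
  moreover have "g x = height A (\<kappa> (\<Phi> x))" if "balanced A L" "x \<in> crossing A L" for A L x
  proof -
    have "x \<in> Z1" unfolding Z1_def B_def using that by force
    then show ?thesis using g(2) g0_crossing[OF that] by simp
  qed
  ultimately show ?thesis using g(1,3) by blast
qed

end

section \<open>Tverberg partitions of the lifted map\<close>

text \<open>Members of dimension less than \<open>d\<close> still share the exact point
  \<open>p\<close>; only the condition on \<open>d\<close>-faces is relaxed, from \<open>p\<close>
  to a cell containing it.\<close>

definition approx_winding_partitions ::
    "nat \<Rightarrow> nat \<Rightarrow> nat \<Rightarrow> ((nat \<Rightarrow> real) \<Rightarrow> nat \<Rightarrow> real) \<Rightarrow> real \<Rightarrow> nat set set set"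
  where "approx_winding_partitions N d q f \<delta> = {P. P \<subseteq> faces N d \<and> card P = q \<and> disjoint P \<and>
    (\<exists>p\<in>coords d. \<exists>c. p \<in> cell d \<delta> c \<and> (\<forall>A\<in>P. (card A \<le> d \<longrightarrow> p \<in> f ` realization A) \<and>
       (card A = d + 1 \<longrightarrow> extensions_hit d A f (cell d \<delta> c))))}"

text \<open>The pigeonhole principle with its case of equality. It is applied to the
  \<open>q - 1\<close> new vertices and, with \<open>N\<close> added, to \<open>q\<close>
  vertices.\<close>

lemma card_disjoint_selection:
  assumes "disjoint P" "finite V" "finite P" "\<And>A. A \<in> P \<Longrightarrow> A \<inter> V \<noteq> {}"
  shows "card P \<le> card V"
    and "card P = card V \<Longrightarrow> A \<in> P \<Longrightarrow> card (A \<inter> V) = 1"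
proof -
  have u: "card (\<Union>A\<in>P. A \<inter> V) = (\<Sum>A\<in>P. card (A \<inter> V))"
    using assms(1,2,3) unfolding disjoint_def by (intro card_UN_disjoint) blast+
  have le: "(\<Sum>A\<in>P. card (A \<inter> V)) \<le> card V"
    unfolding u[symmetric] using assms(2) by (intro card_mono) auto
  have ge: "1 \<le> card (A \<inter> V)" if "A \<in> P" for A
    using assms(2,4) that by (simp add: Suc_le_eq card_gt_0_iff)
  have "card P = (\<Sum>A\<in>P. 1)" by simp
  also have "\<dots> \<le> (\<Sum>A\<in>P. card (A \<inter> V))" using ge by (intro sum_mono)
  finally show "card P \<le> card V" using le by simp
  show "card (A \<inter> V) = 1" if eq: "card P = card V" and A: "A \<in> P"
  proof (rule ccontr)
    assume "card (A \<inter> V) \<noteq> 1"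
    then have "1 < card (A \<inter> V)" using ge[OF A] by simp
    then have "(\<Sum>A\<in>P. 1) < (\<Sum>A\<in>P. card (A \<inter> V))"
      using A ge assms(3) by (intro sum_strict_mono_ex1) auto
    then show False using le eq by simp
  qed
qed

locale lift_full = lift_phi +
  fixes g :: "(nat \<Rightarrow> real) \<Rightarrow> real"
  assumes g_cont: "continuous_on UNIV g" and g_bound: "\<bar>g x\<bar> \<le> 1 / 3"
    and g_zero: "\<lbrakk>x \<in> simplex; x N = 0\<rbrakk> \<Longrightarrow> g x = 0"
    and g_crossing: "\<lbrakk>balanced A L; x \<in> crossing A L\<rbrakk> \<Longrightarrow> g x = height A (\<kappa> (\<Phi> x))"
begin

definition lift :: "(nat \<Rightarrow> real) \<Rightarrow> nat \<Rightarrow> real"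
  where "lift x i = (if i < d then \<Phi> x i else if i = d then new_weight x + g x else 0)"

lemma continuous_on_lift: "continuous_on S lift"
proof (rule continuous_on_coordinatewise_then_product)
  fix i
  have "continuous_on S \<Phi>" "continuous_on S g"
    using \<Phi>_cont g_cont by (auto intro: continuous_on_subset)
  then show "continuous_on S (\<lambda>x. lift x i)"
    unfolding lift_def by (cases "i < d"; cases "i = d")
      (auto intro!: continuous_intros continuous_on_new_weight continuous_on_coordinate[of S \<Phi>])
qed

lemma lift_coords: "lift x \<in> coords (d + 1)"
  by (auto simp: lift_def)

lemma lift_eqD:
  assumes "lift x = lift y"
  shows "\<Phi> x = \<Phi> y" "new_weight x + g x = new_weight y + g y"
proof -
  show "\<Phi> x = \<Phi> y"
  proof
    fix i
    show "\<Phi> x i = \<Phi> y i"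
    proof (cases "i < d")
      case True
      then show ?thesis using fun_cong[OF assms, of i] by (simp add: lift_def)
    next
      case False
      then show ?thesis using \<Phi>_coords[of x] \<Phi>_coords[of y] by simp
    qed
  qed
  show "new_weight x + g x = new_weight y + g y"
    using fun_cong[OF assms, of d] by (simp add: lift_def)
qed

text \<open>By genericity the codimensions of the old parts add up to at most \<open>d\<close>, which leaves no vertex
  unused.\<close>

lemma coincidence:
  assumes P: "P \<subseteq> faces M M" "card P = q" "disjoint P"
    and X: "\<And>A. A \<in> P \<Longrightarrow> X A \<in> realization A" "\<And>A. A \<in> P \<Longrightarrow> new_weight (X A) \<le> 1 / 3"
    and p: "\<And>A. A \<in> P \<Longrightarrow> \<Phi> (X A) = p"
  shows "p \<in> meets" "(\<Union>A\<in>P. old_supp (X A)) = {..N}"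
    "\<And>A. A \<in> P \<Longrightarrow> card (old_supp (X A)) \<le> d + 1"
    "\<And>A. A \<in> P \<Longrightarrow> card (old_supp (X A)) \<le> d \<Longrightarrow> p \<in> f ` realization (old_supp (X A))"
    "\<And>A. A \<in> P \<Longrightarrow> X A N \<noteq> 0 \<Longrightarrow> g (X A) = height (old_supp (X A)) (\<kappa> p)"
proof -
  define W where "W A = old_supp (X A)" for A
  define L where "L = {S \<in> W ` P. card S \<le> d}"
  have finP: "finite P" using P(1) finite_faces finite_subset by blast
  have XM: "X A \<in> simplex" if "A \<in> P" for A
    using X(1)[OF that] that P(1) realization_mono[of A "{..M}"] facesD(3)[of A M M] by blast
  have lt1: "new_weight (X A) < 1" if "A \<in> P" for A using X(2)[OF that] by simp
  have Wne: "W A \<noteq> {}" if "A \<in> P" for A unfolding W_def using old_supp_nonempty[OF XM[OF that] lt1[OF that]] .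
  have Wsub: "W A \<subseteq> A" "W A \<subseteq> {..N}" "finite (W A)" if "A \<in> P" for A
    unfolding W_def using X(1)[OF that] old_supp_finite by (auto simp: old_supp_def realization_def)
  have Wdisj: "A = B" if "A \<in> P" "B \<in> P" "W A \<inter> W B \<noteq> {}" for A B
    using disjointD[OF P(3) that(1,2)] Wsub(1)[OF that(1)] Wsub(1)[OF that(2)] that(3) by blast
  have inj: "inj_on W P"
    using Wdisj Wne by (intro inj_onI) (metis inf.idem)
  have cW: "card (W ` P) = q" using card_image[OF inj] P(2) by simp
  have dW: "disjoint (W ` P)" unfolding disjoint_def using Wdisj by blast
  have UN: "\<Union>(W ` P) \<subseteq> {..N}" using Wsub(2) by blast
  have cU: "card (\<Union>(W ` P)) \<le> (d + 1) * (q - 1) + 1" using card_mono[OF _ UN] N_eq by simp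
  have Lf: "L \<subseteq> faces N (d - 1)"
    unfolding L_def using Wne Wsub(2) d_pos by (auto intro!: facesI)
  have dL: "disjoint L" using dW unfolding L_def disjoint_def by auto
  have low: "p \<in> f ` realization (W A)" if A: "A \<in> P" "card (W A) \<le> d" for A
  proof -
    have "\<Phi> (X A) = f (old_part (X A))" using \<Phi>_low[OF XM[OF A(1)] X(2)[OF A(1)]] A(2) unfolding W_def by simp
    then have "p = f (old_part (X A))" using p[OF A(1)] by simp
    then show ?thesis using old_part_realization[OF XM[OF A(1)] lt1[OF A(1)]] unfolding W_def by blast
  qed
  then show "p \<in> f ` realization (old_supp (X A))" if "A \<in> P" "card (old_supp (X A)) \<le> d" for A
    using that unfolding W_def by blast
  have Lp: "p \<in> f ` realization S" if "S \<in> L" for S using that low unfolding L_def by blast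
  have codL: "codim d L \<le> d"
  proof (rule ccontr)
    assume "\<not> codim d L \<le> d"
    then show False using empty_meet[OF Lf dL] Lp by (meson not_le)
  qed
  note cc = codim_count[of "W ` P" q d 1, OF _ dW _ cW _ cU, folded L_def]
  have prem: "finite (W ` P)" "\<And>S. S \<in> W ` P \<Longrightarrow> finite S" "q > 0" "1 \<le> d + 1"
    using finP Wsub(3) q_ge by auto
  have codd: "codim d L = d" using cc(1)[OF prem] codL by simp
  have big: "card S = d + 1" if "S \<in> W ` P" "card S > d" for S
    using cc(2)[OF prem _ that] codL by simp
  have "card (\<Union>(W ` P)) = card {..N}" using cc(3)[OF prem] codL N_eq by simp
  then have full: "\<Union>(W ` P) = {..N}" using UN by (intro card_subset_eq) auto
  then show "(\<Union>A\<in>P. old_supp (X A)) = {..N}" unfolding W_def .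
  show "p \<in> meets" unfolding meets_def using Lf dL codd Lp by auto
  have cle: "card (W A) \<le> d + 1" if "A \<in> P" for A using big[of "W A"] that by (cases "card (W A) > d") auto
  then show "card (old_supp (X A)) \<le> d + 1" if "A \<in> P" for A using that unfolding W_def by simp
  show "g (X A) = height (old_supp (X A)) (\<kappa> p)" if A: "A \<in> P" and XN: "X A N \<noteq> 0" for A
  proof -
    \<comment> \<open>A carrier of dimension less than \<open>d\<close> belongs to \<open>L\<close>,
      and a \<open>d\<close>-face has codimension 0. Either way the codimensions of
      \<open>L'\<close> and \<open>W A\<close> add up to \<open>d\<close>, as
      \<open>balanced\<close> demands.\<close>
    define L' where "L' = L - {W A}"
    have finL: "finite L" unfolding L_def using finP by simp
    have "codim d L' + (d + 1 - card (W A)) = d"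
    proof (cases "W A \<in> L")
      case True
      then show ?thesis using codd finL sum.remove[OF finL True, of "\<lambda>S. d + 1 - card S"]
        unfolding codim_def L'_def by simp
    next
      case False
      then have "card (W A) = d + 1" using A big[of "W A"] unfolding L_def by auto
      then show ?thesis using codd False unfolding L'_def by simp
    qed
    moreover have "W A \<in> faces N d" using Wne[OF A] Wsub(2)[OF A] cle[OF A] by (intro facesI) auto
    moreover have "N \<in> W A" unfolding W_def old_supp_def using XN by simp
    moreover have "S \<inter> W A = {}" if "S \<in> L'" for S
      using that A dW unfolding L'_def L_def disjoint_def by blast
    moreover have "L' \<subseteq> faces N (d - 1)" "disjoint L'" using Lf dL unfolding L'_def disjoint_def by auto
    ultimately have bal: "balanced (W A) L'" unfolding balanced_def by blast
    have "X A \<in> crossing (W A) L'"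
      unfolding crossing_def slab_def using XM[OF A] X(2)[OF A] Lp p[OF A] unfolding L'_def by (auto simp: W_def)
    then show ?thesis using g_crossing[OF bal] p[OF A] unfolding W_def by simp
  qed
qed

text \<open>The lifted points share the last coordinate \<open>h\<close>, which is the new weight of
  each point without weight on \<open>N\<close>. The core is \<open>h > 0\<close>: then every face
  other than \<open>B\<close> has a new vertex and \<open>B\<close> contains \<open>N\<close>, so
  the \<open>q\<close> disjoint faces have exactly one each of the \<open>q\<close> vertices in
  \<open>{N..M}\<close>.\<close>

lemma tverberg_lift:
  assumes P: "P \<in> tverberg_partitions M M q lift"
  shows "(\<lambda>A. A \<inter> {..N}) ` P \<in> approx_winding_partitions N d q f \<delta>"
    and "\<exists>B\<in>P. N \<in> B \<and> B \<subseteq> {..N} \<and> (\<forall>A\<in>P - {B}. card (A \<inter> {N<..M}) = 1)"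
proof -
  have PF: "P \<subseteq> faces M M" "card P = q" "disjoint P" and ne: "(\<Inter>A\<in>P. lift ` realization A) \<noteq> {}"
    using P unfolding tverberg_partitions_def by auto
  have finP: "finite P" using PF(1) finite_faces finite_subset by blast
  obtain u where "\<And>A. A \<in> P \<Longrightarrow> u \<in> lift ` realization A" using ne by auto
  then have "\<exists>x. x \<in> realization A \<and> lift x = u" if "A \<in> P" for A using that by blast
  then obtain X where X: "\<And>A. A \<in> P \<Longrightarrow> X A \<in> realization A" "\<And>A. A \<in> P \<Longrightarrow> lift (X A) = u" by metis
  obtain A0 where A0: "A0 \<in> P" using PF(2) q_ge by fastforce
  define p where "p = \<Phi> (X A0)"
  define h where "h = new_weight (X A0) + g (X A0)"
  have p: "\<Phi> (X A) = p" and h: "new_weight (X A) + g (X A) = h" if "A \<in> P" for A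
    using lift_eqD[of "X A" "X A0"] X(2)[OF that] X(2)[OF A0] unfolding p_def h_def by auto
  have subM: "A \<subseteq> {..M}" if "A \<in> P" for A using PF(1) that facesD(3) by blast
  have XM: "X A \<in> simplex" if "A \<in> P" for A
    using X(1)[OF that] realization_mono[OF subM[OF that]] by blast
  have XA: "i \<in> A" if "A \<in> P" "X A i \<noteq> 0" for A i
    using X(1)[OF that(1)] that(2) by (auto simp: realization_def)
  have same: "A = B" if "A \<in> P" "B \<in> P" "i \<in> A" "i \<in> B" for A B i
    using that PF(3) unfolding disjoint_def by auto
  have hw: "new_weight (X A) = h" if "A \<in> P" "X A N = 0" for A
    using h[OF that(1)] g_zero[OF XM[OF that(1)] that(2)] by simp
  have newv: "A \<inter> {N<..M} \<noteq> {}" if "A \<in> P" "new_weight (X A) > 0" for A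
  proof
    assume "A \<inter> {N<..M} = {}"
    then have "X A j = 0" if "j \<in> {N<..M}" for j using XA[OF \<open>A \<in> P\<close>, of j] that by auto
    then show False using that(2) unfolding new_weight_def by simp
  qed
  \<comment> \<open>Without weight on \<open>N\<close>, all values of \<open>g\<close> vanish and
    all new weights are \<open>h\<close>. Positive \<open>h\<close> would ask for \<open>q\<close>
    new vertices; otherwise \<open>coincidence\<close> shows that the vertex \<open>N\<close> is
    used after all.\<close>
  have ex1: "\<exists>B\<in>P. X B N \<noteq> 0"
  proof (rule ccontr)
    assume none: "\<not> (\<exists>B\<in>P. X B N \<noteq> 0)"
    then have w: "new_weight (X A) = h" if "A \<in> P" for A using hw that by blast
    have "h \<le> 0"
    proof (rule ccontr)
      assume "\<not> h \<le> 0"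
      then have nn: "A \<inter> {N<..M} \<noteq> {}" if "A \<in> P" for A using newv[OF that] w[OF that] by linarith
      have "card P \<le> card {N<..M}"
        by (rule card_disjoint_selection(1)[OF PF(3) finite_greaterThanAtMost finP nn])
      moreover have "card {N<..M} = q - 1" by simp
      ultimately show False using PF(2) q_ge by linarith
    qed
    then have "new_weight (X A) \<le> 1 / 3" if "A \<in> P" for A using w[OF that] by simp
    then have "(\<Union>A\<in>P. old_supp (X A)) = {..N}" by (intro coincidence(2)[OF PF X(1) _ p])
    then show False using none unfolding old_supp_def by force
  qed
  then obtain B where B: "B \<in> P" "X B N \<noteq> 0" by blast
  have NB: "N \<in> B" using XA[OF B] .
  have notN: "N \<notin> A" and XN: "X A N = 0" if "A \<in> P - {B}" for A
    using same[of A B N] XA[of A N] B NB that by auto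
  have wh: "new_weight (X A) = h" if "A \<in> P - {B}" for A using hw XN[OF that] that by blast
  obtain A1 where A1: "A1 \<in> P - {B}"
  proof -
    have "card (P - {B}) \<ge> 1" using PF(2) q_ge B(1) finP by simp
    then have "P - {B} \<noteq> {}" by (metis card.empty not_one_le_zero)
    then show thesis using that by blast
  qed
  have "A1 \<in> P" using A1 by simp
  then have h0: "h \<ge> 0" using wh[OF A1] simplex_facts(1)[OF XM] by metis
  have gB: "g (X B) \<le> 1 / 3" "g (X B) \<ge> - 1 / 3" using g_bound[of "X B"] by (auto simp: abs_le_iff)
  have wB: "new_weight (X B) \<ge> 0" using simplex_facts(1)[OF XM[OF B(1)]] .
  have one: "card (A \<inter> {N..M}) = 1" if "h > 0" "A \<in> P" for A
  proof -
    have nn: "A \<inter> {N..M} \<noteq> {}" if A: "A \<in> P" for A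
    proof (cases "A = B")
      case True
      then show ?thesis using NB by auto
    next
      case False
      then have "A \<inter> {N<..M} \<noteq> {}" using newv[OF A] wh[of A] A \<open>h > 0\<close> by auto
      then show ?thesis by auto
    qed
    have "card P = card {N..M}" using PF(2) q_ge by simp
    then show ?thesis
      by (intro card_disjoint_selection(2)[of P "{N..M}"] PF(3) finP nn that(2)) auto
  qed
  have Bold: "B \<inter> {N<..M} = {}" if "h > 0"
  proof (rule ccontr)
    assume "B \<inter> {N<..M} \<noteq> {}"
    then obtain i where "i \<in> B \<inter> {N<..M}" by blast
    then have i: "i \<in> B" "i > N" "i \<le> M" by (simp_all only: Int_iff greaterThanAtMost_iff)
    have "N \<in> {N..M}" "i \<in> {N..M}" using i(2,3) unfolding atLeastAtMost_iff by linarith+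
    then have "{N, i} \<subseteq> B \<inter> {N..M}" using NB i(1) by blast
    moreover have "card {N, i} = 2" using i(2) by simp
    moreover have "finite (B \<inter> {N..M})" by simp
    ultimately show False using one[OF that B(1)] card_mono[of "B \<inter> {N..M}" "{N, i}"] by linarith
  qed
  have wB0: "new_weight (X B) = 0" if "h > 0" using newv[OF B(1)] Bold[OF that] wB by (metis less_eq_real_def)
  \<comment> \<open>If \<open>h > 0\<close>, then \<open>X B\<close> has no new weight and
    \<open>h = g (X B)\<close>; if \<open>h = 0\<close>, its new weight is \<open>- g (X B)\<close>.
    In both cases the bound on \<open>g\<close> provides the \<open>1 / 3\<close> required by
    \<open>coincidence\<close>.\<close>
  have h13: "h \<le> 1 / 3" using wB0 h[OF B(1)] gB by (cases "h > 0") auto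
  have w13: "new_weight (X A) \<le> 1 / 3" if "A \<in> P" for A
  proof (cases "A = B")
    case True
    then show ?thesis using wB0 h[OF B(1)] gB h0 by (cases "h > 0") auto
  next
    case False
    then show ?thesis using wh[of A] that h13 by simp
  qed
  have co1: "p \<in> meets" by (rule coincidence(1)[OF PF X(1) w13 p])
  have co2: "(\<Union>A\<in>P. old_supp (X A)) = {..N}" by (rule coincidence(2)[OF PF X(1) w13 p])
  have co3: "card (old_supp (X A)) \<le> d + 1" if "A \<in> P" for A
    by (rule coincidence(3)[OF PF X(1) w13 p that])
  have co4: "p \<in> f ` realization (old_supp (X A))" if "A \<in> P" "card (old_supp (X A)) \<le> d" for A
    by (rule coincidence(4)[OF PF X(1) w13 p that])
  have co5: "g (X B) = height (old_supp (X B)) (\<kappa> p)"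
    by (rule coincidence(5)[OF PF X(1) w13 p B])
  define c where "c = \<kappa> p"
  have c: "c \<in> \<kappa> ` meets" "p \<in> cell d \<delta> c" using co1 in_cell_index unfolding c_def by auto
  have gBc: "g (X B) = height (old_supp (X B)) c" using co5 unfolding c_def .
  \<comment> \<open>At level \<open>H c\<close> the map is \<open>E c\<close>, which enters the cell
    of \<open>p\<close> only where every extension does.\<close>
  have hit: "extensions_hit d (old_supp (X A)) f (cell d \<delta> c)"
    if A: "A \<in> P" "card (old_supp (X A)) = d + 1" "new_weight (X A) = H c" for A
  proof -
    have "E c (old_part (X A)) = p" using \<Phi>_mid[OF XM[OF A(1)] c(1) A(3)] A(2) p[OF A(1)] by simp
    moreover have "old_part (X A) \<in> realization (old_supp (X A))"
      using old_part_realization[OF XM[OF A(1)]] w13[OF A(1)] by simp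
    ultimately show ?thesis using E_hit[OF old_supp_finite(2) A(2)] c(2) by blast
  qed
  \<comment> \<open>For \<open>h = 0\<close> the height of the carrier is minus the new weight of
    \<open>X B\<close>, so it is \<open>- H c\<close> and \<open>E c\<close> avoids the cell on this
    carrier. But then \<open>X B\<close> lies exactly at level \<open>H c\<close>, where its value
    \<open>p\<close> is that of \<open>E c\<close>: a contradiction.\<close>
  have hpos: "h > 0"
  proof (rule ccontr)
    assume "\<not> h > 0"
    then have "h = 0" using h0 by simp
    then have nw: "new_weight (X B) = - height (old_supp (X B)) c" using h[OF B(1)] gBc by simp
    then have ht: "card (old_supp (X B)) = d + 1" "\<forall>x\<in>realization (old_supp (X B)). E c x \<notin> cell d \<delta> c"
      using wB H_pos[of c] unfolding height_def by (auto split: if_splits)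
    then have "new_weight (X B) = H c" using nw unfolding height_def by simp
    then have "E c (old_part (X B)) = p" using \<Phi>_mid[OF XM[OF B(1)] c(1)] ht(1) p[OF B(1)] by simp
    moreover have "old_part (X B) \<in> realization (old_supp (X B))"
      using old_part_realization[OF XM[OF B(1)]] w13[OF B(1)] by simp
    ultimately show False using ht(2) c(2) by blast
  qed
  have hB: "h = height (old_supp (X B)) c" using h[OF B(1)] wB0[OF hpos] gBc by simp
  \<comment> \<open>The other points now lie at level \<open>H c\<close>, where \<open>hit\<close>
    applies. The point \<open>X B\<close> has new weight 0; for its face the same conclusion comes
    from the positive sign of the height.\<close>
  then have hH: "h = H c" "card (old_supp (X B)) \<noteq> d + 1 \<or> (\<exists>x\<in>realization (old_supp (X B)). E c x \<in> cell d \<delta> c)"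
    using hpos H_pos[of c] unfolding height_def by (auto split: if_splits)
  show "\<exists>B\<in>P. N \<in> B \<and> B \<subseteq> {..N} \<and> (\<forall>A\<in>P - {B}. card (A \<inter> {N<..M}) = 1)"
  proof (intro bexI[of _ B] conjI ballI)
    show "B \<subseteq> {..N}"
    proof
      fix i assume i: "i \<in> B"
      then have "i \<le> M" "i \<notin> {N<..M}" using subM[OF B(1)] Bold[OF hpos] by blast+
      then show "i \<in> {..N}" unfolding greaterThanAtMost_iff atMost_iff by linarith
    qed
    fix A assume A: "A \<in> P - {B}"
    have "A \<inter> {N<..M} = A \<inter> {N..M}" using notN[OF A] by (force simp: order.order_iff_strict)
    then show "card (A \<inter> {N<..M}) = 1" using one[OF hpos] A by simp
  qed (use NB B in auto)
  \<comment> \<open>Every old vertex is used by some point of the coincidence, so by disjointness no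
    face has an idle old vertex.\<close>
  have old: "A \<inter> {..N} = old_supp (X A)" if A: "A \<in> P" for A
  proof
    show "old_supp (X A) \<subseteq> A \<inter> {..N}" using XA[OF A] by (auto simp: old_supp_def)
    show "A \<inter> {..N} \<subseteq> old_supp (X A)"
    proof
      fix i assume i: "i \<in> A \<inter> {..N}"
      then obtain A' where A': "A' \<in> P" "i \<in> old_supp (X A')" using co2 by blast
      then have "i \<in> A'" using XA[OF A'(1)] by (auto simp: old_supp_def)
      then show "i \<in> old_supp (X A)" using same[OF A'(1) A, of i] A' i by simp
    qed
  qed
  have ne: "old_supp (X A) \<noteq> {}" if "A \<in> P" for A
    using old_supp_nonempty[OF XM[OF that]] w13[OF that] by simp
  have inj: "inj_on (\<lambda>A. A \<inter> {..N}) P"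
  proof
    fix A A' assume A: "A \<in> P" "A' \<in> P" "A \<inter> {..N} = A' \<inter> {..N}"
    then obtain i where "i \<in> A \<inter> {..N}" using ne old by blast
    then show "A = A'" using same[OF A(1,2), of i] A(3) by blast
  qed
  show "(\<lambda>A. A \<inter> {..N}) ` P \<in> approx_winding_partitions N d q f \<delta>"
    unfolding approx_winding_partitions_def
  proof (rule CollectI, intro conjI)
    show "(\<lambda>A. A \<inter> {..N}) ` P \<subseteq> faces N d"
      using old ne co3 by (auto intro!: facesI)
    show "card ((\<lambda>A. A \<inter> {..N}) ` P) = q" using card_image[OF inj] PF(2) by simp
    show "disjoint ((\<lambda>A. A \<inter> {..N}) ` P)" using PF(3) unfolding disjoint_def by blast
    have pd: "p \<in> coords d" using \<Phi>_coords[of "X B"] p[OF B(1)] by simp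
    have "(card S \<le> d \<longrightarrow> p \<in> f ` realization S) \<and> (card S = d + 1 \<longrightarrow> extensions_hit d S f (cell d \<delta> c))"
      if S: "S \<in> (\<lambda>A. A \<inter> {..N}) ` P" for S
    proof (intro conjI impI)
      obtain A where A: "A \<in> P" "S = old_supp (X A)" using S old by auto
      show "p \<in> f ` realization S" if "card S \<le> d" using co4[OF A(1)] that A(2) by simp
      show "extensions_hit d S f (cell d \<delta> c)" if cS: "card S = d + 1"
      proof (cases "A = B")
        case True
        then obtain x where "x \<in> realization S" "E c x \<in> cell d \<delta> c" using hH(2) cS A(2) by auto
        then show ?thesis using E_hit[OF _ cS] old_supp_finite(2) A(2) by blast
      next
        case False
        then show ?thesis using hit[OF A(1)] wh[of A] A hH(1) cS by simp
      qed
    qed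
    then show "\<exists>p\<in>coords d. \<exists>c. p \<in> cell d \<delta> c \<and> (\<forall>A\<in>(\<lambda>A. A \<inter> {..N}) ` P.
        (card A \<le> d \<longrightarrow> p \<in> f ` realization A) \<and> (card A = d + 1 \<longrightarrow> extensions_hit d A f (cell d \<delta> c)))"
      using pd c(2) by blast
  qed
qed

text \<open>Removing the new vertices maps the partitions of the lift to approximate winding
  partitions. Over a given \<open>Q\<close> only the distribution of the \<open>q - 1\<close> new
  vertices among the \<open>q - 1\<close> members without \<open>N\<close> is free.\<close>

lemma card_tverberg_lift_le:
  "card (tverberg_partitions M M q lift) \<le> fact (q - 1) * card (approx_winding_partitions N d q f \<delta>)"
proof -
  let ?T = "tverberg_partitions M M q lift" and ?W = "approx_winding_partitions N d q f \<delta>"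
  define \<pi> where "\<pi> P = (\<lambda>A. A \<inter> {..N}) ` P" for P :: "nat set set"
  have finW: "finite ?W"
    by (rule finite_subset[of _ "Pow (faces N d)"]) (auto simp: approx_winding_partitions_def finite_faces)
  have fibre: "finite {P \<in> ?T. \<pi> P = Q} \<and> card {P \<in> ?T. \<pi> P = Q} \<le> fact (q - 1)" if Q: "Q \<in> ?W" for Q
  proof -
    define Q' where "Q' = {S \<in> Q. N \<notin> S}"
    define V where "V = {N<..M}"
    have Qf: "Q \<subseteq> faces N d" "card Q = q" "disjoint Q" using Q unfolding approx_winding_partitions_def by auto
    have finQ: "finite Q" using Qf(1) finite_faces finite_subset by blast
    have finV: "finite V" "card V = q - 1" unfolding V_def by auto
    show ?thesis
    proof (cases "card Q' = q - 1")
      \<comment> \<open>By disjointness at most one member of \<open>Q\<close> contains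
        \<open>N\<close>; here none does, and the fibre is empty.\<close>
      case False
      have "{P \<in> ?T. \<pi> P = Q} = {}"
      proof (rule ccontr)
        assume "{P \<in> ?T. \<pi> P = Q} \<noteq> {}"
        then obtain P where P: "P \<in> ?T" "\<pi> P = Q" by auto
        obtain B where B: "B \<in> P" "N \<in> B" using tverberg_lift(2)[OF P(1)] by blast
        then have BQ: "B \<inter> {..N} \<in> Q" using P(2) unfolding \<pi>_def by auto
        have NB: "N \<in> B \<inter> {..N}" using B(2) by simp
        have "N \<in> S \<longleftrightarrow> S = B \<inter> {..N}" if "S \<in> Q" for S
          using disjointD[OF Qf(3) that BQ] NB by blast
        then have "Q' = Q - {B \<inter> {..N}}" unfolding Q'_def by blast
        then show False using False BQ Qf(2) finQ by simp
      qed
      then show ?thesis by (metis card.empty finite.emptyI le0)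
    next
      case True
      have finQ': "finite Q'" unfolding Q'_def using finQ by simp
      \<comment> \<open>A reference bijection, by which distributions of the new vertices become
        permutations of \<open>V\<close>.\<close>
      obtain b where b: "bij_betw b Q' V"
        using finite_same_card_bij[OF finQ' finV(1)] True finV(2) by auto
      define rec where "rec w = (\<lambda>S. if N \<in> S then S else insert (w (b S)) S) ` Q" for w :: "nat \<Rightarrow> nat"
      have sub: "{P \<in> ?T. \<pi> P = Q} \<subseteq> rec ` {w. w permutes V}"
      proof
        fix P assume "P \<in> {P \<in> ?T. \<pi> P = Q}"
        then have P: "P \<in> ?T" "\<pi> P = Q" by auto
        have Pf: "P \<subseteq> faces M M" "card P = q" "disjoint P" using P(1) unfolding tverberg_partitions_def by auto
        obtain B where B: "B \<in> P" "N \<in> B" "B \<subseteq> {..N}" "\<And>A. A \<in> P - {B} \<Longrightarrow> card (A \<inter> V) = 1"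
          using tverberg_lift(2)[OF P(1)] unfolding V_def by blast
        have inj: "inj_on (\<lambda>A. A \<inter> {..N}) P"
          using P(2) Pf(2) Qf(2) finQ finite_subset[OF Pf(1) finite_faces] unfolding \<pi>_def
          by (intro eq_card_imp_inj_on) auto
        have notN: "N \<notin> A" if "A \<in> P - {B}" for A
          using that B(1,2) Pf(3) unfolding disjoint_def by auto
        have "\<exists>v. \<forall>A\<in>P - {B}. A \<inter> V = {v A}"
          using B(4) by (intro bchoice ballI) (auto simp: card_1_singleton_iff)
        then obtain v where v: "\<And>A. A \<in> P - {B} \<Longrightarrow> A \<inter> V = {v A}" by blast
        define r where "r = the_inv_into P (\<lambda>A. A \<inter> {..N})"
        have r: "r (A \<inter> {..N}) = A" if "A \<in> P" for A unfolding r_def using the_inv_into_f_f[OF inj that] .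
        have rQ: "r S \<in> P" "r S \<inter> {..N} = S" if "S \<in> Q" for S
          using that r P(2) unfolding \<pi>_def by auto
        have rQ': "r S \<in> P - {B}" if "S \<in> Q'" for S
        proof -
          have "S \<in> Q" "N \<notin> S" using that unfolding Q'_def by auto
          then show ?thesis using rQ[of S] B(2) by auto
        qed
        have injv: "inj_on (\<lambda>S. v (r S)) Q'"
        proof
          fix S S' assume S: "S \<in> Q'" "S' \<in> Q'" "v (r S) = v (r S')"
          then have "v (r S) \<in> r S" "v (r S) \<in> r S'" using v[OF rQ'[OF S(1)]] v[OF rQ'[OF S(2)]] by auto
          then have "r S = r S'" using disjointD[OF Pf(3), of "r S" "r S'"] rQ'[OF S(1)] rQ'[OF S(2)] by auto
          moreover have "S \<in> Q" "S' \<in> Q" using S(1,2) unfolding Q'_def by auto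
          ultimately show "S = S'" using rQ(2) by metis
        qed
        have vV: "v (r S) \<in> V" if "S \<in> Q'" for S using v[OF rQ'[OF that]] by auto
        define w where "w x = (if x \<in> V then v (r (the_inv_into Q' b x)) else x)" for x
        have wb: "w (b S) = v (r S)" if "S \<in> Q'" for S
          using b that the_inv_into_f_f[of b Q' S] unfolding w_def bij_betw_def by auto
        have "bij_betw w V V"
        proof -
          have ib: "bij_betw (the_inv_into Q' b) V Q'" using b by (rule bij_betw_the_inv_into)
          have "inj_on ((\<lambda>S. v (r S)) \<circ> the_inv_into Q' b) V"
            using ib injv by (intro comp_inj_on) (auto simp: bij_betw_def)
          then have i: "inj_on w V" by (rule inj_on_cong[THEN iffD1, rotated]) (simp add: w_def)
          have "w ` V \<subseteq> V" using vV ib unfolding w_def bij_betw_def by auto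
          then have "w ` V = V" using i finV(1) by (rule endo_inj_surj[rotated])
          then show ?thesis using i unfolding bij_betw_def by simp
        qed
        then have "w permutes V" by (rule bij_imp_permutes) (simp add: w_def)
        moreover have "P = rec w"
        proof -
          have rS: "r S = (if N \<in> S then S else insert (w (b S)) S)" if S: "S \<in> Q" for S
          proof (cases "N \<in> S")
            case True
            then have "N \<in> r S" using rQ[OF S] by auto
            then have "r S = B" using notN[of "r S"] rQ(1)[OF S] by auto
            then show ?thesis using True rQ(2)[OF S] B(3) by auto
          next
            case False
            then have S': "S \<in> Q'" using S unfolding Q'_def by simp
            have "r S \<subseteq> {..M}" using rQ(1)[OF S] Pf(1) facesD(3) by blast
            then have "r S = (r S \<inter> {..N}) \<union> (r S \<inter> V)" unfolding V_def by fastforce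
            then show ?thesis using False rQ(2)[OF S] v[OF rQ'[OF S']] wb[OF S'] by auto
          qed
          have "P = r ` Q"
          proof
            show "P \<subseteq> r ` Q"
            proof
              fix A assume A: "A \<in> P"
              then have "A \<inter> {..N} \<in> Q" using P(2) unfolding \<pi>_def by auto
              then show "A \<in> r ` Q" using r[OF A] by (metis imageI)
            qed
            show "r ` Q \<subseteq> P" using rQ(1) by auto
          qed
          also have "\<dots> = rec w" unfolding rec_def using rS by (intro image_cong) auto
          finally show ?thesis .
        qed
        ultimately show "P \<in> rec ` {w. w permutes V}" by blast
      qed
      have fp: "finite {w. w permutes V}" using finV(1) by (rule finite_permutations)
      have "card {P \<in> ?T. \<pi> P = Q} \<le> card {w. w permutes V}"
        using card_mono[OF finite_imageI[OF fp] sub] card_image_le[OF fp, of rec] by linarith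
      moreover have "card {w. w permutes V} = fact (q - 1)"
        using card_permutations[OF finV(2) finV(1)] .
      ultimately show ?thesis using finite_subset[OF sub finite_imageI[OF fp]] by simp
    qed
  qed
  have "?T \<subseteq> (\<Union>Q\<in>?W. {P \<in> ?T. \<pi> P = Q})" using tverberg_lift(1) unfolding \<pi>_def by auto
  then have "card ?T \<le> card (\<Union>Q\<in>?W. {P \<in> ?T. \<pi> P = Q})"
    using finW fibre by (intro card_mono finite_UN_I) auto
  also have "\<dots> \<le> (\<Sum>Q\<in>?W. card {P \<in> ?T. \<pi> P = Q})" using finW by (rule card_UN_le)
  also have "\<dots> \<le> (\<Sum>Q\<in>?W. fact (q - 1))" using fibre by (intro sum_mono) auto
  finally show ?thesis by (simp add: mult.commute)
qed

end

section \<open>Passing to the limit\<close>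

text \<open>As \<open>M = (d + 2) * (q - 1)\<close>, the assumption is the bound of (1) in dimension
  \<open>d + 1\<close>; cancelling the fibre size \<open>fact (q - 1)\<close> leaves the power
  \<open>d\<close>.\<close>

lemma (in generic_map) card_approx_winding_ge:
  assumes many: "\<And>F. continuous_on simplex F \<Longrightarrow> F \<in> simplex \<rightarrow> coords (d + 1) \<Longrightarrow>
    card (tverberg_partitions M M q F) \<ge> fact (q - 1) ^ (d + 1)"
  shows "card (approx_winding_partitions N d q f \<delta>) \<ge> fact (q - 1) ^ d"
proof -
  obtain e :: "(nat \<Rightarrow> int) \<Rightarrow> nat" where e: "inj_on e (\<kappa> ` meets)"
    using finite_imp_inj_to_nat_seg[OF finite_cells] by blast
  \<comment> \<open>A numbering of the finitely many relevant cells gives distinct positive heights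
    of at most \<open>1 / 3\<close>.\<close>
  define H where "H c = 1 / (3 + real (e c))" for c
  have H_inj: "inj_on H (\<kappa> ` meets)"
    using e unfolding H_def inj_on_def by (auto simp: field_simps)
  define Q where "Q c E \<longleftrightarrow> continuous_on (skeleton N d) E \<and> (\<forall>x. E x \<in> coords d) \<and>
    (\<forall>x\<in>skeleton N (d - 1). E x = f x) \<and>
    (\<forall>A x. A \<subseteq> {..N} \<longrightarrow> card A = d + 1 \<longrightarrow> x \<in> realization A \<longrightarrow> E x \<in> cell d \<delta> c \<longrightarrow>
      extensions_hit d A f (cell d \<delta> c))" for c E
  have "\<exists>E. Q c E" for c
    unfolding Q_def by (rule extension_avoiding[OF d_pos f_cont f_coords, of "cell d \<delta> c"]) blast
  then obtain E where QE: "\<And>c. Q c (E c)" by metis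
  interpret lift_data N d q f \<delta> E H
  proof
    show "continuous_on (skeleton N d) (E c)" "E c x \<in> coords d" for c x using QE[of c] unfolding Q_def by blast+
    show "E c x = f x" if "x \<in> skeleton N (d - 1)" for c x using QE[of c] that unfolding Q_def by blast
    show "extensions_hit d A f (cell d \<delta> c)"
      if "A \<subseteq> {..N}" "card A = d + 1" "x \<in> realization A" "E c x \<in> cell d \<delta> c" for A x c
      using QE[of c] that unfolding Q_def by blast
    show "0 < H c" "H c \<le> 1 / 3" for c unfolding H_def by (auto simp: field_simps)
  qed (rule H_inj)
  obtain \<Phi> where \<Phi>: "continuous_on UNIV \<Phi>" "\<And>x. \<Phi> x \<in> coords d"
    "\<And>x. x \<in> simplex \<Longrightarrow> new_weight x \<le> 1 / 3 \<Longrightarrow> card (old_supp x) \<le> d \<Longrightarrow> \<Phi> x = f (old_part x)"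
    "\<And>x c. x \<in> simplex \<Longrightarrow> c \<in> \<kappa> ` meets \<Longrightarrow> new_weight x = H c \<Longrightarrow> card (old_supp x) \<le> d + 1 \<Longrightarrow>
      \<Phi> x = E c (old_part x)"
    using ex_Phi by blast
  interpret lift_phi N d q f \<delta> E H \<Phi>
    by unfold_locales (use \<Phi> in blast)+
  obtain g where g: "continuous_on UNIV g" "\<And>x. \<bar>g x\<bar> \<le> 1 / 3" "\<And>x. x \<in> simplex \<Longrightarrow> x N = 0 \<Longrightarrow> g x = 0"
    "\<And>A L x. balanced A L \<Longrightarrow> x \<in> crossing A L \<Longrightarrow> g x = height A (\<kappa> (\<Phi> x))"
    using ex_g by blast
  interpret lift_full N d q f \<delta> E H \<Phi> g
    by unfold_locales (use g in blast)+
  have "lift \<in> simplex \<rightarrow> coords (d + 1)" using lift_coords by blast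
  from order_trans[OF many[OF continuous_on_lift this] card_tverberg_lift_le]
  have "fact (q - 1) * fact (q - 1) ^ d \<le> fact (q - 1) * card (approx_winding_partitions N d q f \<delta>)"
    by simp
  then show ?thesis by (rule nat_mult_le_cancel1[THEN iffD1, rotated]) simp
qed

text \<open>A single \<open>\<eta>\<close> is both the accuracy of the approximation and the side of
  the cells.\<close>

lemma approximation_with_many_partitions:
  assumes d: "d > 0" and q: "q \<ge> 2" and \<eta>: "\<eta> > 0"
    and f: "continuous_on (skeleton (tverberg_dim d q) (d - 1)) f" "\<And>x. f x \<in> coords d"
    and many: "\<And>F. continuous_on (realization {..tverberg_dim (d + 1) q}) F \<Longrightarrow>
      F \<in> realization {..tverberg_dim (d + 1) q} \<rightarrow> coords (d + 1) \<Longrightarrow>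
      card (tverberg_partitions (tverberg_dim (d + 1) q) (tverberg_dim (d + 1) q) q F) \<ge> fact (q - 1) ^ (d + 1)"
  obtains f' where "continuous_on (skeleton (tverberg_dim d q) (d - 1)) f'" "\<And>x. f' x \<in> coords d"
    "\<And>x k. x \<in> skeleton (tverberg_dim d q) (d - 1) \<Longrightarrow> k < d \<Longrightarrow> \<bar>f' x k - f x k\<bar> < \<eta>"
    "card (approx_winding_partitions (tverberg_dim d q) d q f' \<eta>) \<ge> fact (q - 1) ^ d"
proof -
  define N where "N = tverberg_dim d q"
  let ?X = "skeleton N (d - 1)"
  note f = f[folded N_def]
  have "\<exists>b. \<forall>x\<in>?X. \<bar>f x k\<bar> \<le> b" for k
  proof -
    have "bounded ((\<lambda>x. f x k) ` ?X)"
      using f(1) by (intro compact_imp_bounded compact_continuous_image compact_skeleton continuous_on_coordinate)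
    then show ?thesis unfolding bounded_iff by auto
  qed
  then obtain b where b: "\<And>k x. x \<in> ?X \<Longrightarrow> \<bar>f x k\<bar> \<le> b k" by metis
  define B where "B = (\<Sum>k<d. \<bar>b k\<bar>) + \<eta>"
  define Z where "Z = \<lceil>B / \<eta>\<rceil>"
  define LL where "LL = {L. L \<subseteq> faces N (d - 1) \<and> disjoint L}"
  \<comment> \<open>\<open>ev1\<close> lists the conditions for \<open>empty_meet\<close>,
    \<open>ev2\<close> those for \<open>off_grid\<close>. Finitely many hyperplanes suffice, since
    the perturbed map is bounded by \<open>B\<close> and reaches no larger multiple of
    \<open>\<eta>\<close>.\<close>
  define ev1 where "ev1 = (\<lambda>L. (L, {} :: nat set, \<lambda>_ :: nat. 0 :: real)) ` {L \<in> LL. codim d L > d}"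
  define ev2 where "ev2 = (\<lambda>(L, k, z). (L, {k}, \<lambda>_ :: nat. \<eta> * of_int z)) ` ({L \<in> LL. codim d L = d} \<times> {..<d} \<times> {- Z..Z})"
  have finLL: "finite LL" unfolding LL_def
    by (rule finite_subset[of _ "Pow (faces N (d - 1))"]) (auto simp: finite_faces)
  have fin: "finite (ev1 \<union> ev2)" unfolding ev1_def ev2_def using finLL by auto
  have ev: "L \<subseteq> faces N (d - 1) \<and> disjoint L \<and> T \<subseteq> {..<d} \<and> codim d L + card T > d"
    if "(L, T, c) \<in> ev1 \<union> ev2" for L T c
    using that unfolding ev1_def ev2_def LL_def by auto
  obtain f' where f': "continuous_on ?X f'" "\<And>x. f' x \<in> coords d"
    "\<And>x k. x \<in> ?X \<Longrightarrow> k < d \<Longrightarrow> \<bar>f' x k - f x k\<bar> < \<eta>"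
    "\<And>L T c p. (L, T, c) \<in> ev1 \<union> ev2 \<Longrightarrow> (\<And>S. S \<in> L \<Longrightarrow> p \<in> f' ` realization S) \<Longrightarrow> \<exists>k\<in>T. p k \<noteq> c k"
    by (rule generic_perturbation[OF d f(1) \<eta> fin ev]) blast+
  have f'B: "\<bar>f' x k\<bar> \<le> B" if x: "x \<in> ?X" and k: "k < d" for x k
  proof -
    have "\<bar>b k\<bar> \<le> (\<Sum>k<d. \<bar>b k\<bar>)" using k by (intro member_le_sum) auto
    then show ?thesis using f'(3)[OF x k] b[OF x, of k] unfolding B_def by linarith
  qed
  have gen: "generic_map N d q f' \<eta>"
  proof
    show "N = (d + 1) * (q - 1)" unfolding N_def ..
    show "\<exists>S\<in>L. p \<notin> f' ` realization S" if "L \<subseteq> faces N (d - 1)" "disjoint L" "d < codim d L" for L p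
    proof (rule ccontr)
      assume *: "\<not> (\<exists>S\<in>L. p \<notin> f' ` realization S)"
      have "(L, {}, \<lambda>_. 0) \<in> ev1 \<union> ev2" unfolding ev1_def LL_def using that by auto
      from f'(4)[OF this, of p] * show False by blast
    qed
    show "p k \<noteq> \<eta> * of_int z"
      if L: "L \<subseteq> faces N (d - 1)" "disjoint L" "codim d L = d" "k < d" and p: "\<And>S. S \<in> L \<Longrightarrow> p \<in> f' ` realization S" for L p k z
    proof
      assume eq: "p k = \<eta> * of_int z"
      have "L \<noteq> {}" using L(3) d by (auto simp: codim_def)
      then obtain S where S: "S \<in> L" by blast
      then obtain x where x: "x \<in> realization S" "p = f' x" using p by blast
      have "x \<in> ?X" using x(1) S L(1) realization_subset_skeleton by blast
      then have "\<bar>\<eta> * of_int z\<bar> \<le> B" using f'B[of x k] x(2) eq L(4) by simp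
      then have "\<bar>of_int z\<bar> \<le> B / \<eta>" using \<eta> by (simp add: abs_mult field_simps)
      then have "z \<in> {- Z..Z}" unfolding Z_def by (simp add: abs_le_iff) linarith
      then have "(L, {k}, \<lambda>_. \<eta> * of_int z) \<in> ev1 \<union> ev2"
        unfolding ev2_def by (intro UnI2 image_eqI[of _ _ "(L, k, z)"]) (use L in \<open>auto simp: LL_def\<close>)
      from f'(4)[OF this p] eq show False by simp
    qed
  qed (use d q \<eta> f' in auto)
  interpret generic_map N d q f' \<eta> by (rule gen)
  have M: "tverberg_dim (d + 1) q = N + (q - 1)" unfolding N_def by (simp only: add_mult_distrib mult_1)
  have "card (approx_winding_partitions N d q f' \<eta>) \<ge> fact (q - 1) ^ d"
    by (rule card_approx_winding_ge) (rule many[unfolded M])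
  then show thesis using that f' unfolding N_def by blast
qed

section \<open>Limits of approximate winding partitions\<close>

definition close_approximation ::
    "nat \<Rightarrow> nat \<Rightarrow> ((nat \<Rightarrow> real) \<Rightarrow> nat \<Rightarrow> real) \<Rightarrow> real \<Rightarrow> ((nat \<Rightarrow> real) \<Rightarrow> nat \<Rightarrow> real) \<Rightarrow> bool"
  where "close_approximation N d f \<eta> f' \<longleftrightarrow> continuous_on (skeleton N (d - 1)) f' \<and> (\<forall>x. f' x \<in> coords d) \<and>
    (\<forall>x\<in>skeleton N (d - 1). \<forall>k<d. \<bar>f' x k - f x k\<bar> < \<eta>)"

lemma tendsto_coordinate:
  fixes X :: "nat \<Rightarrow> nat \<Rightarrow> real"
  assumes "X \<longlonglongrightarrow> x"
  shows "(\<lambda>n. X n k) \<longlonglongrightarrow> x k"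
  using continuous_on_tendsto_compose[OF continuous_on_apply[of UNIV k] assms] by simp

text \<open>On a \<open>d\<close>-face, \<open>G\<close> becomes an extension of \<open>f'\<close>
  by adding a Tietze extension of \<open>f' - f\<close> from the boundary, still bounded by
  \<open>\<eta>\<close>. The result must enter the cell of \<open>p\<close>; the correction and the
  side of the cell cost \<open>\<eta>\<close> each.\<close>

lemma approx_winding_near:
  assumes d: "d > 0" and f: "continuous_on (skeleton N (d - 1)) f" "\<And>x. f x \<in> coords d"
    and f': "close_approximation N d f \<eta> f'" and \<eta>: "\<eta> > 0"
    and A: "A \<in> faces N d" and p: "p \<in> cell d \<eta> c" "card A \<le> d \<Longrightarrow> p \<in> f' ` realization A"
      "card A = d + 1 \<Longrightarrow> extensions_hit d A f' (cell d \<eta> c)"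
    and G: "continuous_on (realization A) G" "G \<in> realization A \<rightarrow> coords d"
      "\<And>x. x \<in> realization A \<Longrightarrow> x \<in> skeleton N (d - 1) \<Longrightarrow> G x = f x"
  shows "\<exists>x\<in>realization A. \<forall>k<d. \<bar>G x k - p k\<bar> \<le> 2 * \<eta>"
proof (cases "card A \<le> d")
  case True
  then obtain x where x: "x \<in> realization A" "p = f' x" using p(2) by auto
  have "A \<in> faces N (d - 1)" using facesD[OF A] True d by (intro facesI) auto
  then have xs: "x \<in> skeleton N (d - 1)" using x(1) realization_subset_skeleton by blast
  have "\<bar>G x k - p k\<bar> \<le> 2 * \<eta>" if "k < d" for k
  proof -
    have "\<bar>f' x k - f x k\<bar> < \<eta>" using f' xs that unfolding close_approximation_def by blast
    then show ?thesis using G(3)[OF x(1) xs] x(2) \<eta> by (simp add: abs_minus_commute)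
  qed
  then show ?thesis using x(1) by blast
next
  case False
  note fA = facesD[OF A]
  have cA: "card A = d + 1" using False fA(4) by simp
  have bs: "boundary A \<subseteq> skeleton N (d - 1)" "boundary A \<subseteq> realization A"
    using boundary_subset_skeleton[OF fA(3) cA] boundary_subset[OF fA(1)] by auto
  have "closed (boundary A)" by (rule compact_imp_closed[OF compact_boundary[OF fA(1)]])
  moreover have "continuous_on (boundary A) (\<lambda>x i. f' x i - f x i)"
  proof (rule continuous_on_coordinatewise_then_product)
    have "continuous_on (boundary A) f" "continuous_on (boundary A) f'"
      using continuous_on_subset[OF _ bs(1)] f(1) f' unfolding close_approximation_def by blast+
    then show "continuous_on (boundary A) (\<lambda>x. f' x i - f x i)" for i
      by (intro continuous_on_diff; elim continuous_on_coordinate)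
  qed
  moreover have "(\<lambda>x i. f' x i - f x i) \<in> boundary A \<rightarrow> coords d"
    using f(2) f' unfolding close_approximation_def by auto
  moreover have "\<bar>f' x i - f x i\<bar> \<le> \<eta>" if "x \<in> boundary A" for x i
  proof (cases "i < d")
    case True
    then have "\<bar>f' x i - f x i\<bar> < \<eta>" using that bs(1) f' unfolding close_approximation_def by blast
    then show ?thesis by simp
  next
    case False
    then have "f' x i = 0" "f x i = 0" using f(2)[of x] f' unfolding close_approximation_def by auto
    then show ?thesis using \<eta> by simp
  qed
  moreover have "0 \<le> \<eta>" using \<eta> by simp
  ultimately obtain e where e: "continuous_on UNIV e" "\<And>x. e x \<in> coords d"
    "\<And>x. x \<in> boundary A \<Longrightarrow> e x = (\<lambda>i. f' x i - f x i)" "\<And>x i. \<bar>e x i\<bar> \<le> \<eta>"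
    using Tietze_coords_bounded[of "boundary A" "\<lambda>x i. f' x i - f x i" d \<eta>] by blast
  let ?G = "\<lambda>x i. G x i + e x i"
  have "continuous_on (realization A) ?G"
  proof (rule continuous_on_coordinatewise_then_product)
    show "continuous_on (realization A) (\<lambda>x. G x i + e x i)" for i
      by (intro continuous_on_add continuous_on_coordinate[OF G(1)]
          continuous_on_coordinate[OF continuous_on_subset[OF e(1)]]) simp
  qed
  moreover have "?G \<in> realization A \<rightarrow> coords d" using G(2) e(2) by (auto simp: Pi_iff)
  moreover have "?G x = f' x" if "x \<in> boundary A" for x
    using e(3)[OF that] G(3)[of x] bs that by (auto simp: fun_eq_iff)
  ultimately obtain x where x: "x \<in> realization A" "?G x \<in> cell d \<eta> c"
    using p(3)[OF cA] unfolding extensions_hit_def by blast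
  have "\<bar>G x k - p k\<bar> \<le> 2 * \<eta>" if "k < d" for k
    using cell_near[OF x(2) p(1) \<eta> that] e(4)[of x k] by linarith
  then show ?thesis using x(1) by blast
qed

text \<open>The approximate common points accumulate at some \<open>p0\<close> by compactness. Every
  extension of \<open>f\<close> to a member comes arbitrarily close to \<open>p0\<close>, hence
  attains it. Outside the winding set, \<open>winding_set_extension\<close> would supply an
  extension missing \<open>p0\<close>.\<close>

lemma approx_winding_limit:
  assumes d: "d > 0" and q: "q > 0" and f: "continuous_on (skeleton N (d - 1)) f" "\<And>x. f x \<in> coords d"
    and P: "\<And>n. \<exists>\<eta> f'. 0 < \<eta> \<and> \<eta> \<le> 1 / real (Suc n) \<and> close_approximation N d f \<eta> f' \<and>
      P \<in> approx_winding_partitions N d q f' \<eta>"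
    and g: "\<And>x. x \<in> skeleton N (d - 1) \<Longrightarrow> g x = f x"
  shows "P \<in> winding_partitions N d q g"
proof -
  have PF: "P \<subseteq> faces N d" "card P = q" "disjoint P"
    using P[of 0] unfolding approx_winding_partitions_def by auto
  \<comment> \<open>The quantifier over all test maps \<open>G\<close> comes after \<open>p\<close>:
    the limit point must serve all of them.\<close>
  define R where "R n p \<longleftrightarrow> p \<in> coords d \<and> (\<forall>A\<in>P. \<forall>G. continuous_on (realization A) G \<longrightarrow>
      G \<in> realization A \<rightarrow> coords d \<longrightarrow> (\<forall>x\<in>realization A. x \<in> skeleton N (d - 1) \<longrightarrow> G x = f x) \<longrightarrow>
      (\<exists>x\<in>realization A. \<forall>k<d. \<bar>G x k - p k\<bar> \<le> 2 / real (Suc n)))" for n p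
  have "\<exists>p. R n p" for n
  proof -
    obtain \<eta> f' where \<eta>: "0 < \<eta>" "\<eta> \<le> 1 / real (Suc n)" "close_approximation N d f \<eta> f'"
      "P \<in> approx_winding_partitions N d q f' \<eta>" using P by blast
    obtain p c where p: "p \<in> coords d" "p \<in> cell d \<eta> c"
      "\<And>A. A \<in> P \<Longrightarrow> card A \<le> d \<Longrightarrow> p \<in> f' ` realization A"
      "\<And>A. A \<in> P \<Longrightarrow> card A = d + 1 \<Longrightarrow> extensions_hit d A f' (cell d \<eta> c)"
      using \<eta>(4) unfolding approx_winding_partitions_def by blast
    have "\<exists>x\<in>realization A. \<forall>k<d. \<bar>G x k - p k\<bar> \<le> 2 / real (Suc n)"
      if A: "A \<in> P" and G: "continuous_on (realization A) G" "G \<in> realization A \<rightarrow> coords d"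
        "\<forall>x\<in>realization A. x \<in> skeleton N (d - 1) \<longrightarrow> G x = f x" for A G
    proof -
      have "A \<in> faces N d" using A PF(1) by blast
      then obtain x where x: "x \<in> realization A" "\<forall>k<d. \<bar>G x k - p k\<bar> \<le> 2 * \<eta>"
        using approx_winding_near[OF d f \<eta>(3,1) _ p(2) p(3,4)[OF A] G(1,2)] G(3) by blast
      have "2 * \<eta> \<le> 2 / real (Suc n)" using \<eta>(2) by simp
      then show ?thesis using x by (meson order_trans)
    qed
    then show ?thesis using p(1) unfolding R_def by blast
  qed
  then obtain p where "\<And>n. R n (p n)" by metis
  then have p: "\<And>n. p n \<in> coords d"
    and near: "\<And>n A G. A \<in> P \<Longrightarrow> continuous_on (realization A) G \<Longrightarrow> G \<in> realization A \<rightarrow> coords d \<Longrightarrow>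
      \<forall>x\<in>realization A. x \<in> skeleton N (d - 1) \<longrightarrow> G x = f x \<Longrightarrow>
      \<exists>x\<in>realization A. \<forall>k<d. \<bar>G x k - p n k\<bar> \<le> 2 / real (Suc n)"
    unfolding R_def by blast+
  obtain F where F: "continuous_on UNIV F" "\<And>x. F x \<in> coords d" "\<And>x. x \<in> skeleton N (d - 1) \<Longrightarrow> F x = f x"
    using Tietze_coords[OF compact_imp_closed[OF compact_skeleton] f(1), of d] f(2) by blast
  obtain A0 where A0: "A0 \<in> P" using PF(2) q by fastforce
  have fin: "finite A" if "A \<in> P" for A using that PF(1) facesD(1) by blast
  have "\<exists>b. \<forall>x\<in>realization A0. \<bar>F x k\<bar> \<le> b" for k
  proof -
    have "bounded ((\<lambda>x. F x k) ` realization A0)"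
      using continuous_on_subset[OF F(1)] compact_realization[OF fin[OF A0]]
      by (intro compact_imp_bounded compact_continuous_image continuous_on_coordinate) auto
    then show ?thesis unfolding bounded_iff by auto
  qed
  then obtain b where b: "\<And>k x. x \<in> realization A0 \<Longrightarrow> \<bar>F x k\<bar> \<le> b k" by metis
  \<comment> \<open>Coordinates from \<open>d\<close> on are pinned to 0; the summand 2 covers the
    error \<open>2 / real (Suc n)\<close> for every \<open>n\<close>.\<close>
  define box where "box = {x :: nat \<Rightarrow> real. \<forall>i. - (if i < d then b i + 2 else 0) \<le> x i \<and> x i \<le> (if i < d then b i + 2 else 0)}"
  have "p n \<in> box" for n
  proof -
    obtain x where x: "x \<in> realization A0" "\<forall>k<d. \<bar>F x k - p n k\<bar> \<le> 2 / real (Suc n)"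
      using near[OF A0 continuous_on_subset[OF F(1)], of n] F(2,3) by blast
    have le: "\<bar>p n k\<bar> \<le> b k + 2" if "k < d" for k
    proof -
      have "2 / real (Suc n) \<le> 2" by (simp add: field_simps)
      then have "\<bar>F x k - p n k\<bar> \<le> 2" using x(2) that by (meson order_trans)
      then show ?thesis using b[OF x(1), of k] by linarith
    qed
    have "- (if i < d then b i + 2 else 0) \<le> p n i \<and> p n i \<le> (if i < d then b i + 2 else 0)" for i
    proof (cases "i < d")
      case True
      then show ?thesis using le[OF True] by (simp only: if_True) linarith
    qed (use p[of n] in auto)
    then show ?thesis unfolding box_def by blast
  qed
  then have pbox: "\<forall>n. p n \<in> box" by blast
  have cbox: "compact box" unfolding box_def by (rule compact_box)
  obtain p0 r where r: "p0 \<in> box" "strict_mono r" "(p \<circ> r) \<longlonglongrightarrow> p0"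
    using seq_compactE[OF compact_imp_seq_compact[OF cbox] pbox] by blast
  have p0: "p0 \<in> coords d"
  proof -
    have "p0 i = 0" if "i \<ge> d" for i
    proof -
      have "- (if i < d then b i + 2 else 0) \<le> p0 i \<and> p0 i \<le> (if i < d then b i + 2 else 0)"
        using r(1) unfolding box_def by blast
      then show ?thesis using that by simp
    qed
    then show ?thesis by blast
  qed
  have mem: "p0 \<in> G ` realization A"
    if A: "A \<in> P" and G: "continuous_on (realization A) G" "G \<in> realization A \<rightarrow> coords d"
      "\<forall>x\<in>realization A. x \<in> skeleton N (d - 1) \<longrightarrow> G x = f x" for A G
  proof -
    have "\<exists>x\<in>realization A. \<forall>k<d. \<bar>G x k - p (r n) k\<bar> \<le> 2 / real (Suc (r n))" for n
      using near[OF A G] .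
    then obtain x where x: "\<And>n. x n \<in> realization A" "\<And>n k. k < d \<Longrightarrow> \<bar>G (x n) k - p (r n) k\<bar> \<le> 2 / real (Suc (r n))"
      by metis
    have xA: "\<forall>n. x n \<in> realization A" using x(1) by blast
    obtain x0 s where s: "x0 \<in> realization A" "strict_mono s" "(x \<circ> s) \<longlonglongrightarrow> x0"
      using seq_compactE[OF compact_imp_seq_compact[OF compact_realization[OF fin[OF A]]] xA] by blast
    have Gs: "(\<lambda>n. G (x (s n))) \<longlonglongrightarrow> G x0"
      using continuous_on_tendsto_compose[OF G(1), of "x \<circ> s" x0 sequentially] s(1,3) x(1) by (simp add: o_def)
    have ps: "(\<lambda>n. p (r (s n))) \<longlonglongrightarrow> p0"
      using LIMSEQ_subseq_LIMSEQ[OF r(3) s(2)] by (simp add: o_def)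
    have "G x0 k = p0 k" if k: "k < d" for k
    proof -
      have "(\<lambda>n. 2 / real (Suc n)) \<longlonglongrightarrow> 0" by (rule LIMSEQ_Suc[OF lim_const_over_n])
      then have "(\<lambda>n. 2 / real (Suc (r (s n)))) \<longlonglongrightarrow> 0"
        using LIMSEQ_subseq_LIMSEQ[OF _ strict_mono_o[OF r(2) s(2)], of "\<lambda>n. 2 / real (Suc n)" 0]
        by (simp add: o_def)
      then have "(\<lambda>n. G (x (s n)) k - p (r (s n)) k) \<longlonglongrightarrow> 0"
        by (rule Lim_null_comparison[rotated]) (use x(2)[OF k] in simp)
      moreover have "(\<lambda>n. G (x (s n)) k - p (r (s n)) k) \<longlonglongrightarrow> G x0 k - p0 k"
        by (intro tendsto_diff tendsto_coordinate Gs ps)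
      ultimately have "G x0 k - p0 k = 0" by (rule LIMSEQ_unique[rotated])
      then show ?thesis by simp
    qed
    moreover have "G x0 k = p0 k" if "k \<ge> d" for k
    proof -
      have "G x0 \<in> coords d" using G(2) s(1) by blast
      then show ?thesis using p0 that by simp
    qed
    ultimately have "G x0 = p0" by (metis ext not_le)
    then show ?thesis using s(1) by blast
  qed
  have low: "p0 \<in> g ` realization A" if A: "A \<in> P" "card A \<le> d" for A
  proof -
    have "A \<in> faces N (d - 1)" using A PF(1) facesD[of A N d] d by (intro facesI) auto
    then have sub: "realization A \<subseteq> skeleton N (d - 1)" by (rule realization_subset_skeleton)
    then have "p0 \<in> f ` realization A" using mem[OF A(1) continuous_on_subset[OF f(1)]] f(2) by blast
    then show ?thesis using g sub by (metis (no_types, lifting) image_cong subsetD)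
  qed
  have high: "p0 \<in> winding_set d A g" if A: "A \<in> P" "card A = d + 1" for A
  proof (rule ccontr)
    assume np: "p0 \<notin> winding_set d A g"
    have AN: "A \<subseteq> {..N}" using A(1) PF(1) facesD(3) by blast
    note bs = boundary_subset_skeleton[OF AN A(2)]
    have gf: "g x = f x" if "x \<in> boundary A" for x using g bs that by blast
    have "continuous_on (boundary A) g"
      by (rule continuous_on_eq[OF continuous_on_subset[OF f(1) bs]]) (simp add: gf)
    moreover have "g \<in> boundary A \<rightarrow> coords d" using f(2) gf by auto
    ultimately obtain G where G: "continuous_on (realization A) G" "G \<in> realization A \<rightarrow> coords d - {p0}"
      "\<And>x. x \<in> boundary A \<Longrightarrow> G x = g x"
      using winding_set_extension[OF A(2) d _ _ p0 np] by blast
    have "G x = f x" if x: "x \<in> realization A" "x \<in> skeleton N (d - 1)" for x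
    proof -
      have "supp x \<noteq> A" using skeleton_supp(3)[OF x(2)] A(2) d by auto
      then show ?thesis using G(3) gf boundaryI[OF fin[OF A(1)] x(1)] by simp
    qed
    then have "p0 \<in> G ` realization A" using mem[OF A(1) G(1)] G(2) by blast
    then show False using G(2) by auto
  qed
  have "card A \<le> d" if "face_dim A \<le> d - 1" for A :: "nat set" using that d by (simp add: face_dim_def)
  moreover have "card A = d + 1" if "face_dim A = d" for A :: "nat set" using that d by (simp add: face_dim_def)
  ultimately show ?thesis
    unfolding winding_partitions_def topspace_Euclidean_space using PF p0 low high by blast
qed

section \<open>Comparison of the three statements\<close>

lemma skeleton_subset_simplex: "skeleton N k \<subseteq> standard_simplex N"
  unfolding skeleton_def realization_atMost[symmetric]
  using realization_mono[of _ "{..N}"] facesD(3) by blast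

lemma skeleton_mono: "k \<le> l \<Longrightarrow> skeleton N k \<subseteq> skeleton N l"
  unfolding skeleton_def using faces_mono by blast

lemma tverberg_partitions_mono:
  assumes "faces N k \<subseteq> faces N l"
  shows "card (tverberg_partitions N k q f) \<le> card (tverberg_partitions N l q f)"
proof (rule card_mono)
  show "finite (tverberg_partitions N l q f)"
    by (rule finite_subset[of _ "Pow (faces N l)"]) (auto simp: tverberg_partitions_def finite_faces)
qed (use assms in \<open>auto simp: tverberg_partitions_def\<close>)

lemma finite_winding_partitions: "finite (winding_partitions N d q f)"
  by (rule finite_subset[of _ "Pow (faces N d)"]) (auto simp: winding_partitions_def finite_faces)

lemma winding_partitions_subset_tverberg:
  assumes d: "d > 0" and f: "continuous_on (skeleton N d) f" "f \<in> skeleton N d \<rightarrow> coords d" and q: "q > 0"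
  shows "winding_partitions N d q f \<subseteq> tverberg_partitions N d q f"
proof
  fix P assume "P \<in> winding_partitions N d q f"
  then obtain p where P: "P \<subseteq> faces N d" "card P = q" "disjoint P"
    and p: "\<And>A. A \<in> P \<Longrightarrow> face_dim A \<le> d - 1 \<Longrightarrow> p \<in> f ` realization A"
      "\<And>A. A \<in> P \<Longrightarrow> face_dim A = d \<Longrightarrow> p \<in> winding_set d A f"
    unfolding winding_partitions_def by blast
  have "p \<in> f ` realization A" if A: "A \<in> P" for A
  proof (cases "face_dim A \<le> d - 1")
    case False
    have AF: "A \<in> faces N d" using A P(1) by blast
    then have dim: "face_dim A = d" using False by (auto simp: faces_def)
    then have "card A = d + 1" using d card_face by blast
    moreover have "continuous_on (realization A) f" "f \<in> realization A \<rightarrow> coords d"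
      using continuous_on_subset[OF f(1)] f(2) realization_subset_skeleton[OF AF] by blast+
    ultimately show ?thesis using winding_set_subset_image d p(2)[OF A dim] by blast
  qed (use p A in blast)
  then show "P \<in> tverberg_partitions N d q f"
    unfolding tverberg_partitions_def using P by blast
qed

text \<open>There are finitely many candidate sets of faces, and each that is no winding partition
  fails to be an approximate one at all sufficiently fine scales. Beyond the finest of these scales,
  a single approximation already supplies enough winding partitions.\<close>

lemma card_winding_partitions_ge:
  assumes d: "d > 0" and q: "q \<ge> 2"
    and f: "continuous_on (skeleton (tverberg_dim d q) (d - 1)) f" "\<And>x. f x \<in> coords d"
    and many: "\<And>F. continuous_on (realization {..tverberg_dim (d + 1) q}) F \<Longrightarrow>
      F \<in> realization {..tverberg_dim (d + 1) q} \<rightarrow> coords (d + 1) \<Longrightarrow>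
      card (tverberg_partitions (tverberg_dim (d + 1) q) (tverberg_dim (d + 1) q) q F) \<ge> fact (q - 1) ^ (d + 1)"
    and g: "\<And>x. x \<in> skeleton (tverberg_dim d q) (d - 1) \<Longrightarrow> g x = f x"
  shows "card (winding_partitions (tverberg_dim d q) d q g) \<ge> fact (q - 1) ^ d"
proof -
  define N where "N = tverberg_dim d q"
  define far where "far P n \<longleftrightarrow> (\<forall>\<eta> f'. 0 < \<eta> \<longrightarrow> \<eta> \<le> 1 / real (Suc n) \<longrightarrow> close_approximation N d f \<eta> f' \<longrightarrow>
      P \<notin> approx_winding_partitions N d q f' \<eta>)" for P n
  have "\<exists>n. P \<notin> winding_partitions N d q g \<longrightarrow> far P n" for P
  proof (rule ccontr)
    assume *: "\<nexists>n. P \<notin> winding_partitions N d q g \<longrightarrow> far P n"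
    have "P \<in> winding_partitions N d q g"
    proof (rule approx_winding_limit[OF d _ f[folded N_def]])
      show "\<exists>\<eta> f'. 0 < \<eta> \<and> \<eta> \<le> 1 / real (Suc n) \<and> close_approximation N d f \<eta> f' \<and>
        P \<in> approx_winding_partitions N d q f' \<eta>" for n
        using * unfolding far_def by blast
    qed (use q g in \<open>auto simp: N_def\<close>)
    then show False using * by blast
  qed
  then obtain m where m: "\<And>P. P \<notin> winding_partitions N d q g \<Longrightarrow> far P (m P)" by metis
  define n where "n = Max (m ` Pow (faces N d))"
  define \<eta> where "\<eta> = 1 / real (Suc n)"
  obtain f' where f': "continuous_on (skeleton N (d - 1)) f'" "\<And>x. f' x \<in> coords d"
    "\<And>x k. x \<in> skeleton N (d - 1) \<Longrightarrow> k < d \<Longrightarrow> \<bar>f' x k - f x k\<bar> < \<eta>"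
    "card (approx_winding_partitions N d q f' \<eta>) \<ge> fact (q - 1) ^ d"
    using approximation_with_many_partitions[OF d q _ f many, of \<eta>] unfolding \<eta>_def N_def by auto
  have "approx_winding_partitions N d q f' \<eta> \<subseteq> winding_partitions N d q g"
  proof
    fix P assume P: "P \<in> approx_winding_partitions N d q f' \<eta>"
    show "P \<in> winding_partitions N d q g"
    proof (rule ccontr)
      assume "P \<notin> winding_partitions N d q g"
      then have "far P (m P)" by (rule m)
      moreover have "m P \<le> n"
        unfolding n_def using P finite_faces by (intro Max_ge) (auto simp: approx_winding_partitions_def)
      then have "\<eta> \<le> 1 / real (Suc (m P))" unfolding \<eta>_def by (simp add: frac_le)
      moreover have "close_approximation N d f \<eta> f'" unfolding close_approximation_def using f' by blast
      moreover have "\<eta> > 0" unfolding \<eta>_def by simp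
      ultimately show False using P unfolding far_def by blast
    qed
  qed
  from card_mono[OF finite_winding_partitions this] f'(4) show ?thesis unfolding N_def by linarith
qed

theorem theorem2p3p3:
  shows "((\<forall>d q. d > 0 \<longrightarrow> q > 0 \<longrightarrow>
             (\<forall>f. continuous_map (coord_top (standard_simplex (tverberg_dim d q))) (Euclidean_space d) f \<longrightarrow>
                  card (tverberg_partitions (tverberg_dim d q) (tverberg_dim d q) q f) \<ge> fact (q - 1) ^ d))
          \<longleftrightarrow>
          (\<forall>d q. d > 0 \<longrightarrow> q > 0 \<longrightarrow>
             (\<forall>f. continuous_map (coord_top (skeleton (tverberg_dim d q) d)) (Euclidean_space d) f \<longrightarrow>
                  card (tverberg_partitions (tverberg_dim d q) d q f) \<ge> fact (q - 1) ^ d)))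
       \<and>
         ((\<forall>d q. d > 0 \<longrightarrow> q > 0 \<longrightarrow>
             (\<forall>f. continuous_map (coord_top (skeleton (tverberg_dim d q) d)) (Euclidean_space d) f \<longrightarrow>
                  card (tverberg_partitions (tverberg_dim d q) d q f) \<ge> fact (q - 1) ^ d))
          \<longleftrightarrow>
          (\<forall>d q. d > 0 \<longrightarrow> q > 0 \<longrightarrow>
             (\<forall>f. continuous_map (coord_top (skeleton (tverberg_dim d q) (d - 1))) (Euclidean_space d) f \<longrightarrow>
                  card (winding_partitions (tverberg_dim d q) d q f) \<ge> fact (q - 1) ^ d)))"
    (is "(?T1 \<longleftrightarrow> ?T2) \<and> (_ \<longleftrightarrow> ?T3)")
proof -
  have restrict: "continuous_map (coord_top S) (Euclidean_space d) f"
    if "continuous_map (coord_top T) (Euclidean_space d) f" "S \<subseteq> T" for S T d f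
    using that unfolding continuous_map_coord_top_iff by (auto intro: continuous_on_subset)
  \<comment> \<open>This covers \<open>k > N\<close>, which occurs for \<open>q = 1\<close>, where
    \<open>N = 0\<close> and \<open>k = d\<close>.\<close>
  have faces_le: "faces N k \<subseteq> faces N N" for N k
  proof
    fix A assume A: "A \<in> faces N k"
    then have "card A \<le> N + 1" using facesD(3)[OF A] card_mono[of "{..N}" A] by simp
    then show "A \<in> faces N N" using facesD[OF A] by (intro facesI)
  qed
  have T21: ?T1 if T2: ?T2
  proof (intro allI impI)
    fix d q f assume dq: "d > (0::nat)" "q > (0::nat)"
      and f: "continuous_map (coord_top (standard_simplex (tverberg_dim d q))) (Euclidean_space d) f"
    have "fact (q - 1) ^ d \<le> card (tverberg_partitions (tverberg_dim d q) d q f)"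
      using T2 dq restrict[OF f skeleton_subset_simplex] by blast
    also have "\<dots> \<le> card (tverberg_partitions (tverberg_dim d q) (tverberg_dim d q) q f)"
      by (rule tverberg_partitions_mono[OF faces_le])
    finally show "fact (q - 1) ^ d \<le> card (tverberg_partitions (tverberg_dim d q) (tverberg_dim d q) q f)" .
  qed
  have T32: ?T2 if T3: ?T3
  proof (intro allI impI)
    fix d q f assume dq: "d > (0::nat)" "q > (0::nat)"
      and f: "continuous_map (coord_top (skeleton (tverberg_dim d q) d)) (Euclidean_space d) f"
    have "fact (q - 1) ^ d \<le> card (winding_partitions (tverberg_dim d q) d q f)"
      using T3 dq restrict[OF f skeleton_mono[OF diff_le_self]] by blast
    also have "\<dots> \<le> card (tverberg_partitions (tverberg_dim d q) d q f)"
    proof (rule card_mono)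
      show "finite (tverberg_partitions (tverberg_dim d q) d q f)"
        by (rule finite_subset[of _ "Pow (faces (tverberg_dim d q) d)"])
          (auto simp: tverberg_partitions_def finite_faces)
      show "winding_partitions (tverberg_dim d q) d q f \<subseteq> tverberg_partitions (tverberg_dim d q) d q f"
        using f dq unfolding continuous_map_coord_top_iff by (intro winding_partitions_subset_tverberg) auto
    qed
    finally show "fact (q - 1) ^ d \<le> card (tverberg_partitions (tverberg_dim d q) d q f)" .
  qed
  have T13: ?T3 if T1: ?T1
  proof (intro allI impI)
    fix d q f assume dq: "d > (0::nat)" "q > (0::nat)"
      and f: "continuous_map (coord_top (skeleton (tverberg_dim d q) (d - 1))) (Euclidean_space d) f"
    show "fact (q - 1) ^ d \<le> card (winding_partitions (tverberg_dim d q) d q f)"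
    proof (cases "q = 1")
      \<comment> \<open>Here \<open>N = 0\<close> and the bound is 1: the single vertex forms a
        partition.\<close>
      case True
      have v: "vertex 0 \<in> realization {0}" by (simp add: vertex_in_realization)
      have face: "{0} \<in> faces 0 k" for k by (intro facesI) auto
      have "f (vertex 0) \<in> coords d"
        using f v realization_subset_skeleton[OF face[of "d - 1"]] True
        unfolding continuous_map_coord_top_iff by auto
      then have "{{0}} \<in> winding_partitions 0 d 1 f"
        unfolding winding_partitions_def topspace_Euclidean_space
        using face v dq by (auto simp: face_dim_def disjoint_def intro!: bexI[of _ "f (vertex 0)"])
      then have "card (winding_partitions 0 d 1 f) > 0"
        using finite_winding_partitions by (auto simp: card_gt_0_iff)
      then show ?thesis using True by simp
    next
      case False
      then have q2: "q \<ge> 2" using dq by simp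
      let ?X = "skeleton (tverberg_dim d q) (d - 1)"
      have fX: "continuous_on ?X f" "f \<in> ?X \<rightarrow> coords d" using f unfolding continuous_map_coord_top_iff by auto
      \<comment> \<open>Only the values on the skeleton are given; the value 0 elsewhere keeps the
        whole map in \<open>coords d\<close>.\<close>
      define f0 where "f0 x = (if x \<in> ?X then f x else (\<lambda>_. 0))" for x
      show ?thesis
      proof (rule card_winding_partitions_ge[OF dq(1) q2, of f0])
        show "continuous_on ?X f0" by (rule continuous_on_eq[OF fX(1)]) (simp add: f0_def)
        show "f0 x \<in> coords d" for x using fX(2) by (auto simp: f0_def)
        show "f x = f0 x" if "x \<in> ?X" for x using that by (simp add: f0_def)
        show "fact (q - 1) ^ (d + 1) \<le> card (tverberg_partitions (tverberg_dim (d + 1) q) (tverberg_dim (d + 1) q) q F)"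
          if "continuous_on (realization {..tverberg_dim (d + 1) q}) F"
            "F \<in> realization {..tverberg_dim (d + 1) q} \<rightarrow> coords (d + 1)" for F
        proof -
          have "continuous_map (coord_top (standard_simplex (tverberg_dim (d + 1) q))) (Euclidean_space (d + 1)) F"
            unfolding continuous_map_coord_top_iff realization_atMost[symmetric] using that by simp
          then show ?thesis using T1[rule_format, of "d + 1" q F] dq(2) by linarith
        qed
      qed
    qed
  qed
  show ?thesis
    by (intro conjI iffI) (fact T32[OF T13], fact T21, fact T13[OF T21], fact T32)
qed

end
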